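(* Let $\mathcal X:y^n=f(x)$ be a superelliptic curve over $\mathbb F_q$ as in the context, and let $1\le s\le M-1$. Then $$G_s\wedge A_s=G_{M-s}\wedge A_{M-s},\qquad G_s\vee A_s=G_{M-s}\vee A_{M-s},\qquad t(s)=t(M-s),$$ and $$\dim\operatorname{Hull}(\mathcal C_s)-\dim\operatorname{Hull}(\mathcal C_{M-s})=\varepsilon(G_s,A_s)-\varepsilon(G_{M-s},A_{M-s}).$$ In particular, if $\varepsilon(G_s,A_s)=0$ for every $s$, then $\dim\operatorname{Hull}(\mathcal C_s)=\dim\operatorname{Hull}(\mathcal C_{M-s})$ for every $1\le s\le M-1$.
   Context: Setting. $q$ is a power of a prime $p$; $n\ge2$, $d\ge3$ are integers with $n\mid q-1$ (so $p\nmid n$); $c=\gcd(n,d)$; $f\in\mathbb F_q[x]$ is separable of degree $d$ with no root in $\mathbb F_q$. $\mathcal X$ is the smooth projective model of $y^n=f(x)$ over $\mathbb F_q$, of genus $g_{\mathcal X}=\frac{(n-1)(d-1)+1-c}{2}$, and $\pi:\mathcal X\to\mathbb P^1$, $(x,y)\mapsto x$. $\mathrm{Ram}$ is the reduced divisor of the $d$ geometric points over the roots of $f$, $D_\infty$ the reduced divisor of the $c$ geometric points over $x=\infty$. $D$ is the sum of all $\mathbb F_q$-rational points of $\mathcal X$ over $\mathbb A^1(\mathbb F_q)$, $N=\deg D$, and $E=\sum_{a\in\mathbb F_q}\pi^*(a)-D$ (effective). $\Delta=\{a\in\mathbb F_q:f(a)\notin(\mathbb F_q^* )^n\}$, $\delta=|\Delta|$.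 Codes. $L(G)=\{h\in\mathbb F_q(\mathcal X)^*:\operatorname{div}(h)+G\ge0\}\cup\{0\}$; for $G$ with support disjoint from $\operatorname{Supp} D$, $C_L(D,G)\subseteq\mathbb F_q^N$ is the image of evaluation of $L(G)$ at the points of $D$. For $s\ge1$: $G_s=sD_\infty$, $\mathcal C_s=C_L(D,G_s)$ (equivalently the span of the vectors $(x(P)^iy(P)^j)_{P}$, $i\ge0$, $0\le j\le n-1$, $\frac nc i+\frac dc j\le s$). $\operatorname{Hull}(C)=C\cap C^\perp$ for the standard bilinear form. $M=\frac{(q-1)n}{c}-1$, $\mu(s)=\min\{s,M-s\}$, and $A_s=(n-1)\mathrm{Ram}-E+(M-s)D_\infty$, for which $\mathcal C_s^\perp=C_L(D,A_s)$. Put $t(s)=2g_{\mathcal X}-2-c\,\mu(s)+n\delta$. $\wedge,\vee$ denote the coefficientwise minimum and maximum of divisors. The excess of a pair $(G,A)$ is $$\varepsilon(G,A)=\dim_{\mathbb F_q}\frac{(L(G)+L(A))\cap L(G\vee A-D)}{L(G-D)+L(A-D)}.$$ *)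

theory Defs
  imports
    "HOL-Algebra.Algebraic_Closure_Type"
    "HOL-Library.Cardinality"
    "HOL-Library.Function_Algebras"
begin

text \<open>
  The finite field is a type \<open>'k :: {field, finite}\<close>, so that \<open>q = CARD('k)\<close>. The curve
  \<open>y^n = f(x)\<close> is given by \<open>n\<close> and \<open>f :: 'k poly\<close>; throughout, \<open>d = degree f\<close>.
\<close>

section \<open>The function field\<close>

text \<open>
  The function field is realised as the subfield \<open>F = K(x)(y)\<close> of a fixed algebraic closure of
  the rational function field \<open>K(x)\<close>, with \<open>y\<close> a root of \<open>Y^n - f(x)\<close>.
\<close>

type_synonym 'k ambient = "'k poly fract alg_closure"

definition const :: "'k :: field \<Rightarrow> 'k ambient"
  where "const a = to_ac (to_fract [:a:])"

definition of_poly :: "'k :: field poly \<Rightarrow> 'k ambient"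
  where "of_poly p = to_ac (to_fract p)"

definition x_fun :: "'k :: field ambient"
  where "x_fun = of_poly [:0, 1:]"

text \<open>
  If \<open>n\<close> divides \<open>q - 1\<close> (the standing assumption), then \<open>K\<close> contains all \<open>n\<close>-th roots of unity,
  and the field generated by \<open>y\<close> does not depend on the root chosen here.
\<close>

definition y_fun :: "nat \<Rightarrow> 'k :: field poly \<Rightarrow> 'k ambient"
  where "y_fun n f = (SOME y. y ^ n = of_poly f)"

lemma y_fun_power:
  assumes "n > 0"
  shows "y_fun n f ^ n = of_poly f"
proof -
  have "\<exists>y. y ^ n = of_poly f"
    using nth_root_exists[OF assms, of "of_poly f"] by blast
  then show ?thesis
    unfolding y_fun_def by (rule someI_ex)
qed

text \<open>Since \<open>y\<close> is algebraic over \<open>K(x)\<close>, the ring \<open>K(x)[y]\<close> is the field \<open>K(x)(y)\<close>.\<close>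

definition function_field :: "nat \<Rightarrow> 'k :: field poly \<Rightarrow> 'k ambient set"
  where "function_field n f = range (\<lambda>r. poly (map_poly to_ac r) (y_fun n f))"

abbreviation fscale :: "'k :: field \<Rightarrow> 'k ambient \<Rightarrow> 'k ambient"
  where "fscale a h \<equiv> const a * h"

section \<open>Closed points and divisors\<close>

text \<open>
  The closed points of the smooth projective model correspond to the discrete valuations of \<open>F\<close>
  that are trivial on \<open>K\<close>; a point is represented by its normalised valuation. The value at
  \<open>0\<close>, which should be infinity, and the values outside \<open>F\<close> are irrelevant; they are fixed to
  be \<open>0\<close>, so that each valuation of \<open>F\<close> is represented exactly once.

  Divisors over \<open>K\<close> are integer-valued functions on closed points, extended by \<open>0\<close> to all
  functions of that type. As \<open>K\<close> is perfect, the sum of the geometric points lying over a closed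
  point \<open>P\<close> is the divisor \<open>P\<close>; so the reduced divisor of a Galois-stable finite set of
  geometric points has coefficient \<open>1\<close> at the closed points under it. Sums and differences of
  divisors are pointwise, and \<open>inf\<close> and \<open>sup\<close> on the function type are the coefficientwise
  minimum and maximum.
\<close>

type_synonym 'k place = "'k ambient \<Rightarrow> int"

type_synonym 'k divisor = "'k place \<Rightarrow> int"

definition places :: "nat \<Rightarrow> 'k :: field poly \<Rightarrow> 'k place set"
  where "places n f = {v.
    (\<forall>h. h \<notin> function_field n f \<or> h = 0 \<longrightarrow> v h = 0) \<and>
    v ` (function_field n f - {0}) = UNIV \<and>
    (\<forall>a. a \<noteq> 0 \<longrightarrow> v (const a) = 0) \<and>
    (\<forall>g \<in> function_field n f - {0}. \<forall>h \<in> function_field n f - {0}.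
      v (g * h) = v g + v h \<and> (g + h \<noteq> 0 \<longrightarrow> min (v g) (v h) \<le> v (g + h)))}"

definition valuation_ring :: "nat \<Rightarrow> 'k :: field poly \<Rightarrow> 'k place \<Rightarrow> 'k ambient set"
  where "valuation_ring n f P = {h \<in> function_field n f. h = 0 \<or> 0 \<le> P h}"

definition maximal_ideal :: "nat \<Rightarrow> 'k :: field poly \<Rightarrow> 'k place \<Rightarrow> 'k ambient set"
  where "maximal_ideal n f P = {h \<in> function_field n f. h = 0 \<or> 0 < P h}"

text \<open>
  The dimension of \<open>U / W\<close> for subspaces \<open>W \<subseteq> U\<close>: the cardinality of a set of representatives
  of a basis of the quotient space (\<open>0\<close> in the infinite-dimensional case, as for the library's
  \<open>dim\<close>).
\<close>

definition basis_modulo :: "('a :: field \<Rightarrow> 'b :: ab_group_add \<Rightarrow> 'b) \<Rightarrow> 'b set \<Rightarrow> 'b set \<Rightarrow> 'b set \<Rightarrow> bool"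
  where "basis_modulo scl U W B \<longleftrightarrow>
    module.span scl (B \<union> W) = U \<and>
    (\<forall>T c. finite T \<and> T \<subseteq> B \<and> (\<Sum>b\<in>T. scl (c b) b) \<in> W \<longrightarrow> (\<forall>b\<in>T. c b = 0))"

definition quot_dim :: "('a :: field \<Rightarrow> 'b :: ab_group_add \<Rightarrow> 'b) \<Rightarrow> 'b set \<Rightarrow> 'b set \<Rightarrow> nat"
  where "quot_dim scl U W = card (SOME B. basis_modulo scl U W B)"

definition place_degree :: "nat \<Rightarrow> 'k :: field poly \<Rightarrow> 'k place \<Rightarrow> nat"
  where "place_degree n f P = quot_dim fscale (valuation_ring n f P) (maximal_ideal n f P)"

definition divisors :: "nat \<Rightarrow> 'k :: field poly \<Rightarrow> 'k divisor set"
  where "divisors n f = {A. finite {P. A P \<noteq> 0} \<and> {P. A P \<noteq> 0} \<subseteq> places n f}"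

definition divisor_degree :: "nat \<Rightarrow> 'k :: field poly \<Rightarrow> 'k divisor \<Rightarrow> int"
  where "divisor_degree n f A = (\<Sum>P | A P \<noteq> 0. A P * int (place_degree n f P))"

definition riemann_roch_space :: "nat \<Rightarrow> 'k :: field poly \<Rightarrow> 'k divisor \<Rightarrow> 'k ambient set"
  where "riemann_roch_space n f G =
    {h \<in> function_field n f. h = 0 \<or> (\<forall>P \<in> places n f. 0 \<le> P h + G P)}"

text \<open>
  The genus is the one of the function field; for the curves in question it equals
  \<open>((n - 1) * (d - 1) + 1 - gcd n d) / 2\<close>.
\<close>

definition genus :: "nat \<Rightarrow> 'k :: field poly \<Rightarrow> int"
  where "genus n f = (SUP A \<in> divisors n f.
    divisor_degree n f A - int (vector_space.dim fscale (riemann_roch_space n f A)) + 1)"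

definition Ram :: "nat \<Rightarrow> 'k :: field poly \<Rightarrow> 'k divisor"
  where "Ram n f = (\<lambda>P. if P \<in> places n f \<and> 0 < P (of_poly f) then 1 else 0)"

definition D_inf :: "nat \<Rightarrow> 'k :: field poly \<Rightarrow> 'k divisor"
  where "D_inf n f = (\<lambda>P. if P \<in> places n f \<and> P x_fun < 0 then 1 else 0)"

definition eval_points :: "nat \<Rightarrow> 'k :: field poly \<Rightarrow> 'k place set"
  where "eval_points n f = {P \<in> places n f. place_degree n f P = 1 \<and> 0 \<le> P x_fun}"

definition D_div :: "nat \<Rightarrow> 'k :: field poly \<Rightarrow> 'k divisor"
  where "D_div n f = (\<lambda>P. if P \<in> eval_points n f then 1 else 0)"

text \<open>The function \<open>x - a\<close> is a uniformiser of the projective line at the point \<open>a\<close>, so the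
  ramification index of a point \<open>P\<close> above \<open>a\<close> is the valuation of \<open>x - a\<close> at \<open>P\<close>.\<close>

definition fibre :: "nat \<Rightarrow> 'k :: field poly \<Rightarrow> 'k \<Rightarrow> 'k divisor"
  where "fibre n f a =
    (\<lambda>P. if P \<in> places n f \<and> 0 < P (x_fun - const a) then P (x_fun - const a) else 0)"

definition E_div :: "nat \<Rightarrow> 'k :: {field, finite} poly \<Rightarrow> 'k divisor"
  where "E_div n f = (\<Sum>a\<in>UNIV. fibre n f a) - D_div n f"

section \<open>Codes\<close>

text \<open>
  A word of \<open>K^N\<close> is a function on the \<open>N\<close> points of \<open>D\<close>, extended by \<open>0\<close>.
\<close>

definition words :: "'p set \<Rightarrow> ('p \<Rightarrow> 'k :: field) set"
  where "words I = {w. \<forall>i. i \<notin> I \<longrightarrow> w i = 0}"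

abbreviation wscale :: "'k :: field \<Rightarrow> ('p \<Rightarrow> 'k) \<Rightarrow> 'p \<Rightarrow> 'k"
  where "wscale a w \<equiv> (\<lambda>i. a * w i)"

definition dual_code :: "'p set \<Rightarrow> ('p \<Rightarrow> 'k :: field) set \<Rightarrow> ('p \<Rightarrow> 'k) set"
  where "dual_code I C = {w \<in> words I. \<forall>u \<in> C. (\<Sum>i\<in>I. w i * u i) = 0}"

definition code_hull :: "'p set \<Rightarrow> ('p \<Rightarrow> 'k :: field) set \<Rightarrow> ('p \<Rightarrow> 'k) set"
  where "code_hull I C = C \<inter> dual_code I C"

text \<open>The value of \<open>h\<close> at a rational point is its residue class modulo the maximal ideal.\<close>

definition value_at :: "nat \<Rightarrow> 'k :: field poly \<Rightarrow> 'k ambient \<Rightarrow> 'k place \<Rightarrow> 'k"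
  where "value_at n f h P = (THE a. h - const a \<in> maximal_ideal n f P)"

text \<open>The code \<open>C_L(D, G)\<close>; it is only meaningful if the supports of \<open>G\<close> and \<open>D\<close> are disjoint.\<close>

definition AG_code :: "nat \<Rightarrow> 'k :: field poly \<Rightarrow> 'k divisor \<Rightarrow> ('k place \<Rightarrow> 'k) set"
  where "AG_code n f G =
    (\<lambda>h P. if P \<in> eval_points n f then value_at n f h P else 0) ` riemann_roch_space n f G"

definition G_div :: "nat \<Rightarrow> 'k :: field poly \<Rightarrow> int \<Rightarrow> 'k divisor"
  where "G_div n f s = (\<lambda>P. s * D_inf n f P)"

definition hull_dim :: "nat \<Rightarrow> 'k :: field poly \<Rightarrow> int \<Rightarrow> nat"
  where "hull_dim n f s =
    vector_space.dim wscale (code_hull (eval_points n f) (AG_code n f (G_div n f s)))"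

text \<open>The division is exact, as \<open>gcd n d\<close> divides \<open>n\<close>.\<close>

definition M_val :: "nat \<Rightarrow> 'k :: {field, finite} poly \<Rightarrow> int"
  where "M_val n f = (int CARD('k) - 1) * int n div int (gcd n (degree f)) - 1"

definition A_div :: "nat \<Rightarrow> 'k :: {field, finite} poly \<Rightarrow> int \<Rightarrow> 'k divisor"
  where "A_div n f s =
    (\<lambda>P. (int n - 1) * Ram n f P - E_div n f P + (M_val n f - s) * D_inf n f P)"

definition mu :: "nat \<Rightarrow> 'k :: {field, finite} poly \<Rightarrow> int \<Rightarrow> int"
  where "mu n f s = min s (M_val n f - s)"

definition Delta :: "nat \<Rightarrow> 'k :: field poly \<Rightarrow> 'k set"
  where "Delta n f = {a. poly f a \<notin> (\<lambda>b. b ^ n) ` (UNIV - {0})}"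

definition t_val :: "nat \<Rightarrow> 'k :: {field, finite} poly \<Rightarrow> int \<Rightarrow> int"
  where "t_val n f s =
    2 * genus n f - 2 - int (gcd n (degree f)) * mu n f s + int n * int (card (Delta n f))"

definition space_sum :: "'a :: ab_group_add set \<Rightarrow> 'a set \<Rightarrow> 'a set"
  where "space_sum U W = {u + w | u w. u \<in> U \<and> w \<in> W}"

definition excess :: "nat \<Rightarrow> 'k :: field poly \<Rightarrow> 'k divisor \<Rightarrow> 'k divisor \<Rightarrow> nat"
  where "excess n f G A = quot_dim fscale
    (space_sum (riemann_roch_space n f G) (riemann_roch_space n f A)
      \<inter> riemann_roch_space n f (sup G A - D_div n f))
    (space_sum (riemann_roch_space n f (G - D_div n f)) (riemann_roch_space n f (A - D_div n f)))"

section \<open>The vector space structures\<close>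

lemma const_add: "const (a + b) = const a + const b"
proof -
  have "[:a + b:] = [:a:] + [:b:]" by simp
  then show ?thesis unfolding const_def by (simp only: to_fract_add to_ac_add)
qed

lemma const_mult: "const (a * b) = const a * const b"
proof -
  have "[:a * b:] = [:a:] * [:b:]" by simp
  then show ?thesis unfolding const_def by (simp only: to_fract_mult to_ac_mult)
qed

lemma const_1: "const 1 = 1"
  by (simp add: const_def flip: one_pCons)

lemma vector_space_fscale: "vector_space (fscale :: 'k :: field \<Rightarrow> _)"
  by unfold_locales (simp_all add: const_add const_mult const_1 algebra_simps)

lemma vector_space_wscale: "vector_space (wscale :: 'k :: field \<Rightarrow> ('p \<Rightarrow> 'k) \<Rightarrow> _)"
  by unfold_locales (simp_all add: algebra_simps fun_eq_iff)

end

theory Submission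
  imports Defs "HOL-Number_Theory.Residues"
begin

text \<open>
  Let \<open>U = L(G_s)\<close> and \<open>V = L(A_s)\<close>, and let \<open>ev\<close> be the evaluation at the points of \<open>D\<close>. As \<open>ev V\<close>
  is the dual code of \<open>ev U\<close> (\<open>dual_AG_code\<close>), the hull is \<open>ev U \<inter> ev V\<close>. If \<open>ev u = ev v\<close> is a word
  of it, then \<open>u - v\<close> lies in the kernel of \<open>ev\<close> on \<open>U + V\<close>, which is
  \<open>(U + V) \<inter> L(G_s \<or> A_s - D)\<close>; its class modulo \<open>L(G_s - D) + L(A_s - D)\<close> determines the word up
  to \<open>ev (U \<inter> V)\<close>. Hence the dimension of the hull is the dimension of \<open>ev (L(G_s \<and> A_s))\<close> plus the
  excess (\<open>dim_image_Int_image\<close>, \<open>hull_dim_eq\<close>). At the points at infinity \<open>G_s\<close> has the coefficient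
  \<open>s\<close> and \<open>A_s\<close> the coefficient \<open>M - s\<close>, and all other coefficients are independent of \<open>s\<close>. So passing
  from \<open>s\<close> to \<open>M - s\<close> exchanges two coefficients, which changes neither the minimum nor the maximum,
  and the first summand is the same for both parameters.

  The duality is proved by explicit computation, without residues of differentials. The function
  field is the direct sum of the \<open>K(x) y^j\<close> for \<open>0 \<le> j < n\<close>. For a discrete valuation \<open>v0\<close> of \<open>K(x)\<close>
  the monomial \<open>r y^j\<close> has a weight proportional to \<open>n v0(r) + j v0(f)\<close>, and the functions whose
  monomials have weight at least \<open>k\<close> form a filtration. A monomial of weight \<open>0\<close> is a root of unity
  up to positive weight, so a power of Frobenius fixes the functions of weight at least \<open>0\<close> modulo
  those of positive weight (\<open>exists_frobenius_trivial\<close>). If \<open>h^Q\<close> is congruent to \<open>h\<close>, then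
  \<open>1 - h^(Q - 1)\<close> annihilates \<open>h\<close>, and this is enough to find all places over \<open>v0\<close>: they are
  unramified relative to the weight, prime ideals provide as many of them as necessary, and the
  filtration is the intersection of their valuation filtrations (\<open>filt_iff_places\<close>).

  Consequently \<open>L(s D_inf)\<close> is spanned by the monomials \<open>x^i y^j\<close> in it (\<open>riemann_roch_space_G_div\<close>),
  \<open>L(A_s)\<close> is \<open>w y^(1 - n) L(s' D_inf)\<close> for an explicit \<open>s'\<close> and the product \<open>w\<close> of all \<open>x - a\<close> with
  \<open>a \<in> \<Delta>\<close> (\<open>riemann_roch_space_A_div\<close>), and the rational points over the affine line are the pairs
  \<open>(a, b)\<close> with \<open>b^n = f(a)\<close> (\<open>point_code_D\<close>). The duality becomes a statement on polynomials over
  \<open>K\<close> (\<open>dual_code_eq\<close>): for each power of \<open>y\<close> it is the duality of Reed--Solomon codes.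
\<close>

section \<open>Finite fields and polynomials over them\<close>

lemma prime_CHAR_finite: "prime (CHAR('k :: {field, finite}))"
proof -
  have "CHAR('k) > 0"
    by (rule finite_imp_CHAR_pos) simp
  then show ?thesis
    by (rule prime_CHAR_semidom)
qed

lemma CARD_gt_1: "CARD('k :: {field, finite}) > 1"
proof -
  have "card {0, 1 :: 'k} \<le> CARD('k)"
    by (rule card_mono) auto
  then show ?thesis by simp
qed

lemma power_CARD_minus_1:
  fixes a :: "'k :: {field, finite}"
  assumes "a \<noteq> 0"
  shows "a ^ (CARD('k) - 1) = 1"
proof -
  have "(\<Prod>b\<in>UNIV - {0}. a * b) = (\<Prod>b\<in>UNIV - {0}. b)"
    by (rule prod.reindex_bij_witness[of _ "\<lambda>b. b / a" "\<lambda>b. a * b"]) (use assms in auto)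
  then have "a ^ (CARD('k) - 1) * (\<Prod>b\<in>UNIV - {0::'k}. b) = (\<Prod>b\<in>UNIV - {0}. b)"
    by (simp add: prod.distrib)
  moreover have "(\<Prod>b\<in>UNIV - {0::'k}. b) \<noteq> 0" by simp
  ultimately show ?thesis by simp
qed

lemma power_CARD:
  fixes a :: "'k :: {field, finite}"
  shows "a ^ CARD('k) = a"
proof (cases "a = 0")
  case False
  have "CARD('k) = Suc (CARD('k) - 1)" using CARD_gt_1[where 'k = 'k] by simp
  then have "a ^ CARD('k) = a * a ^ (CARD('k) - 1)" by (metis power_Suc)
  then show ?thesis using power_CARD_minus_1[OF False] by simp
qed (simp add: power_0_left)

lemma coprime_CARD_minus_1_CHAR: "coprime (CARD('k :: {field, finite}) - 1) CHAR('k)"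
proof -
  have "coprime (CARD('k) - 1) CARD('k)"
    by (intro coprime_diff_one_left_nat) (simp add: zero_less_card_finite)
  then show ?thesis
    by (rule coprime_divisors[OF dvd_refl CHAR_dvd_CARD])
qed

lemma coprime_CHAR_of_dvd:
  assumes "n dvd CARD('k :: {field, finite}) - 1"
  shows "coprime n CHAR('k)"
  by (rule coprime_divisors[OF assms dvd_refl coprime_CARD_minus_1_CHAR])

lemma of_nat_neq_0_of_dvd:
  assumes "n dvd CARD('k :: {field, finite}) - 1" 
  shows "of_nat n \<noteq> (0 :: 'k)"
proof
  assume "of_nat n = (0 :: 'k)"
  then have "CHAR('k) dvd n" by (simp add: of_nat_eq_0_iff_char_dvd)
  then show False
    using coprime_CHAR_of_dvd[OF assms] prime_CHAR_finite[where 'k = 'k]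
    by (meson coprime_absorb_right not_prime_unit)
qed

text \<open>
  The polynomial \<open>x^(q - 1) - 1 = (x^n - 1) g\<close> has \<open>q - 1\<close> different roots, and neither factor
  can have more roots than its degree.
\<close>

lemma card_roots_of_unity:
  assumes "n dvd CARD('k :: {field, finite}) - 1"
  shows "card {z :: 'k. z ^ n = 1} = n"
proof -
  let ?q = "CARD('k)"
  obtain k where k: "?q - 1 = n * k" using assms by blast
  have pos: "n > 0" "k > 0" using k CARD_gt_1[where 'k = 'k] by (auto intro: gr0I)
  define g :: "'k poly" where "g = (\<Sum>i<k. monom 1 (n * i))"
  have root: "z ^ n = 1 \<or> poly g z = 0" if "z \<noteq> 0" for z
  proof -
    have "(z ^ n - 1) * poly g z = (z ^ n - 1) * (\<Sum>i<k. (z ^ n) ^ i)"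
      by (simp add: g_def poly_sum poly_monom power_mult)
    also have "\<dots> = (z ^ n) ^ k - 1" by (simp add: power_diff_1_eq)
    also have "\<dots> = 0" using power_CARD_minus_1[OF that] k by (simp add: power_mult)
    finally show ?thesis by simp
  qed
  have "coeff g 0 = (\<Sum>i<k. if i = 0 then 1 else 0)"
    unfolding g_def coeff_sum by (rule sum.cong) (use pos in auto)
  also have "\<dots> = 1" using pos by simp
  finally have g0: "g \<noteq> 0" by auto
  have deg: "degree g \<le> n * (k - 1)"
    unfolding g_def
    by (rule degree_sum_le) (auto intro!: order.trans[OF degree_monom_le])
  let ?A = "{z :: 'k. z ^ n = 1}" and ?B = "{z. poly g z = 0}"
  have A: "card ?A \<le> n"
  proof -
    define h :: "'k poly" where "h = monom 1 n - 1"
    have h: "coeff h n = 1" using pos by (simp add: h_def)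
    have "degree h \<le> n" by (simp add: h_def degree_diff_le degree_monom_eq)
    moreover have "h \<noteq> 0" using h by auto
    moreover have "?A = {z. poly h z = 0}" by (simp add: h_def poly_monom)
    ultimately show ?thesis using card_poly_roots_bound[of h] by simp
  qed
  have "?q - 1 = card (UNIV - {0 :: 'k})" by (simp add: card_Diff_singleton)
  also have "\<dots> \<le> card (?A \<union> ?B)" by (rule card_mono) (use root in auto)
  also have "\<dots> \<le> card ?A + card ?B" by (rule card_Un_le)
  also have "card ?B \<le> n * (k - 1)" using card_poly_roots_bound[OF g0] deg by linarith
  finally have "n * k \<le> card ?A + n * (k - 1)" using k by simp
  then show ?thesis using A pos by (cases k) auto
qed

text \<open>
  Otherwise all \<open>n\<close> of the \<open>n\<close>-th roots of unity are roots of \<open>x^r - 1\<close> for \<open>r = k mod n\<close>.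
\<close>

lemma exists_root_of_unity_power_neq_1:
  assumes "n dvd CARD('k :: {field, finite}) - 1" "\<not> n dvd k"
  shows "\<exists>z :: 'k. z ^ n = 1 \<and> z ^ k \<noteq> 1"
proof (rule ccontr)
  assume "\<not> ?thesis"
  then have all: "z ^ k = 1" if "z ^ n = 1" for z :: 'k using that by blast
  define r where "r = k mod n"
  have n: "n > 0" using assms CARD_gt_1[where 'k = 'k] by (auto intro: gr0I)
  have r: "0 < r" "r < n" using assms(2) n by (auto simp: r_def mod_greater_zero_iff_not_dvd)
  have zr: "z ^ r = 1" if "z ^ n = 1" for z :: 'k
  proof -
    have "z ^ k = (z ^ n) ^ (k div n) * z ^ r"
      by (simp add: r_def flip: power_mult power_add)
    then show ?thesis using all that by simp
  qed
  define h :: "'k poly" where "h = monom 1 r - 1"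
  have h: "coeff h r = 1" using r by (simp add: h_def)
  have "degree h \<le> r" by (simp add: h_def degree_diff_le degree_monom_eq)
  moreover have "h \<noteq> 0" using h by auto
  moreover have "{z :: 'k. z ^ n = 1} \<subseteq> {z. poly h z = 0}"
    using zr by (auto simp: h_def poly_monom)
  ultimately have "card {z :: 'k. z ^ n = 1} \<le> r"
    using card_poly_roots_bound[of h] card_mono[of "{z. poly h z = 0}"]
    by (meson finite le_trans)
  then show False using card_roots_of_unity[OF assms(1)] r by simp
qed

text \<open>
  A bijection of the index set that multiplies every summand by the same factor
  different from \<open>1\<close> forces a sum to vanish.
\<close>

lemma sum_power_nth_roots_eq_0:
  fixes c :: "'k :: {field, finite}"
  assumes "n dvd CARD('k) - 1" "\<not> n dvd k"
  shows "(\<Sum>b | b ^ n = c. b ^ k) = 0"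
proof -
  obtain z :: 'k where z: "z ^ n = 1" "z ^ k \<noteq> 1"
    using exists_root_of_unity_power_neq_1[OF assms] by blast
  have n: "n > 0" using assms CARD_gt_1[where 'k = 'k] by (auto intro: gr0I)
  have z0: "z \<noteq> 0" using z n by (auto simp: power_0_left)
  have "(\<Sum>b | b ^ n = c. b ^ k) = (\<Sum>b | b ^ n = c. (z * b) ^ k)"
    by (rule sum.reindex_bij_witness[of _ "\<lambda>b. z * b" "\<lambda>b. b / z"])
      (use z z0 in \<open>auto simp: power_mult_distrib power_divide\<close>)
  also have "\<dots> = z ^ k * (\<Sum>b | b ^ n = c. b ^ k)"
    by (simp add: power_mult_distrib sum_distrib_left)
  finally have "(z ^ k - 1) * (\<Sum>b | b ^ n = c. b ^ k) = 0" by (simp add: algebra_simps)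
  then show ?thesis using z by simp
qed

lemma card_nth_roots:
  fixes c :: "'k :: {field, finite}"
  assumes "n dvd CARD('k) - 1" "b0 ^ n = c" "c \<noteq> 0"
  shows "card {b. b ^ n = c} = n"
proof -
  have n: "n > 0" using assms CARD_gt_1[where 'k = 'k] by (auto intro: gr0I)
  have b0: "b0 \<noteq> 0" using assms n by (auto simp: power_0_left)
  have "bij_betw (\<lambda>z. b0 * z) {z. z ^ n = 1} {b. b ^ n = c}"
    by (rule bij_betw_byWitness[of _ "\<lambda>b. b / b0"])
      (use b0 assms in \<open>auto simp: power_mult_distrib power_divide\<close>)
  then show ?thesis using card_roots_of_unity[OF assms(1)] bij_betw_same_card by metis
qed

lemma sum_power_field_eq_0:
  assumes "i < CARD('k :: {field, finite}) - 1"
  shows "(\<Sum>a\<in>UNIV. (a :: 'k) ^ i) = 0"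
proof (cases "i = 0")
  case True
  then show ?thesis
    using CHAR_dvd_CARD[where 'a = 'k] by (simp add: of_nat_eq_0_iff_char_dvd)
next
  case False
  have "(\<Sum>a\<in>UNIV. (a :: 'k) ^ i) = (\<Sum>a | a ^ (CARD('k) - 1) = 1. a ^ i)"
    by (rule sum.mono_neutral_right) (use False power_CARD_minus_1 in \<open>auto simp: zero_power\<close>)
  also have "\<dots> = 0"
    by (rule sum_power_nth_roots_eq_0) (use assms False in \<open>auto dest: dvd_imp_le\<close>)
  finally show ?thesis .
qed

lemma sum_poly_field_eq_0:
  fixes p :: "'k :: {field, finite} poly"
  assumes "degree p < CARD('k) - 1"
  shows "(\<Sum>a\<in>UNIV. poly p a) = 0"
proof -
  have "(\<Sum>a\<in>UNIV. poly p a) = (\<Sum>i\<le>degree p. coeff p i * (\<Sum>a\<in>UNIV. a ^ i))"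
    unfolding poly_altdef sum_distrib_left by (rule sum.swap)
  also have "\<dots> = 0" by (rule sum.neutral) (use assms sum_power_field_eq_0[where 'k = 'k] in auto)
  finally show ?thesis .
qed

section \<open>Order of vanishing of a polynomial at an irreducible polynomial\<close>

text \<open>
  For irreducible \<open>p\<close> and \<open>a \<noteq> 0\<close> this is the exponent of \<open>p\<close> in the factorisation of \<open>a\<close>.
\<close>

definition pord :: "'k :: field poly \<Rightarrow> 'k poly \<Rightarrow> nat"
  where "pord p a = (LEAST k. \<not> p ^ Suc k dvd a)"

lemma irreducible_degree_pos:
  fixes p :: "'k :: field poly"
  assumes "irreducible p"
  shows "degree p > 0"
proof (rule gr0I)
  assume "degree p = 0"
  moreover have "p \<noteq> 0" using assms by auto
  ultimately have "p dvd 1" by (simp add: is_unit_iff_degree)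
  then show False using assms by (simp add: irreducible_not_unit)
qed

lemma pord_decompose:
  fixes p :: "'k :: field poly"
  assumes "irreducible p" "a \<noteq> 0"
  shows "\<exists>b. a = p ^ pord p a * b \<and> \<not> p dvd b"
proof -
  have "\<not> p ^ Suc (degree a) dvd a"
  proof
    assume "p ^ Suc (degree a) dvd a"
    then have "degree (p ^ Suc (degree a)) \<le> degree a" using assms(2) by (rule dvd_imp_degree_le)
    moreover have "p \<noteq> 0" using assms by auto
    ultimately have "Suc (degree a) * degree p \<le> degree a" by (simp only: degree_power_eq not_False_eq_True)
    moreover have "Suc (degree a) * 1 \<le> Suc (degree a) * degree p"
      using irreducible_degree_pos[OF assms(1)] by (intro mult_le_mono) auto
    ultimately have "Suc (degree a) * 1 \<le> degree a" by (rule order.trans[rotated])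
    then show False by simp
  qed
  then have not: "\<not> p ^ Suc (pord p a) dvd a" unfolding pord_def by (rule LeastI)
  have "p ^ pord p a dvd a"
  proof (cases "pord p a")
    case (Suc k)
    then have "k < (LEAST k. \<not> p ^ Suc k dvd a)" by (simp add: pord_def)
    from not_less_Least[OF this] show ?thesis unfolding Suc by simp
  qed auto
  then obtain b where b: "a = p ^ pord p a * b" by blast
  moreover have "\<not> p dvd b"
  proof
    assume "p dvd b"
    then obtain c where "b = p * c" by blast
    then have "a = p ^ Suc (pord p a) * c" using b by (metis mult.assoc power_Suc2)
    then show False using not by (metis dvd_triv_left)
  qed
  ultimately show ?thesis by blast
qed

lemma pord_eqI:
  fixes p :: "'k :: field poly"
  assumes "irreducible p" "a = p ^ k * b" "\<not> p dvd b"
  shows "pord p a = k"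
proof -
  have p0: "p \<noteq> 0" using assms by auto
  have "a \<noteq> 0" using assms by auto
  then obtain c where c: "a = p ^ pord p a * c" "\<not> p dvd c" using pord_decompose assms by blast
  have aux: "\<not> l < m" if "p ^ l * x = p ^ m * y" "\<not> p dvd x" for l m x y
  proof
    assume "l < m"
    then have "p ^ m = p ^ l * (p * p ^ (m - l - 1))"
      by (simp flip: power_add power_Suc)
    then have "x = p * (p ^ (m - l - 1) * y)"
      using that(1) p0 by (simp add: mult.assoc)
    then show False using that(2) by (metis dvd_triv_left)
  qed
  show ?thesis
    using aux[of "pord p a" c k b] aux[of k b "pord p a" c] c assms by fastforce
qed

lemma pord_mult:
  fixes p :: "'k :: field poly"
  assumes "irreducible p" "a \<noteq> 0" "b \<noteq> 0"
  shows "pord p (a * b) = pord p a + pord p b"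
proof -
  obtain c where c: "a = p ^ pord p a * c" "\<not> p dvd c" using pord_decompose assms by blast
  obtain d where d: "b = p ^ pord p b * d" "\<not> p dvd d" using pord_decompose assms by blast
  have "\<not> p dvd c * d"
    using c(2) d(2) field_poly_irreducible_imp_prime[OF assms(1)] by (simp add: prime_elem_dvd_mult_iff)
  moreover have "a * b = p ^ (pord p a + pord p b) * (c * d)"
    by (subst c(1), subst d(1)) (simp add: power_add mult_ac)
  ultimately show ?thesis using pord_eqI assms(1) by blast
qed

lemma pord_ge:
  fixes p :: "'k :: field poly"
  assumes "irreducible p" "a \<noteq> 0" "p ^ k dvd a"
  shows "k \<le> pord p a"
proof -
  obtain b where b: "a = p ^ k * b" using assms by blast
  then have "pord p a = pord p (p ^ k) + pord p b"
    using pord_mult[of p "p ^ k" b] assms by auto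
  moreover have "pord p (p ^ k) = k"
    by (rule pord_eqI[of _ _ _ 1]) (use assms in \<open>auto simp: irreducible_not_unit\<close>)
  ultimately show ?thesis by simp
qed

lemma pord_power_dvd:
  fixes p :: "'k :: field poly"
  assumes "irreducible p" "a \<noteq> 0" "k \<le> pord p a"
  shows "p ^ k dvd a"
proof -
  obtain b where "a = p ^ pord p a * b" using pord_decompose[OF assms(1,2)] by blast
  then have "p ^ pord p a dvd a" by (rule dvdI)
  then show ?thesis using le_imp_power_dvd[OF assms(3)] dvd_trans by blast
qed

lemma pord_add:
  fixes p :: "'k :: field poly"
  assumes "irreducible p" "a \<noteq> 0" "b \<noteq> 0" "a + b \<noteq> 0"
  shows "min (pord p a) (pord p b) \<le> pord p (a + b)"
  by (intro pord_ge dvd_add) (use assms in \<open>auto intro: pord_power_dvd\<close>)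

lemma exists_irreducible_dvd:
  fixes a :: "'k :: field poly"
  assumes "degree a > 0"
  shows "\<exists>p. irreducible p \<and> p dvd a"
  using assms
proof (induction "degree a" arbitrary: a rule: less_induct)
  case less
  show ?case
  proof (cases "irreducible a")
    case False
    have "a \<noteq> 0" using less.prems by auto
    moreover have "\<not> a dvd 1" using less.prems \<open>a \<noteq> 0\<close> by (simp add: is_unit_iff_degree)
    ultimately obtain b c where bc: "a = b * c" "\<not> b dvd 1" "\<not> c dvd 1"
      using False by (auto simp: irreducible_def)
    then have "b \<noteq> 0" "c \<noteq> 0" using \<open>a \<noteq> 0\<close> by auto
    then have "degree b > 0" "degree c > 0" "degree a = degree b + degree c"
      using bc by (auto simp: is_unit_iff_degree degree_mult_eq)
    then have "\<exists>p. irreducible p \<and> p dvd b" using less.hyps[of b] by simp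
    then show ?thesis using bc by auto
  qed auto
qed

lemma finite_polys_degree_less:
  "finite {s :: 'k :: {field, finite} poly. degree s < d}"
proof -
  have "{s :: 'k poly. degree s < d} \<subseteq> Poly ` {xs. set xs \<subseteq> UNIV \<and> length xs \<le> d}"
  proof
    fix s :: "'k poly" assume "s \<in> {s. degree s < d}"
    then have "length (coeffs s) \<le> d" by (auto simp: length_coeffs_degree coeffs_def)
    then show "s \<in> Poly ` {xs. set xs \<subseteq> UNIV \<and> length xs \<le> d}"
      by (intro image_eqI[of _ _ "coeffs s"]) auto
  qed
  then show ?thesis by (rule finite_subset) (intro finite_imageI finite_lists_length_le, simp)
qed

text \<open>
  Modulo an irreducible polynomial the powers \<open>x^P\<close>, for \<open>P\<close> ranging over the powers of the
  characteristic that fix \<open>K\<close>, must repeat; as Frobenius is injective, \<open>x\<close> itself is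
  repeated, so a power of Frobenius is trivial on the residue field.
\<close>

lemma exists_frobenius_trivial_mod:
  fixes p :: "'k :: {field, finite} poly"
  assumes "irreducible p"
  shows "\<exists>P k. P = CHAR('k) ^ k \<and> k > 0 \<and> (\<forall>a. p dvd a ^ P - a)"
proof -
  have prime: "prime (CHAR('k))" by (rule prime_CHAR_finite)
  then have prime': "prime (CHAR('k poly))" by simp
  define l where "l = totient (CARD('k) - 1)"
  have l: "l > 0" using CARD_gt_1[where 'k = 'k] by (simp add: l_def)
  define P0 where "P0 = CHAR('k) ^ l"
  have P0: "a ^ P0 = a" for a :: 'k
  proof (cases "a = 0")
    case True
    then show ?thesis using prime by (simp add: P0_def prime_gt_0_nat)
  next
    case False
    have "[CHAR('k) ^ l = 1] (mod (CARD('k) - 1))"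
      unfolding l_def using coprime_CARD_minus_1_CHAR[where 'k = 'k]
      by (intro euler_theorem) (simp add: coprime_commute)
    moreover have "P0 \<ge> 1" using prime by (simp add: P0_def prime_gt_0_nat Suc_leI)
    ultimately have "(CARD('k) - 1) dvd P0 - 1"
      by (simp add: P0_def cong_altdef_nat)
    then obtain k where "P0 - 1 = (CARD('k) - 1) * k" by (rule dvdE)
    then have "P0 = Suc ((CARD('k) - 1) * k)" using \<open>P0 \<ge> 1\<close> by simp
    then show ?thesis using power_CARD_minus_1[OF False] by (simp add: power_mult)
  qed
  have P0i: "a ^ (P0 ^ i) = a" for a :: 'k and i
    by (induction i) (simp_all add: P0 power_mult)
  let ?x = "[:0, 1 :: 'k:]"
  let ?T = "{s :: 'k poly. degree s < degree p}"
  have "(\<lambda>i. ?x ^ (P0 ^ i) mod p) ` UNIV \<subseteq> ?T"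
  proof (rule image_subsetI)
    fix i
    have "p \<noteq> 0" using assms by auto
    then show "?x ^ (P0 ^ i) mod p \<in> ?T"
      using irreducible_degree_pos[OF assms] degree_mod_less[of p "?x ^ (P0 ^ i)"] by auto
  qed
  then have "\<not> inj (\<lambda>i. ?x ^ (P0 ^ i) mod p)"
    using finite_polys_degree_less[of "degree p"] finite_imageD finite_subset infinite_UNIV_nat by metis
  then obtain i j where ij: "i < j" "?x ^ (P0 ^ i) mod p = ?x ^ (P0 ^ j) mod p"
    unfolding inj_def by (metis linorder_neqE_nat)
  define k where "k = j - i"
  define P where "P = P0 ^ k"
  have k: "k > 0" "j = i + k" using ij by (auto simp: k_def)
  have frob: "(a + b) ^ (P0 ^ h) = a ^ (P0 ^ h) + b ^ (P0 ^ h)" for a b :: "'k poly" and h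
    by (rule freshmans_dream'[OF prime', of _ "l * h"]) (simp add: P0_def power_mult)
  have P0pos: "P0 > 0" using prime by (simp add: P0_def prime_gt_0_nat)
  have "p dvd ?x ^ (P0 ^ j) - ?x ^ (P0 ^ i)"
    using ij(2)[symmetric] by (simp add: mod_eq_dvd_iff)
  also have "?x ^ (P0 ^ j) - ?x ^ (P0 ^ i) = (?x ^ P - ?x) ^ (P0 ^ i)"
  proof -
    have "?x ^ (P0 ^ j) = ((?x ^ P - ?x) + ?x) ^ (P0 ^ i)"
      by (simp add: P_def k(2) power_add mult.commute flip: power_mult)
    then show ?thesis unfolding frob by simp
  qed
  finally have x: "p dvd ?x ^ P - ?x"
    using field_poly_irreducible_imp_prime[OF assms] prime_elem_dvd_power by blast
  have "p dvd a ^ P - a" for a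
  proof (induction a)
    case 0
    then show ?case using P0pos by (simp add: P_def power_0_left)
  next
    case (pCons c a)
    have c: "[:c:] ^ P = [:c:]" using P0i[of c k] by (simp add: P_def poly_const_pow)
    have e: "pCons c a = [:c:] + ?x * a" by simp
    have "pCons c a ^ P - pCons c a = [:c:] ^ P + (?x * a) ^ P - ([:c:] + ?x * a)"
      unfolding e P_def frob ..
    also have "\<dots> = ?x ^ P * (a ^ P - a) + (?x ^ P - ?x) * a"
      unfolding c power_mult_distrib by (simp only: algebra_simps)
    finally show ?case using pCons.IH x by simp
  qed
  moreover have "P = CHAR('k) ^ (l * k)" by (simp add: P_def P0_def power_mult)
  ultimately show ?thesis using l k by (metis nat_0_less_mult_iff)
qed

lemma exists_power_cong_1:
  fixes p :: "'k :: {field, finite} poly"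
  assumes "irreducible p"
  shows "\<exists>m>0. coprime m CHAR('k) \<and> (\<forall>a. \<not> p dvd a \<longrightarrow> p dvd a ^ m - 1)"
proof -
  obtain P k where P: "P = CHAR('k) ^ k" "k > 0" "\<And>a. p dvd a ^ P - a"
    using exists_frobenius_trivial_mod[OF assms] by blast
  define m where "m = P - 1"
  have "CHAR('k) > 1" using prime_CHAR_finite[where 'k = 'k] prime_gt_1_nat by blast
  then have "P > 1" unfolding P(1) using P(2) by (rule one_less_power)
  then have m: "m > 0" "P = Suc m" by (simp_all add: m_def)
  have "coprime m P" using m(2) by simp
  moreover have "CHAR('k) dvd P" using P by (simp add: dvd_power)
  ultimately have "coprime m CHAR('k)" using coprime_divisors dvd_refl by blast
  moreover have "p dvd a ^ m - 1" if "\<not> p dvd a" for a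
  proof -
    have "p dvd a * (a ^ m - 1)" using P(3)[of a] m(2) by (simp add: algebra_simps)
    then show ?thesis
      using that field_poly_irreducible_imp_prime[OF assms] by (simp add: prime_elem_dvd_mult_iff)
  qed
  ultimately show ?thesis using m(1) by blast
qed

section \<open>Valuations of the rational function field\<close>

lemma fract_cases:
  obtains a b where "b \<noteq> 0" "r = to_fract a / to_fract b"
  by (cases r) (auto simp: Fract_conv_to_fract)

lemma to_fract_power: "to_fract a ^ i = to_fract (a ^ i)"
  by (induction i) simp_all

text \<open>
  A valuation \<open>v0\<close> with uniformiser \<open>w\<close>. The finiteness of the residue field is expressed by an
  exponent \<open>m\<close>, prime to the characteristic, such that the \<open>m\<close>-th power of every unit has residue
  \<open>1\<close>.
\<close>

locale base_valuation =
  fixes v0 :: "'k :: {field, finite} poly fract \<Rightarrow> int" and w :: "'k poly fract" and m :: nat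
  assumes v0_mult: "\<And>r s. r \<noteq> 0 \<Longrightarrow> s \<noteq> 0 \<Longrightarrow> v0 (r * s) = v0 r + v0 s"
    and v0_add: "\<And>r s. r \<noteq> 0 \<Longrightarrow> s \<noteq> 0 \<Longrightarrow> r + s \<noteq> 0 \<Longrightarrow> min (v0 r) (v0 s) \<le> v0 (r + s)"
    and w_nonzero: "w \<noteq> 0" and v0_w: "v0 w = 1"
    and m_pos: "m > 0" and m_coprime: "coprime m CHAR('k)"
    and residue: "\<And>r. r \<noteq> 0 \<Longrightarrow> v0 r = 0 \<Longrightarrow> r ^ m = 1 \<or> 0 < v0 (r ^ m - 1)"
begin

lemma v0_1: "v0 1 = 0"
  using v0_mult[of 1 1] by simp

lemma v0_power: "r \<noteq> 0 \<Longrightarrow> v0 (r ^ k) = int k * v0 r"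
  by (induction k) (simp_all add: v0_1 v0_mult algebra_simps)

lemma v0_inverse: "r \<noteq> 0 \<Longrightarrow> v0 (inverse r) = - v0 r"
  using v0_mult[of r "inverse r"] v0_1 by simp

lemma v0_powi: "r \<noteq> 0 \<Longrightarrow> v0 (r powi k) = k * v0 r"
  by (simp add: power_int_def v0_power v0_inverse)

lemma v0_const:
  assumes "a \<noteq> 0"
  shows "v0 (to_fract [:a:]) = 0"
proof -
  have "to_fract [:a:] ^ (CARD('k) - 1) = 1"
    using power_CARD_minus_1[OF assms] unfolding to_fract_power poly_const_pow by (simp flip: one_pCons)
  then have "int (CARD('k) - 1) * v0 (to_fract [:a:]) = 0"
    using v0_power[of "to_fract [:a:]" "CARD('k) - 1"] assms v0_1 by simp
  then show ?thesis using CARD_gt_1[where 'k = 'k] by simp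
qed

lemma v0_minus: "v0 (- r) = v0 r"
proof (cases "r = 0")
  case False
  have "- r = to_fract [:-1:] * r"
    by (metis minus_pCons minus_zero mult_minus1 one_pCons to_fract_1 to_fract_uminus)
  then show ?thesis
    using v0_mult[of "to_fract [:-1:]" r] v0_const[of "-1"] False by simp
qed simp

end

text \<open>
  The common part of the construction of the valuation at an irreducible polynomial and of the
  valuation at infinity, which is minus the degree.
\<close>

locale poly_valuation =
  fixes \<mu> :: "'k :: {field, finite} poly \<Rightarrow> int"
  assumes mult: "\<And>a b. a \<noteq> 0 \<Longrightarrow> b \<noteq> 0 \<Longrightarrow> \<mu> (a * b) = \<mu> a + \<mu> b"
    and add: "\<And>a b. a \<noteq> 0 \<Longrightarrow> b \<noteq> 0 \<Longrightarrow> a + b \<noteq> 0 \<Longrightarrow> min (\<mu> a) (\<mu> b) \<le> \<mu> (a + b)"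
begin

definition fval :: "'k poly fract \<Rightarrow> int"
  where "fval r = (THE k. \<exists>a b. a \<noteq> 0 \<and> b \<noteq> 0 \<and> r = to_fract a / to_fract b \<and> k = \<mu> a - \<mu> b)"

lemma fval_quotient:
  assumes "a \<noteq> 0" "b \<noteq> 0"
  shows "fval (to_fract a / to_fract b) = \<mu> a - \<mu> b"
  unfolding fval_def
proof (rule the_equality)
  show "\<exists>a' b'. a' \<noteq> 0 \<and> b' \<noteq> 0 \<and> to_fract a / to_fract b = to_fract a' / to_fract b' \<and>
      \<mu> a - \<mu> b = \<mu> a' - \<mu> b'"
    using assms by blast
next
  fix k assume "\<exists>a' b'. a' \<noteq> 0 \<and> b' \<noteq> 0 \<and> to_fract a / to_fract b = to_fract a' / to_fract b' \<and>
      k = \<mu> a' - \<mu> b'"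
  then obtain a' b' where *: "a' \<noteq> 0" "b' \<noteq> 0" "to_fract a / to_fract b = to_fract a' / to_fract b'"
    "k = \<mu> a' - \<mu> b'" by blast
  then have "to_fract (a * b') = to_fract (a' * b)"
    using assms by (simp add: divide_eq_eq eq_divide_eq mult.commute)
  then have "a * b' = a' * b" by (simp only: to_fract_eq_iff)
  then show "k = \<mu> a - \<mu> b"
    using mult[of a b'] mult[of a' b] * assms by simp
qed

lemma fval_to_fract: "a \<noteq> 0 \<Longrightarrow> fval (to_fract a) = \<mu> a"
  using fval_quotient[of a 1] mult[of 1 1] by simp

lemma fval_mult:
  assumes "r \<noteq> 0" "s \<noteq> 0"
  shows "fval (r * s) = fval r + fval s"
proof -
  obtain a b where r: "b \<noteq> 0" "r = to_fract a / to_fract b" by (rule fract_cases)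
  obtain c d where s: "d \<noteq> 0" "s = to_fract c / to_fract d" by (rule fract_cases)
  have nz: "a \<noteq> 0" "c \<noteq> 0" using assms r s by auto
  have "r * s = to_fract (a * c) / to_fract (b * d)" using r s by simp
  then show ?thesis
    using fval_quotient[of "a * c" "b * d"] fval_quotient[of a b] fval_quotient[of c d] r s nz
      mult[of a c] mult[of b d] by simp
qed

lemma fval_add:
  assumes "r \<noteq> 0" "s \<noteq> 0" "r + s \<noteq> 0"
  shows "min (fval r) (fval s) \<le> fval (r + s)"
proof -
  obtain a b where r: "b \<noteq> 0" "r = to_fract a / to_fract b" by (rule fract_cases)
  obtain c d where s: "d \<noteq> 0" "s = to_fract c / to_fract d" by (rule fract_cases)
  have nz: "a \<noteq> 0" "c \<noteq> 0" using assms r s by auto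
  have sum: "r + s = to_fract (a * d + c * b) / to_fract (b * d)"
    using r s by (simp add: add_frac_eq)
  then have "a * d + c * b \<noteq> 0" using assms(3) by (metis div_0 to_fract_0)
  then show ?thesis
    using fval_quotient[of "a * d + c * b" "b * d"] fval_quotient[of a b] fval_quotient[of c d] r s nz
      mult[of a d] mult[of b d] mult[of c b] add[of "a * d" "c * b"] sum by simp
qed

lemma power_val: "a \<noteq> 0 \<Longrightarrow> \<mu> (a ^ k) = int k * \<mu> a"
  using mult[of 1 1] by (induction k) (simp_all add: mult algebra_simps)

text \<open>
  The residue condition on a quotient \<open>a/b\<close> of elements of equal value is cleared of denominators.
\<close>

lemma base_valuation_fval:
  assumes "w \<noteq> 0" "fval w = 1" "m > 0" "coprime m CHAR('k)"
    and "\<And>a b. a \<noteq> 0 \<Longrightarrow> b \<noteq> 0 \<Longrightarrow> \<mu> a = \<mu> b \<Longrightarrow> a ^ m \<noteq> b ^ m \<Longrightarrow> \<mu> (b ^ m) < \<mu> (a ^ m - b ^ m)"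
  shows "base_valuation fval w m"
proof
  fix r :: "'k poly fract" assume r0: "r \<noteq> 0" "fval r = 0"
  obtain a b where r: "b \<noteq> 0" "r = to_fract a / to_fract b" by (rule fract_cases)
  have a: "a \<noteq> 0" using r r0 by auto
  have ab: "\<mu> a = \<mu> b" using fval_quotient[of a b] r r0 a by simp
  have eq: "r ^ m - 1 = to_fract (a ^ m - b ^ m) / to_fract (b ^ m)"
    using r by (simp add: power_divide to_fract_power diff_divide_distrib)
  show "r ^ m = 1 \<or> 0 < fval (r ^ m - 1)"
  proof (cases "a ^ m = b ^ m")
    case True
    then show ?thesis using eq by simp
  next
    case False
    then have "fval (r ^ m - 1) = \<mu> (a ^ m - b ^ m) - \<mu> (b ^ m)"
      unfolding eq using r by (intro fval_quotient) auto
    then show ?thesis using assms(5)[OF a r(1) ab False] by simp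
  qed
qed (use assms fval_mult fval_add in auto)

end

definition pval :: "'k :: {field, finite} poly \<Rightarrow> 'k poly fract \<Rightarrow> int"
  where "pval p = poly_valuation.fval (\<lambda>a. int (pord p a))"

definition dval :: "'k :: {field, finite} poly fract \<Rightarrow> int"
  where "dval = poly_valuation.fval (\<lambda>a. - int (degree a))"

lemma poly_valuation_pord:
  fixes p :: "'k :: {field, finite} poly"
  assumes "irreducible p"
  shows "poly_valuation (\<lambda>a. int (pord p a))"
proof
  fix a b :: "'k poly" assume "a \<noteq> 0" "b \<noteq> 0" "a + b \<noteq> 0"
  then show "min (int (pord p a)) (int (pord p b)) \<le> int (pord p (a + b))"
    using pord_add[OF assms, of a b] by linarith
qed (simp add: pord_mult[OF assms])

lemma poly_valuation_degree: "poly_valuation (\<lambda>a :: 'k :: {field, finite} poly. - int (degree a))"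
proof
  fix a b :: "'k poly"
  show "min (- int (degree a)) (- int (degree b)) \<le> - int (degree (a + b))"
    using degree_add_le_max[of a b] by linarith
qed (simp add: degree_mult_eq)

lemmas pval_quotient = poly_valuation.fval_quotient[OF poly_valuation_pord, folded pval_def]
lemmas pval_to_fract = poly_valuation.fval_to_fract[OF poly_valuation_pord, folded pval_def]
lemmas dval_quotient = poly_valuation.fval_quotient[OF poly_valuation_degree, folded dval_def]
lemmas dval_to_fract = poly_valuation.fval_to_fract[OF poly_valuation_degree, folded dval_def]

lemma pord_self: "irreducible p \<Longrightarrow> pord p p = 1" for p :: "'k :: field poly"
  by (rule pord_eqI[of _ _ _ 1]) (auto simp: irreducible_not_unit)

lemma pord_eq_0_iff:
  fixes p :: "'k :: field poly"
  assumes "irreducible p" "a \<noteq> 0"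
  shows "pord p a = 0 \<longleftrightarrow> \<not> p dvd a"
proof
  assume "pord p a = 0"
  then show "\<not> p dvd a" using pord_ge[OF assms, of 1] by auto
qed (rule pord_eqI[OF assms(1), of _ _ a], simp)

lemma base_valuation_pval:
  fixes p :: "'k :: {field, finite} poly"
  assumes "irreducible p"
  shows "\<exists>m. base_valuation (pval p) (to_fract p) m"
proof -
  obtain m where m: "m > 0" "coprime m CHAR('k)" and unit: "\<And>a. \<not> p dvd a \<Longrightarrow> p dvd a ^ m - 1"
    using exists_power_cong_1[OF assms] by blast
  have p0: "p \<noteq> 0" using assms by auto
  have "base_valuation (pval p) (to_fract p) m"
    unfolding pval_def
  proof (rule poly_valuation.base_valuation_fval[OF poly_valuation_pord[OF assms]])
    show "poly_valuation.fval (\<lambda>a. int (pord p a)) (to_fract p) = 1"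
      using pval_to_fract[OF assms p0] pord_self[OF assms] by (simp add: pval_def)
    fix a b :: "'k poly"
    assume ab: "a \<noteq> 0" "b \<noteq> 0" "int (pord p a) = int (pord p b)" "a ^ m \<noteq> b ^ m"
    define j where "j = pord p b"
    obtain a' where a': "a = p ^ j * a'" "\<not> p dvd a'"
      using pord_decompose[OF assms ab(1)] ab(3) by (auto simp: j_def)
    obtain b' where b': "b = p ^ j * b'" "\<not> p dvd b'"
      using pord_decompose[OF assms ab(2)] by (auto simp: j_def)
    have "p dvd (a' ^ m - 1) - (b' ^ m - 1)" by (rule dvd_diff[OF unit[OF a'(2)] unit[OF b'(2)]])
    then have "p dvd a' ^ m - b' ^ m" by simp
    moreover have "a ^ m - b ^ m = p ^ (j * m) * (a' ^ m - b' ^ m)"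
      by (simp add: a' b' power_mult_distrib power_mult algebra_simps)
    ultimately have "p ^ (j * m) * p dvd a ^ m - b ^ m" by (simp add: mult_dvd_mono)
    then have "Suc (j * m) \<le> pord p (a ^ m - b ^ m)"
      using ab(4) by (intro pord_ge[OF assms]) (auto simp: mult.commute)
    moreover have "pord p (b ^ m) = j * m"
      using poly_valuation.power_val[OF poly_valuation_pord[OF assms] ab(2), of m]
      by (simp add: j_def mult.commute flip: of_nat_mult)
    ultimately show "int (pord p (b ^ m)) < int (pord p (a ^ m - b ^ m))"
      by (simp del: of_nat_mult)
  qed (use p0 m in auto)
  then show ?thesis by blast
qed

text \<open>
  For polynomials \<open>a\<close>, \<open>b\<close> of the same degree, \<open>a^(q - 1)\<close> and \<open>b^(q - 1)\<close> are both monic, so their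
  difference has smaller degree.
\<close>

lemma base_valuation_dval:
  "base_valuation (dval :: 'k :: {field, finite} poly fract \<Rightarrow> int) (1 / to_fract [:0, 1:]) (CARD('k) - 1)"
  unfolding dval_def
proof (rule poly_valuation.base_valuation_fval[OF poly_valuation_degree])
  show "poly_valuation.fval (\<lambda>a :: 'k poly. - int (degree a)) (1 / to_fract [:0, 1:]) = 1"
    using dval_quotient[of "1 :: 'k poly" "[:0, 1:]"] by (simp add: dval_def)
  let ?m = "CARD('k) - 1"
  fix a b :: "'k poly"
  assume ab: "a \<noteq> 0" "b \<noteq> 0" "- int (degree a) = - int (degree b)" "a ^ ?m \<noteq> b ^ ?m"
  have deg: "degree (a ^ ?m) = degree (b ^ ?m)" using ab by (simp add: degree_power_eq)
  have lead: "lead_coeff (c ^ ?m) = 1" if "c \<noteq> 0" for c :: "'k poly"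
    using power_CARD_minus_1[of "lead_coeff c"] that by (simp add: lead_coeff_power)
  have "degree (a ^ ?m - b ^ ?m) < degree (b ^ ?m)"
  proof -
    have le: "degree (a ^ ?m - b ^ ?m) \<le> degree (b ^ ?m)" using deg by (simp add: degree_diff_le)
    have "coeff (a ^ ?m - b ^ ?m) (degree (b ^ ?m)) = 0"
      using lead[OF ab(1)] lead[OF ab(2)] deg by simp
    moreover have "a ^ ?m - b ^ ?m \<noteq> 0" using ab by simp
    ultimately have "degree (a ^ ?m - b ^ ?m) \<noteq> degree (b ^ ?m)"
      by (metis leading_coeff_0_iff)
    then show ?thesis using le by simp
  qed
  then show "- int (degree (b ^ ?m)) < - int (degree (a ^ ?m - b ^ ?m))" by simp
qed (use CARD_gt_1[where 'k = 'k] coprime_CARD_minus_1_CHAR in \<open>auto\<close>)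

section \<open>The function field\<close>

lemma map_poly_to_ac_add: "map_poly to_ac (p + q) = map_poly to_ac p + map_poly to_ac q"
  by (rule poly_eqI) (simp add: coeff_map_poly)

lemma map_poly_to_ac_mult: "map_poly to_ac (p * q) = map_poly to_ac p * map_poly to_ac q"
  by (rule poly_eqI) (simp add: coeff_map_poly coeff_mult to_ac_sum)

lemma poly_eq_sum_less:
  fixes x :: "'a :: comm_semiring_1"
  assumes "degree p < n"
  shows "poly p x = (\<Sum>j<n. coeff p j * x ^ j)"
  unfolding poly_altdef
  by (rule sum.mono_neutral_left) (use assms in \<open>auto simp: coeff_eq_0 not_le\<close>)

locale superelliptic =
  fixes f :: "'k :: {field, finite} poly" and n :: nat
  assumes n_ge_2: "n \<ge> 2"
    and n_dvd: "n dvd CARD('k) - 1"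
    and separable: "coprime f (pderiv f)"
    and degree_f_pos: "degree f > 0"
begin

abbreviation y :: "'k ambient" where "y \<equiv> y_fun n f"
abbreviation F :: "'k ambient set" where "F \<equiv> function_field n f"
abbreviation ff :: "'k poly fract" where "ff \<equiv> to_fract f"
abbreviation x :: "'k ambient" where "x \<equiv> x_fun"

lemma f_nonzero: "f \<noteq> 0"
  using degree_f_pos by auto

lemma y_power_n: "y ^ n = to_ac ff"
  using y_fun_power[of n f] n_ge_2 by (simp add: of_poly_def)

lemma y_nonzero: "y \<noteq> 0"
  using y_power_n f_nonzero n_ge_2 by (auto simp: power_0_left)

lemma pord_f:
  assumes "irreducible p" "p dvd f"
  shows "pord p f = 1"
proof -
  obtain g where g: "f = p * g" using assms by blast
  have "\<not> p dvd g"
  proof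
    assume "p dvd g"
    then obtain h where "g = p * h" by blast
    then have "pderiv f = p * (pderiv (p * h) + h * pderiv p)"
      using g by (simp add: pderiv_mult algebra_simps)
    then have "p dvd pderiv f" by (metis dvd_triv_left)
    then have "p dvd 1" using assms separable by (metis coprime_common_divisor)
    then show False using assms by (simp add: irreducible_not_unit)
  qed
  then show ?thesis by (intro pord_eqI[OF assms(1), of _ _ g]) (simp_all add: g)
qed

abbreviation evy :: "'k poly fract poly \<Rightarrow> 'k ambient"
  where "evy r \<equiv> poly (map_poly to_ac r) y"

lemma evy_mult: "evy (r * s) = evy r * evy s"
  by (simp add: map_poly_to_ac_mult)

lemma evy_add: "evy (r + s) = evy r + evy s"
  by (simp add: map_poly_to_ac_add)

definition kummer :: "'k poly fract poly"
  where "kummer = monom 1 n - [:ff:]"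

lemma poly_kummer: "poly (map_poly to_ac kummer) z = z ^ n - to_ac ff"
proof -
  have "map_poly to_ac kummer = monom 1 n - [:to_ac ff:]"
    by (rule poly_eqI) (simp add: kummer_def coeff_map_poly coeff_pCons split: nat.split)
  then show ?thesis by (simp add: poly_monom)
qed

lemma evy_kummer: "evy kummer = 0"
  by (simp add: poly_kummer y_power_n)

lemma degree_kummer: "degree kummer = n" and kummer_nonzero: "kummer \<noteq> 0"
proof -
  have lead: "coeff kummer n = 1" using n_ge_2 by (simp add: kummer_def coeff_pCons split: nat.split)
  then show "kummer \<noteq> 0" by auto
  have "degree kummer \<le> n" by (simp add: kummer_def degree_diff_le degree_monom_eq)
  moreover have "n \<le> degree kummer" using lead by (simp add: le_degree)
  ultimately show "degree kummer = n" by simp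
qed

text \<open>
  All roots of the minimal polynomial \<open>m\<close> of \<open>y\<close> over \<open>K(x)\<close> are \<open>n\<close>-th roots of \<open>f\<close>, so its
  constant coefficient \<open>c\<close> satisfies \<open>c^n = f^k\<close> up to sign, \<open>k\<close> being the degree of \<open>m\<close>.
  As \<open>f\<close> vanishes to order \<open>1\<close> at some irreducible polynomial, \<open>n\<close> divides \<open>k\<close>.
\<close>

lemma evy_eq_0_degree:
  assumes "evy r = 0" "r \<noteq> 0"
  shows "n \<le> degree r"
proof -
  define k where "k = (LEAST k. \<exists>m. m \<noteq> 0 \<and> evy m = 0 \<and> degree m = k)"
  have ex: "\<exists>m. m \<noteq> 0 \<and> evy m = 0 \<and> degree m = k"
    unfolding k_def by (rule LeastI[of _ "degree r"]) (use assms in blast)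
  then obtain m where m: "m \<noteq> 0" "evy m = 0" "degree m = k" by blast
  have least: "k \<le> degree s" if "s \<noteq> 0" "evy s = 0" for s
    unfolding k_def by (rule Least_le) (use that in blast)
  have k_pos: "k > 0"
  proof (rule gr0I)
    assume "k = 0"
    then obtain c where "m = [:c:]" using m(3) degree_eq_zeroE by blast
    then show False using m by (simp add: map_poly_pCons)
  qed
  define g where "g = kummer"
  have "evy (g mod m) = 0"
  proof -
    have "evy g = evy (g div m * m + g mod m)" by simp
    also have "\<dots> = evy (g mod m)" by (simp only: evy_add evy_mult m(2)) simp
    finally show ?thesis by (simp add: g_def evy_kummer)
  qed
  moreover have "g mod m = 0 \<or> degree (g mod m) < k"
    using degree_mod_less[of m g] m by simp
  ultimately have "g mod m = 0" using least[of "g mod m"] by (metis not_le)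
  then obtain h where h: "g = m * h" by (auto simp: mod_eq_0_iff_dvd)
  define M where "M = map_poly to_ac m"
  have "coeff M k = to_ac (lead_coeff m)" by (simp add: M_def coeff_map_poly m(3))
  then have M0: "M \<noteq> 0" using m(1) by auto
  have degM: "degree M = k"
    unfolding M_def using m by (subst degree_map_poly) auto
  obtain A where A: "size A = degree M" "M = smult (lead_coeff M) (\<Prod>a\<in>#A. [:-a, 1:])"
    using alg_closed_imp_factorization[OF M0] by blast
  have root: "a ^ n = to_ac ff" if "a \<in># A" for a
  proof -
    have "poly (\<Prod>a\<in>#A. [:-a, 1:]) a = 0"
      using that by (auto simp: poly_prod_mset)
    then have "poly M a = 0" by (subst A(2)) simp
    then have "poly (map_poly to_ac g) a = 0" by (simp add: h map_poly_to_ac_mult M_def)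
    then show ?thesis by (simp add: g_def poly_kummer)
  qed
  have "poly M 0 = lead_coeff M * (\<Prod>a\<in>#A. - a)"
    by (subst A(2)) (simp add: poly_prod_mset)
  then have "(poly M 0 / lead_coeff M) ^ n = (\<Prod>a\<in>#A. (- a) ^ n)"
  proof -
    have "(\<Prod>a\<in>#A. h a) ^ n = (\<Prod>a\<in>#A. h a ^ n)" for h :: "'k ambient \<Rightarrow> 'k ambient"
      by (induction A) (simp_all add: power_mult_distrib)
    from this[of uminus] show ?thesis using M0 \<open>poly M 0 = lead_coeff M * (\<Prod>a\<in>#A. - a)\<close> by simp
  qed
  also have "(\<Prod>a\<in>#A. (- a) ^ n) = (\<Prod>a\<in>#A. (-1) ^ n * to_ac ff)"
    using root by (intro arg_cong[of _ _ prod_mset] image_mset_cong) (metis power_minus)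
  also have "\<dots> = ((-1) ^ n * to_ac ff) ^ k"
    using A(1) degM by simp
  finally have eq: "(poly M 0 / lead_coeff M) ^ n = ((-1) ^ n * to_ac ff) ^ k" .
  define s where "s = coeff m 0 / lead_coeff m"
  have "poly M 0 / lead_coeff M = to_ac s"
    using degM m(3) by (simp add: s_def M_def poly_0_coeff_0 coeff_map_poly)
  then have "to_ac (s ^ n) = to_ac (((-1) ^ n * ff) ^ k)" using eq by simp
  then have sn: "s ^ n = ((-1) ^ n * ff) ^ k" by (simp only: to_ac_eq_iff)
  obtain p where p: "irreducible p" "p dvd f" using exists_irreducible_dvd[OF degree_f_pos] by blast
  obtain mm where "base_valuation (pval p) (to_fract p) mm" using base_valuation_pval[OF p(1)] by blast
  then interpret base_valuation "pval p" "to_fract p" mm .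
  have "pval p ((-1) ^ n * ff) = 1"
    using pval_to_fract[OF p(1) f_nonzero] pord_f[OF p] v0_minus[of ff]
    by (cases "even n") simp_all
  moreover have nz: "(-1) ^ n * ff \<noteq> 0" using f_nonzero by simp
  ultimately have "pval p (s ^ n) = int k" using sn v0_power[OF nz, of k] by simp
  moreover have "s \<noteq> 0"
  proof
    assume "s = 0"
    then have "((-1) ^ n * ff) ^ k = 0" using sn n_ge_2 by (simp only: power_0_left) simp
    then show False using nz by (metis power_not_zero)
  qed
  ultimately have "int n * pval p s = int k" using v0_power by simp
  then have "n dvd k" by (metis dvd_triv_left int_dvd_int_iff)
  then have "n \<le> k" using k_pos by (rule dvd_imp_le)
  then show ?thesis using least[OF assms(2,1)] by simp
qed

definition lincomb :: "(nat \<Rightarrow> 'k poly fract) \<Rightarrow> 'k ambient"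
  where "lincomb r = (\<Sum>j<n. to_ac (r j) * y ^ j)"

lemma lincomb_eq_evy: "lincomb r = evy (\<Sum>j<n. monom (r j) j)"
proof -
  have "map_poly to_ac (\<Sum>j<n. monom (r j) j) = (\<Sum>j<n. monom (to_ac (r j)) j)"
    by (rule poly_eqI) (simp add: coeff_map_poly coeff_sum to_ac_sum if_distrib cong: if_cong)
  then show ?thesis by (simp add: lincomb_def poly_sum poly_monom)
qed

text \<open>
  The powers \<open>y^j\<close> with \<open>j < n\<close> are linearly independent over \<open>K(x)\<close>, so the coefficients of a
  function are well defined.
\<close>

lemma lincomb_eq_0D:
  assumes "lincomb r = 0" "j < n"
  shows "r j = 0"
proof -
  let ?p = "\<Sum>j<n. monom (r j) j"
  have "degree ?p \<le> n - 1"
    by (rule degree_sum_le) (auto intro!: order.trans[OF degree_monom_le])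
  then have "?p = 0"
    using evy_eq_0_degree[of ?p] assms(1) n_ge_2 unfolding lincomb_eq_evy by linarith
  then have "coeff ?p j = 0" by simp
  then show ?thesis using assms(2) by (simp add: coeff_sum)
qed

lemma lincomb_diff: "lincomb r - lincomb s = lincomb (\<lambda>j. r j - s j)"
  by (simp add: lincomb_def sum_subtractf algebra_simps)

lemma lincomb_add: "lincomb r + lincomb s = lincomb (\<lambda>j. r j + s j)"
  by (simp add: lincomb_def sum.distrib algebra_simps)

lemma lincomb_eqD:
  assumes "lincomb r = lincomb s" "j < n"
  shows "r j = s j"
  using lincomb_eq_0D[of "\<lambda>j. r j - s j"] assms by (simp flip: lincomb_diff)

lemma F_eq_range_evy: "F = range evy"
  by (simp add: function_field_def)

lemma F_eq_range_lincomb: "F = range lincomb"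
proof
  show "range lincomb \<subseteq> F" unfolding F_eq_range_evy by (auto simp: lincomb_eq_evy)
  show "F \<subseteq> range lincomb"
  proof
    fix h assume "h \<in> F"
    then obtain r where r: "h = evy r" by (auto simp: F_eq_range_evy)
    let ?s = "r mod kummer"
    have deg: "degree ?s < n"
      using degree_mod_less[OF kummer_nonzero, of r] n_ge_2 degree_kummer by auto
    have "r div kummer * kummer + ?s = r" by (rule div_mult_mod_eq)
    then have "h = evy (r div kummer * kummer + ?s)" using r by (simp only:)
    also have "\<dots> = evy ?s" by (simp only: evy_add evy_mult evy_kummer) simp
    also have "\<dots> = lincomb (coeff ?s)"
      unfolding lincomb_def using deg
      by (subst poly_eq_sum_less[of _ n]) (auto simp: coeff_map_poly degree_map_poly)
    finally show "h \<in> range lincomb" by blast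
  qed
qed

lemma F_cases:
  assumes "h \<in> F"
  obtains r where "h = lincomb r"
  using assms by (auto simp: F_eq_range_lincomb)

lemma F_mult: "g \<in> F \<Longrightarrow> h \<in> F \<Longrightarrow> g * h \<in> F"
  unfolding F_eq_range_evy by (auto simp: image_iff) (metis evy_mult)

lemma F_add: "g \<in> F \<Longrightarrow> h \<in> F \<Longrightarrow> g + h \<in> F"
  unfolding F_eq_range_evy by (auto simp: image_iff) (metis evy_add)

lemma F_to_ac: "to_ac r \<in> F"
  unfolding F_eq_range_evy by (rule image_eqI[of _ _ "[:r:]"]) (simp_all add: map_poly_pCons)

lemma F_y: "y \<in> F"
  unfolding F_eq_range_evy by (rule image_eqI[of _ _ "[:0, 1:]"]) (simp_all add: map_poly_pCons)

lemma F_0: "0 \<in> F" and F_1: "1 \<in> F"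
  using F_to_ac[of 0] F_to_ac[of 1] by simp_all

lemma F_const: "const a \<in> F" and F_of_poly: "of_poly p \<in> F"
  by (simp_all add: const_def of_poly_def F_to_ac)

lemma F_x: "x \<in> F"
  by (simp add: x_fun_def F_of_poly)

lemma F_minus: "h \<in> F \<Longrightarrow> - h \<in> F"
  using F_mult[OF F_to_ac[of "-1"], of h] by simp

lemma F_diff: "g \<in> F \<Longrightarrow> h \<in> F \<Longrightarrow> g - h \<in> F"
  using F_add[OF _ F_minus, of g h] by simp

lemma F_power: "h \<in> F \<Longrightarrow> h ^ k \<in> F"
  by (induction k) (simp_all add: F_1 F_mult)

lemma F_sum: "(\<And>i. i \<in> I \<Longrightarrow> h i \<in> F) \<Longrightarrow> sum h I \<in> F"
  by (induction I rule: infinite_finite_induct) (auto simp: F_0 F_add)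

lemma F_prod: "(\<And>i. i \<in> I \<Longrightarrow> h i \<in> F) \<Longrightarrow> prod h I \<in> F"
  by (induction I rule: infinite_finite_induct) (auto simp: F_1 F_mult)

text \<open>
  An inverse of \<open>r(y)\<close> is found by dividing \<open>Y^n - f\<close> by \<open>r\<close>: the remainder has smaller
  degree, so its value at \<open>y\<close> can be assumed to be invertible.
\<close>

lemma F_inverse:
  assumes "h \<in> F"
  shows "inverse h \<in> F"
proof -
  have main: "inverse (evy r) \<in> F" if "degree r < n" for r
    using that
  proof (induction "degree r" arbitrary: r rule: less_induct)
    case less
    show ?case
    proof (cases "evy r = 0")
      case True
      then show ?thesis by (simp add: F_0)
    next
      case False
      then have r0: "r \<noteq> 0" by auto
      show ?thesis
      proof (cases "degree r = 0")
        case True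
        then obtain c where "r = [:c:]" using degree_eq_zeroE by blast
        then show ?thesis using F_to_ac[of "inverse c"] by (simp add: map_poly_pCons)
      next
        case pos: False
        define g where "g = kummer"
        define s where "s = g mod r"
        have "0 = evy (g div r * r + s)" by (simp add: s_def g_def evy_kummer)
        then have eq: "evy (g div r) * evy r = - evy s"
          by (simp only: evy_add evy_mult) (simp add: eq_neg_iff_add_eq_0)
        have degs: "s = 0 \<or> degree s < degree r"
          using degree_mod_less[OF r0, of g] by (simp add: s_def)
        then have "degree s < degree r" using pos by auto
        then have inv: "inverse (evy s) \<in> F" using less by auto
        have "evy s \<noteq> 0"
        proof
          assume "evy s = 0"
          then have q: "evy (g div r) = 0" using eq False by simp
          have "g div r \<noteq> 0"
          proof
            assume "g div r = 0"
            then have "degree g < degree r" using r0 pos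
              by (auto simp: div_poly_eq_0_iff)
            then show False using degree_kummer less.prems by (simp add: g_def)
          qed
          then have "n \<le> degree (g div r)" using q evy_eq_0_degree by blast
          moreover have "degree (g div r) + degree r \<le> n"
          proof -
            have "g div r * r = g - s" by (simp add: s_def minus_mod_eq_div_mult)
            moreover have "degree (g - s) \<le> n"
              using degree_kummer \<open>degree s < degree r\<close> less.prems by (intro degree_diff_le) (auto simp: g_def)
            ultimately show ?thesis using r0 \<open>g div r \<noteq> 0\<close> by (metis degree_mult_eq)
          qed
          ultimately show False using pos by simp
        qed
        then have "inverse (evy r) = - evy (g div r) * inverse (evy s)"
          using eq False by (simp add: field_simps)
        moreover have "evy (g div r) \<in> F" by (auto simp: F_eq_range_evy)
        ultimately show ?thesis using inv F_mult F_minus by metis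
      qed
    qed
  qed
  obtain r where h: "h = lincomb r" using assms by (rule F_cases)
  let ?p = "\<Sum>j<n. monom (r j) j"
  have "degree ?p \<le> n - 1"
    by (rule degree_sum_le) (auto intro!: order.trans[OF degree_monom_le])
  then have "degree ?p < n" using n_ge_2 by simp
  then show ?thesis using main[of ?p] by (simp add: h lincomb_eq_evy)
qed

lemma F_divide: "g \<in> F \<Longrightarrow> h \<in> F \<Longrightarrow> g / h \<in> F"
  using F_mult[OF _ F_inverse] by (simp add: divide_inverse)

lemma F_powi: "h \<in> F \<Longrightarrow> h powi k \<in> F"
  by (simp add: power_int_def F_power F_inverse)

end

section \<open>Places and their valuation filtration\<close>

context superelliptic
begin

text \<open>
  The functions of value at least \<open>k\<close>. Zero is included by hand, since its value is \<open>0\<close> by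
  convention instead of infinity.
\<close>

definition vge :: "'k place \<Rightarrow> int \<Rightarrow> 'k ambient set"
  where "vge P k = {h \<in> F. h = 0 \<or> k \<le> P h}"

context
  fixes P :: "'k place"
  assumes P: "P \<in> places n f"
begin

lemma place_mult: "g \<in> F \<Longrightarrow> h \<in> F \<Longrightarrow> g \<noteq> 0 \<Longrightarrow> h \<noteq> 0 \<Longrightarrow> P (g * h) = P g + P h"
  using P by (auto simp: places_def)

lemma place_add: "g \<in> F \<Longrightarrow> h \<in> F \<Longrightarrow> g \<noteq> 0 \<Longrightarrow> h \<noteq> 0 \<Longrightarrow> g + h \<noteq> 0 \<Longrightarrow> min (P g) (P h) \<le> P (g + h)"
  using P by (auto simp: places_def)

lemma place_const: "P (const a) = 0"
proof (cases "a = 0")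
  case True
  then have "const a = 0" by (simp add: const_def)
  then show ?thesis using P by (auto simp: places_def)
qed (use P in \<open>auto simp: places_def\<close>)

lemma place_1: "P 1 = 0"
  using place_const[of 1] by (simp add: const_1)

lemma place_inverse: "h \<in> F \<Longrightarrow> h \<noteq> 0 \<Longrightarrow> P (inverse h) = - P h"
  using place_mult[of h "inverse h"] place_1 F_inverse[of h] by simp

lemma place_divide: "g \<in> F \<Longrightarrow> h \<in> F \<Longrightarrow> g \<noteq> 0 \<Longrightarrow> h \<noteq> 0 \<Longrightarrow> P (g / h) = P g - P h"
  using place_mult[of g "inverse h"] place_inverse[of h] F_inverse[of h] by (simp add: divide_inverse)

lemma place_power: "h \<in> F \<Longrightarrow> h \<noteq> 0 \<Longrightarrow> P (h ^ k) = int k * P h"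
  by (induction k) (simp_all add: place_1 place_mult F_power algebra_simps)

lemma place_powi: "h \<in> F \<Longrightarrow> h \<noteq> 0 \<Longrightarrow> P (h powi k) = k * P h"
  by (simp add: power_int_def place_power place_inverse F_inverse)

lemma place_minus: "h \<in> F \<Longrightarrow> P (- h) = P h"
proof (cases "h = 0")
  case False
  assume "h \<in> F"
  have "[:-1:] = (-1 :: 'k poly)" by (simp add: one_pCons)
  then have "const (-1) = (-1 :: 'k ambient)"
    unfolding const_def by (simp only: to_fract_uminus to_ac_minus to_fract_1 to_ac_1)
  then show ?thesis using place_mult[of "-1" h] False \<open>h \<in> F\<close> place_const[of "-1"] F_const[of "-1"] by simp
qed simp

lemma place_surj: "\<exists>h \<in> F. h \<noteq> 0 \<and> P h = k"
proof -
  have "k \<in> P ` (F - {0})" using P by (auto simp: places_def)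
  then show ?thesis by auto
qed

lemma place_prod: 
  assumes "\<And>i. i \<in> I \<Longrightarrow> h i \<in> F" "\<And>i. i \<in> I \<Longrightarrow> h i \<noteq> 0"
  shows "P (prod h I) = (\<Sum>i\<in>I. P (h i))"
  using assms
proof (induction I rule: infinite_finite_induct)
  case (insert i I)
  then show ?case using place_mult[of "h i" "prod h I"] F_prod[of I h] by simp
qed (simp_all add: place_1)

lemma vge_add: "g \<in> vge P k \<Longrightarrow> h \<in> vge P k \<Longrightarrow> g + h \<in> vge P k"
  using place_add[of g h] by (cases "g = 0"; cases "h = 0"; cases "g + h = 0") (auto simp: vge_def F_add F_0)

lemma vge_minus: "h \<in> vge P k \<Longrightarrow> - h \<in> vge P k"
  using place_minus[of h] by (auto simp: vge_def F_minus)

lemma vge_diff: "g \<in> vge P k \<Longrightarrow> h \<in> vge P k \<Longrightarrow> g - h \<in> vge P k"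
  using vge_add[OF _ vge_minus] by fastforce

lemma vge_0: "0 \<in> vge P k"
  by (simp add: vge_def F_0)

lemma vge_sum: "(\<And>i. i \<in> I \<Longrightarrow> h i \<in> vge P k) \<Longrightarrow> sum h I \<in> vge P k"
  by (induction I rule: infinite_finite_induct) (auto simp: vge_0 intro: vge_add)

lemma vge_mult: "g \<in> vge P k \<Longrightarrow> h \<in> vge P l \<Longrightarrow> g * h \<in> vge P (k + l)"
  using place_mult[of g h] by (cases "g = 0"; cases "h = 0") (auto simp: vge_def F_mult F_0)

lemma vge_mult0: "g \<in> vge P 0 \<Longrightarrow> h \<in> vge P k \<Longrightarrow> g * h \<in> vge P k"
  using vge_mult[of g 0 h k] by simp

lemma vge_const: "const a \<in> vge P 0"
  by (simp add: vge_def F_const place_const)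

lemma vge_power: "h \<in> vge P 0 \<Longrightarrow> h ^ k \<in> vge P 0"
  by (induction k) (use vge_mult0 vge_const[of 1] in \<open>auto simp: const_1\<close>)

lemma vge_mono: "h \<in> vge P k \<Longrightarrow> l \<le> k \<Longrightarrow> h \<in> vge P l"
  by (auto simp: vge_def)

text \<open>If the sum had larger value, then so would \<open>g = (g + h) - h\<close>.\<close>

lemma place_add_eq:
  assumes "g \<in> F" "g \<noteq> 0" "P g = k" "h \<in> vge P (k + 1)"
  shows "g + h \<noteq> 0 \<and> P (g + h) = k"
proof -
  have hF: "h \<in> F" using assms by (simp add: vge_def)
  have nz: "g + h \<noteq> 0"
  proof
    assume "g + h = 0"
    then have "g = - h" by (simp add: eq_neg_iff_add_eq_0)
    then have "g \<in> vge P (k + 1)" using vge_minus assms(4) by simp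
    then show False using assms by (simp add: vge_def)
  qed
  have "g \<in> vge P k" "h \<in> vge P k"
    using assms vge_mono by (auto simp: vge_def)
  then have ge: "k \<le> P (g + h)" using vge_add[of g k h] nz by (simp add: vge_def)
  have "\<not> k < P (g + h)"
  proof
    assume "k < P (g + h)"
    then have "g + h \<in> vge P (k + 1)" using assms hF by (simp add: vge_def F_add)
    then have "(g + h) - h \<in> vge P (k + 1)" using assms vge_diff by blast
    then show False using assms by (simp add: vge_def)
  qed
  then show ?thesis using nz ge by simp
qed

lemma vge_of_poly:
  assumes "x \<in> vge P 0"
  shows "of_poly p \<in> vge P 0"
proof (induction p)
  case 0
  then show ?case using vge_0 by (simp add: of_poly_def)
next
  case (pCons a p)
  have "pCons a p = [:a:] + [:0, 1:] * p" by simp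
  then have "of_poly (pCons a p) = const a + x * of_poly p"
    unfolding of_poly_def const_def x_fun_def by (simp only: to_fract_add to_fract_mult to_ac_add to_ac_mult)
  then show ?case using pCons vge_add[OF vge_const vge_mult0[OF assms pCons.IH]] by simp
qed

end

end

section \<open>The places over a valuation of the rational function field\<close>

text \<open>
  The numbers \<open>e\<close> and \<open>\<phi>\<close> will turn out to be the ramification index over \<open>v0\<close> and the value of
  \<open>y\<close> of every place over \<open>v0\<close>: their ratio is dictated by \<open>y^n = f\<close>, and as the value group is
  generated by the values of \<open>K(x)\<close> and of \<open>y\<close>, they have to be coprime.
\<close>

locale local_data = superelliptic f n + base_valuation v0 w m
  for f :: "'k :: {field, finite} poly" and n :: nat and v0 w m +
  fixes e :: nat and \<phi> :: int
  assumes e_pos: "e > 0"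
    and e_phi: "int n * \<phi> = int e * v0 ff"
    and e_phi_coprime: "coprime (int e) \<phi>"
begin

abbreviation weight :: "'k poly fract \<Rightarrow> nat \<Rightarrow> int"
  where "weight r j \<equiv> int e * v0 r + int j * \<phi>"

text \<open>
  The weight of a function is the value that a place over \<open>v0\<close> would assign to it if no
  cancellation occurred between its monomials; \<open>filt k\<close> consists of the weights at least \<open>k\<close>.
\<close>

definition filt :: "int \<Rightarrow> 'k ambient set"
  where "filt k = {lincomb r | r. \<forall>j<n. r j = 0 \<or> k \<le> weight (r j) j}"

lemma filt_subset_F: "h \<in> filt k \<Longrightarrow> h \<in> F"
  by (auto simp: filt_def F_eq_range_lincomb)

lemma filtE:
  assumes "h \<in> filt k"
  obtains r where "h = lincomb r" "\<And>j. j < n \<Longrightarrow> r j = 0 \<or> k \<le> weight (r j) j"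
  using assms by (auto simp: filt_def)

lemma filt_mono: "h \<in> filt k \<Longrightarrow> l \<le> k \<Longrightarrow> h \<in> filt l"
  by (erule filtE) (unfold filt_def, fastforce)

lemma filt_0: "0 \<in> filt k"
  unfolding filt_def by (auto intro!: exI[of _ "\<lambda>_. 0"] simp: lincomb_def)

lemma filt_add:
  assumes "g \<in> filt k" "h \<in> filt k"
  shows "g + h \<in> filt k"
proof -
  obtain r where r: "g = lincomb r" "\<And>j. j < n \<Longrightarrow> r j = 0 \<or> k \<le> weight (r j) j"
    using assms(1) by (rule filtE) blast
  obtain s where s: "h = lincomb s" "\<And>j. j < n \<Longrightarrow> s j = 0 \<or> k \<le> weight (s j) j"
    using assms(2) by (rule filtE) blast
  have "r j + s j = 0 \<or> k \<le> int e * v0 (r j + s j) + int j * \<phi>" if "j < n" for j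
  proof (cases "r j = 0 \<or> s j = 0 \<or> r j + s j = 0")
    case True
    then show ?thesis using r(2)[OF that] s(2)[OF that] by auto
  next
    case False
    then have "min (v0 (r j)) (v0 (s j)) \<le> v0 (r j + s j)" using v0_add by blast
    then have "v0 (r j) \<le> v0 (r j + s j) \<or> v0 (s j) \<le> v0 (r j + s j)" by linarith
    then have "int e * v0 (r j) \<le> int e * v0 (r j + s j) \<or> int e * v0 (s j) \<le> int e * v0 (r j + s j)"
      by (auto intro: mult_left_mono)
    then show ?thesis using False r(2)[OF that] s(2)[OF that] by auto
  qed
  then show ?thesis unfolding filt_def r(1) s(1) lincomb_add by auto
qed

lemma filt_sum: "(\<And>i. i \<in> I \<Longrightarrow> h i \<in> filt k) \<Longrightarrow> sum h I \<in> filt k"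
  by (induction I rule: infinite_finite_induct) (auto simp: filt_0 intro: filt_add)

lemma filt_monomial:
  assumes "r = 0 \<or> k \<le> weight r j"
  shows "to_ac r * y ^ j \<in> filt k"
proof (cases "r = 0")
  case True
  then show ?thesis using filt_0 by simp
next
  case False
  \<comment> \<open>By \<open>y^n = f\<close> and \<open>e_phi\<close>, reducing the exponent modulo \<open>n\<close> does not change the weight.\<close>
  define a where "a = j div n"
  define b where "b = j mod n"
  have j: "j = n * a + b" by (simp add: a_def b_def)
  have b: "b < n" using n_ge_2 by (simp add: b_def)
  define r' where "r' = (\<lambda>i. if i = b then r * ff ^ a else 0)"
  have "to_ac r * y ^ j = to_ac (r * ff ^ a) * y ^ b"
    by (simp add: j power_add power_mult y_power_n)
  also have "\<dots> = lincomb r'"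
    unfolding lincomb_def r'_def using b by (simp add: if_distrib[of to_ac] if_distrib[of "\<lambda>u. u * _"] cong: if_cong)
  finally have eq: "to_ac r * y ^ j = lincomb r'" .
  have "int e * v0 (r * ff ^ a) = int e * v0 r + int a * (int e * v0 ff)"
    using False f_nonzero by (simp add: v0_mult v0_power algebra_simps)
  also have "\<dots> = int e * v0 r + int a * (int n * \<phi>)" by (simp only: e_phi)
  finally have "int e * v0 (r * ff ^ a) + int b * \<phi> = weight r j"
    by (simp add: j algebra_simps)
  then have "\<forall>i<n. r' i = 0 \<or> k \<le> weight (r' i) i"
    using assms False by (auto simp: r'_def)
  then show ?thesis unfolding filt_def eq by blast
qed

lemma filt_mult:
  assumes "g \<in> filt k" "h \<in> filt l"
  shows "g * h \<in> filt (k + l)"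
proof -
  obtain r where r: "g = lincomb r" "\<And>j. j < n \<Longrightarrow> r j = 0 \<or> k \<le> weight (r j) j"
    using assms(1) by (rule filtE) blast
  obtain s where s: "h = lincomb s" "\<And>j. j < n \<Longrightarrow> s j = 0 \<or> l \<le> weight (s j) j"
    using assms(2) by (rule filtE) blast
  have "g * h = (\<Sum>i<n. \<Sum>j<n. to_ac (r i * s j) * y ^ (i + j))"
    by (simp add: r s lincomb_def sum_product power_add mult_ac)
  also have "\<dots> \<in> filt (k + l)"
  proof (intro filt_sum filt_monomial)
    fix i j assume ij: "i \<in> {..<n}" "j \<in> {..<n}"
    show "r i * s j = 0 \<or> k + l \<le> int e * v0 (r i * s j) + int (i + j) * \<phi>"
    proof (cases "r i = 0 \<or> s j = 0")
      case False
      then show ?thesis using r(2)[of i] s(2)[of j] ij by (auto simp: v0_mult algebra_simps)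
    qed auto
  qed
  finally show ?thesis .
qed

lemma filt_mult0: "g \<in> filt 0 \<Longrightarrow> h \<in> filt k \<Longrightarrow> g * h \<in> filt k"
  using filt_mult[of g 0 h k] by simp

lemma filt_to_ac:
  assumes "r = 0 \<or> k \<le> int e * v0 r"
  shows "to_ac r \<in> filt k"
  using filt_monomial[of r k 0] assms by simp

lemma filt_const: "const a \<in> filt 0"
  unfolding const_def using v0_const[of a] by (intro filt_to_ac) (cases "a = 0", auto)

lemma filt_1: "1 \<in> filt 0"
  using filt_const[of 1] by (simp add: const_1)

lemma filt_uminus: "h \<in> filt k \<Longrightarrow> - h \<in> filt k"
  using filt_mult0[OF filt_to_ac[of "-1"], of h k] v0_minus[of 1] v0_1 by simp

lemma filt_diff: "g \<in> filt k \<Longrightarrow> h \<in> filt k \<Longrightarrow> g - h \<in> filt k"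
  using filt_add[OF _ filt_uminus] by fastforce

lemma filt_power: "h \<in> filt 0 \<Longrightarrow> h ^ i \<in> filt 0"
  by (induction i) (auto simp: filt_1 intro: filt_mult0)

lemma filt_exhaust:
  assumes "h \<in> F"
  shows "\<exists>k. h \<in> filt k"
proof -
  obtain r where r: "h = lincomb r" using assms by (rule F_cases)
  let ?S = "(\<lambda>j. weight (r j) j) ` {..<n}"
  have "h \<in> filt (Min ?S)" unfolding filt_def r by (auto intro!: exI[of _ r])
  then show ?thesis by blast
qed

text \<open>
  As \<open>e\<close> and \<open>\<phi>\<close> are coprime, some monomial \<open>w^\<alpha> y^\<beta>\<close> has weight \<open>1\<close>, and its inverse is a monomial
  too. Multiplication by its powers identifies all steps of the filtration with each other.
\<close>

lemma exists_monomial_weight_1: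
  "\<exists>t. t \<noteq> 0 \<and> t \<in> filt 1 \<and> inverse t \<in> filt (-1)"
proof -
  obtain a b :: int where ab: "a * int e + b * \<phi> = 1"
    using bezout_int[of "int e" \<phi>] e_phi_coprime by auto
  \<comment> \<open>shift the Bezout coefficients so that the exponent of \<open>y\<close> is a natural number\<close>
  define \<beta> where "\<beta> = nat (b + int e * \<bar>b\<bar>)"
  define \<alpha> where "\<alpha> = a - \<phi> * \<bar>b\<bar>"
  have "1 * \<bar>b\<bar> \<le> int e * \<bar>b\<bar>" using e_pos by (intro mult_right_mono) auto
  then have \<beta>: "int \<beta> = b + int e * \<bar>b\<bar>" by (simp add: \<beta>_def)
  have wt: "int e * \<alpha> + int \<beta> * \<phi> = 1" unfolding \<beta> \<alpha>_def using ab by (simp add: algebra_simps)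
  define t where "t = to_ac (w powi \<alpha>) * y ^ \<beta>"
  have t0: "t \<noteq> 0" using w_nonzero y_nonzero by (simp add: t_def)
  have v\<alpha>: "v0 (w powi \<alpha>) = \<alpha>" "w powi \<alpha> \<noteq> 0" using v0_powi[OF w_nonzero] v0_w w_nonzero by simp_all
  have t1: "t \<in> filt 1" unfolding t_def using wt v\<alpha> by (intro filt_monomial) simp
  have "y ^ \<beta> * y ^ ((n - 1) * \<beta>) = y ^ (n * \<beta>)"
    using n_ge_2 by (simp flip: power_add add: algebra_simps)
  also have "\<dots> = to_ac (ff ^ \<beta>)" by (simp add: power_mult y_power_n)
  finally have "y ^ \<beta> * y ^ ((n - 1) * \<beta>) = to_ac (ff ^ \<beta>)" .
  then have "t * (to_ac (inverse (w powi \<alpha> * ff ^ \<beta>)) * y ^ ((n - 1) * \<beta>)) = 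
      to_ac (w powi \<alpha>) * to_ac (inverse (w powi \<alpha> * ff ^ \<beta>)) * to_ac (ff ^ \<beta>)"
    by (simp add: t_def mult_ac del: to_ac_mult to_ac_power to_ac_inverse)
  also have "\<dots> = to_ac (w powi \<alpha> * inverse (w powi \<alpha> * ff ^ \<beta>) * ff ^ \<beta>)"
    by (simp only: to_ac_mult)
  also have "w powi \<alpha> * inverse (w powi \<alpha> * ff ^ \<beta>) * ff ^ \<beta> = 1"
    using v\<alpha> f_nonzero by (simp add: field_simps)
  finally have inv: "inverse t = to_ac (inverse (w powi \<alpha> * ff ^ \<beta>)) * y ^ ((n - 1) * \<beta>)"
    by (intro inverse_unique) simp
  have nz: "w powi \<alpha> * ff ^ \<beta> \<noteq> 0" using v\<alpha> f_nonzero by simp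
  have "v0 (inverse (w powi \<alpha> * ff ^ \<beta>)) = - (\<alpha> + int \<beta> * v0 ff)"
    unfolding v0_inverse[OF nz] using v\<alpha> f_nonzero by (simp add: v0_mult v0_power)
  then have "int e * v0 (inverse (w powi \<alpha> * ff ^ \<beta>)) = - (int e * \<alpha> + int \<beta> * (int e * v0 ff))"
    by (simp only:) (simp add: algebra_simps)
  also have "\<dots> = - (int e * \<alpha> + int \<beta> * (int n * \<phi>))" by (simp only: e_phi)
  finally have "int e * v0 (inverse (w powi \<alpha> * ff ^ \<beta>)) + int ((n - 1) * \<beta>) * \<phi> = -1"
    using wt n_ge_2 by (simp add: of_nat_diff algebra_simps)
  then have "inverse t \<in> filt (-1)" unfolding inv by (intro filt_monomial) simp
  then show ?thesis using t0 t1 by blast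
qed

definition t :: "'k ambient"
  where "t = (SOME t. t \<noteq> 0 \<and> t \<in> filt 1 \<and> inverse t \<in> filt (-1))"

lemma t_nonzero: "t \<noteq> 0" and t_filt: "t \<in> filt 1" and inverse_t_filt: "inverse t \<in> filt (-1)"
  using someI_ex[OF exists_monomial_weight_1] by (auto simp: t_def)

lemma t_F: "t \<in> F"
  using t_filt filt_subset_F by blast

lemma t_powi_filt: "t powi k \<in> filt k"
proof -
  have "t ^ i \<in> filt (int i)" for i
  proof (induction i)
    case (Suc i)
    then show ?case using filt_mult[OF t_filt Suc] by simp
  qed (use filt_1 in auto)
  moreover have "inverse t ^ i \<in> filt (- int i)" for i
  proof (induction i)
    case (Suc i)
    then show ?case using filt_mult[OF inverse_t_filt Suc] by simp
  qed (use filt_1 in auto)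
  ultimately have "inverse t ^ nat (- k) \<in> filt (- int (nat (- k)))" "t ^ nat k \<in> filt (int (nat k))"
    by blast+
  then show ?thesis by (cases "k \<ge> 0") (simp_all add: power_int_def)
qed

lemma filt_t_powi: "h \<in> filt k \<Longrightarrow> t powi l * h \<in> filt (l + k)"
  using filt_mult[OF t_powi_filt] .

lemma CHAR_ambient: "CHAR('k ambient) = CHAR('k)"
proof -
  have "CHAR('k poly fract) = CHAR('k)"
  proof (rule CHAR_eqI)
    have nat: "(of_nat k :: 'k poly fract) = to_fract (of_nat k)" for k
      by (induction k) simp_all
    show "of_nat CHAR('k) = (0 :: 'k poly fract)"
      unfolding nat using of_nat_CHAR[where 'a = "'k poly"] by simp
    show "CHAR('k) dvd k" if "of_nat k = (0 :: 'k poly fract)" for k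
      using that unfolding nat by (simp add: of_nat_eq_0_iff_char_dvd)
  qed
  then show ?thesis by simp
qed

text \<open>
  The \<open>n\<close>-th power of a monomial of weight \<open>0\<close> lies in \<open>K(x)\<close> and is a unit of \<open>v0\<close>, so its \<open>n m\<close>-th
  power is \<open>1\<close> up to terms of positive weight. A power \<open>Q\<close> of the characteristic that is congruent
  to \<open>1\<close> modulo \<open>n m\<close> therefore acts trivially on the graded piece of weight \<open>0\<close>.
\<close>

lemma exists_frobenius_trivial:
  "\<exists>Q \<ge> 2. \<forall>h \<in> filt 0. h ^ Q - h \<in> filt 1"
proof -
  have prime: "prime (CHAR('k))" by (rule prime_CHAR_finite)
  have cop: "coprime (n * m) CHAR('k)"
    using m_coprime coprime_CHAR_of_dvd[OF n_dvd] by simp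
  define l where "l = totient (n * m)"
  have l: "l > 0" using n_ge_2 m_pos by (simp add: l_def)
  define Q where "Q = CHAR('k) ^ l"
  have Q2: "Q \<ge> 2" 
    using prime l prime_ge_2_nat[OF prime] one_less_power[of "CHAR('k)" l] unfolding Q_def by linarith
  have "[CHAR('k) ^ l = 1] (mod (n * m))"
    unfolding l_def using cop by (intro euler_theorem) (simp add: coprime_commute)
  then have "n * m dvd Q - 1"
    using Q2 by (simp add: Q_def cong_altdef_nat)
  then obtain i where i: "Q - 1 = n * m * i" by (rule dvdE)
  have Qi: "Q = Suc (n * m * i)" using i Q2 by simp
  have mono: "z ^ Q - z \<in> filt 1"
    if z: "z = to_ac r * y ^ j" "r \<noteq> 0" "0 \<le> weight r j" for z r j
  proof (cases "weight r j = 0")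
    case False
    then have z1: "z \<in> filt 1" unfolding z(1) using z by (intro filt_monomial) simp
    have "z \<in> filt 0" using z1 filt_mono by fastforce
    then have "z ^ (n * m * i) * z \<in> filt 1" using z1 filt_power filt_mult0 by blast
    then have "z ^ Q \<in> filt 1" by (simp add: Qi mult.commute)
    then show ?thesis using z1 filt_diff by blast
  next
    case True
    have z0: "z \<in> filt 0" unfolding z(1) using z by (intro filt_monomial) simp
    define \<rho> where "\<rho> = r ^ n * ff ^ j"
    have zn: "z ^ n = to_ac \<rho>"
    proof -
      have "(y ^ j) ^ n = (y ^ n) ^ j" by (simp add: mult.commute flip: power_mult)
      then show ?thesis by (simp add: z(1) \<rho>_def power_mult_distrib y_power_n)
    qed
    have \<rho>0: "\<rho> \<noteq> 0" using z f_nonzero by (simp add: \<rho>_def)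
    have "int e * v0 \<rho> = int n * (int e * v0 r) + int j * (int e * v0 ff)"
      using z(2) f_nonzero by (simp add: \<rho>_def v0_mult v0_power algebra_simps)
    also have "\<dots> = int n * (weight r j)"
      by (simp add: e_phi[symmetric] algebra_simps)
    finally have "v0 \<rho> = 0" using True e_pos by simp
    then have res: "\<rho> ^ m = 1 \<or> 0 < v0 (\<rho> ^ m - 1)" using residue \<rho>0 by blast
    have "to_ac (\<rho> ^ m - 1) \<in> filt 1"
    proof (rule filt_to_ac)
      have "1 * 1 \<le> int e * v0 (\<rho> ^ m - 1)" if "0 < v0 (\<rho> ^ m - 1)"
        using that e_pos by (intro mult_mono) auto
      then show "\<rho> ^ m - 1 = 0 \<or> 1 \<le> int e * v0 (\<rho> ^ m - 1)" using res by auto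
    qed
    then have \<sigma>: "z ^ (n * m) - 1 \<in> filt 1" by (simp add: power_mult zn)
    have "z ^ (n * m * i) - 1 = (z ^ (n * m) - 1) * (\<Sum>l<i. (z ^ (n * m)) ^ l)"
      unfolding power_mult[of z "n * m" i] by (rule power_diff_1_eq)
    also have "\<dots> = (\<Sum>l<i. (z ^ (n * m)) ^ l) * (z ^ (n * m) - 1)"
      by (rule mult.commute)
    also have "\<dots> \<in> filt 1"
      by (intro filt_mult0 filt_sum filt_power z0 \<sigma>)
    finally have "z * (z ^ (n * m * i) - 1) \<in> filt 1" by (rule filt_mult0[OF z0])
    then show ?thesis by (simp add: Qi algebra_simps)
  qed
  have "h ^ Q - h \<in> filt 1" if h: "h \<in> filt 0" for h
  proof -
    obtain r where r: "h = lincomb r" "\<And>j. j < n \<Longrightarrow> r j = 0 \<or> 0 \<le> weight (r j) j"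
      using h by (rule filtE) blast
    have "h ^ Q = (\<Sum>j<n. (to_ac (r j) * y ^ j) ^ Q)"
      unfolding r(1) lincomb_def using prime
      by (intro freshmans_dream_sum'[of _ l]) (simp_all only: CHAR_ambient Q_def)
    then have "h ^ Q - h = (\<Sum>j<n. (to_ac (r j) * y ^ j) ^ Q - to_ac (r j) * y ^ j)"
      by (simp add: r(1) lincomb_def sum_subtractf)
    also have "\<dots> \<in> filt 1"
    proof (rule filt_sum)
      fix j assume "j \<in> {..<n}"
      then show "(to_ac (r j) * y ^ j) ^ Q - to_ac (r j) * y ^ j \<in> filt 1"
        using mono[OF refl, of "r j" j] r(2)[of j] Q2 filt_0 by (cases "r j = 0") (auto simp: power_0_left)
    qed
    finally show ?thesis .
  qed
  then show ?thesis using Q2 by blast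
qed

definition Q :: nat where "Q = (SOME Q. Q \<ge> 2 \<and> (\<forall>h \<in> filt 0. h ^ Q - h \<in> filt 1))"

lemma Q_ge_2: "Q \<ge> 2" and frobenius: "h \<in> filt 0 \<Longrightarrow> h ^ Q - h \<in> filt 1"
  using someI_ex[OF exists_frobenius_trivial[unfolded Bex_def]] by (auto simp: Q_def)

end

section \<open>Prime ideals by maximality\<close>

text \<open>
  A set that is maximal among the proper ideals of \<open>R\<close> above \<open>I\<close> is a prime ideal. The ring \<open>R\<close> is
  a subring of the type, so ideals are closed under multiplication by \<open>R\<close> only.
\<close>

lemma exists_prime_ideal:
  fixes R I :: "'a :: comm_ring_1 set"
  assumes R: "1 \<in> R" "\<And>a b. a \<in> R \<Longrightarrow> b \<in> R \<Longrightarrow> a + b \<in> R" "\<And>a b. a \<in> R \<Longrightarrow> b \<in> R \<Longrightarrow> a * b \<in> R"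
    and I: "I \<subseteq> R" "0 \<in> I" "\<And>a b. a \<in> I \<Longrightarrow> b \<in> I \<Longrightarrow> a + b \<in> I" "\<And>a b. a \<in> R \<Longrightarrow> b \<in> I \<Longrightarrow> a * b \<in> I"
      "1 \<notin> I"
  shows "\<exists>q. I \<subseteq> q \<and> q \<subseteq> R \<and> (\<forall>a\<in>q. \<forall>b\<in>q. a + b \<in> q) \<and> (\<forall>a\<in>R. \<forall>b\<in>q. a * b \<in> q) \<and> 1 \<notin> q \<and>
    (\<forall>a\<in>R. \<forall>b\<in>R. a * b \<in> q \<longrightarrow> a \<in> q \<or> b \<in> q)"
proof -
  define S where "S = {q. I \<subseteq> q \<and> q \<subseteq> R \<and> (\<forall>a\<in>q. \<forall>b\<in>q. a + b \<in> q) \<and> (\<forall>a\<in>R. \<forall>b\<in>q. a * b \<in> q) \<and> 1 \<notin> q}"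
  have "\<exists>q\<in>S. \<forall>J\<in>S. q \<subseteq> J \<longrightarrow> J = q"
  proof (rule subset_Zorn_nonempty)
    have "I \<in> S" unfolding S_def using I by blast
    then show "S \<noteq> {}" by blast
    fix C assume C: "C \<noteq> {}" "subset.chain S C"
    then have CS: "C \<subseteq> S" and tot: "\<And>J Y. J \<in> C \<Longrightarrow> Y \<in> C \<Longrightarrow> J \<subseteq> Y \<or> Y \<subseteq> J"
      by (auto simp: subset_chain_def)
    have "a + b \<in> \<Union>C" if ab: "a \<in> \<Union>C" "b \<in> \<Union>C" for a b
    proof -
      obtain J Y where XY: "J \<in> C" "a \<in> J" "Y \<in> C" "b \<in> Y" using ab by blast
      from tot[OF XY(1,3)] obtain Z where "Z \<in> C" "a \<in> Z" "b \<in> Z" using XY by blast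
      then have "a + b \<in> Z" using CS by (auto simp: S_def)
      then show ?thesis using \<open>Z \<in> C\<close> by blast
    qed
    moreover have "a * b \<in> \<Union>C" if ab: "a \<in> R" "b \<in> \<Union>C" for a b
    proof -
      obtain Y where Y: "Y \<in> C" "b \<in> Y" using ab by blast
      then have "a * b \<in> Y" using CS ab(1) by (auto simp: S_def)
      then show ?thesis using Y(1) by blast
    qed
    moreover have "I \<subseteq> \<Union>C"
    proof -
      obtain Z where "Z \<in> C" using C(1) by blast
      then have "I \<subseteq> Z" using CS by (auto simp: S_def)
      then show ?thesis using \<open>Z \<in> C\<close> by blast
    qed
    moreover have "\<Union>C \<subseteq> R" "1 \<notin> \<Union>C" using CS by (auto simp: S_def)
    ultimately show "\<Union>C \<in> S" by (auto simp: S_def)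
  qed
  then obtain q where q: "q \<in> S" and max: "\<And>J. J \<in> S \<Longrightarrow> q \<subseteq> J \<Longrightarrow> J = q" by blast
  have qI: "I \<subseteq> q" "q \<subseteq> R" "1 \<notin> q" and q_add: "\<And>a b. a \<in> q \<Longrightarrow> b \<in> q \<Longrightarrow> a + b \<in> q"
    and q_mult: "\<And>a b. a \<in> R \<Longrightarrow> b \<in> q \<Longrightarrow> a * b \<in> q"
    using q by (auto simp: S_def)
  have q0: "0 \<in> q" using I(2) qI(1) by blast
  have R0: "0 \<in> R" using q0 qI(2) by blast
  have unit: "\<exists>u\<in>q. \<exists>v\<in>R. 1 = u + v * a" if a: "a \<in> R" "a \<notin> q" for a
  proof (rule ccontr)
    assume no: "\<not> ?thesis"
    define J where "J = {u + v * a | u v. u \<in> q \<and> v \<in> R}"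
    have "q \<subseteq> J"
    proof
      fix u assume "u \<in> q"
      then have "u = u + 0 * a \<and> u \<in> q \<and> 0 \<in> R" using R0 by simp
      then show "u \<in> J" unfolding J_def by blast
    qed
    moreover have "J \<in> S"
      unfolding S_def
    proof (intro CollectI conjI ballI)
      show "I \<subseteq> J" using \<open>q \<subseteq> J\<close> qI by blast
      show "J \<subseteq> R" using qI(2) R a by (auto simp: J_def)
      show "1 \<notin> J" using no by (auto simp: J_def)
      fix b c assume "b \<in> J" "c \<in> J"
      then obtain u v u' v' where "u \<in> q" "v \<in> R" "b = u + v * a" "u' \<in> q" "v' \<in> R" "c = u' + v' * a"
        by (auto simp: J_def)
      then have "b + c = (u + u') + (v + v') * a \<and> u + u' \<in> q \<and> v + v' \<in> R"
        using q_add R by (simp add: algebra_simps)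
      then show "b + c \<in> J" unfolding J_def by blast
    next
      fix b c assume bc: "b \<in> R" "c \<in> J"
      then obtain u v where "u \<in> q" "v \<in> R" "c = u + v * a" by (auto simp: J_def)
      then have "b * c = b * u + (b * v) * a \<and> b * u \<in> q \<and> b * v \<in> R"
        using q_mult R bc by (simp add: algebra_simps)
      then show "b * c \<in> J" unfolding J_def by blast
    qed
    ultimately have "J = q" using max by blast
    moreover have "a \<in> J"
    proof -
      have "a = 0 + 1 * a \<and> 0 \<in> q \<and> 1 \<in> R" using q0 R by simp
      then show ?thesis unfolding J_def by blast
    qed
    ultimately show False using a by blast
  qed
  have "a \<in> q \<or> b \<in> q" if ab: "a \<in> R" "b \<in> R" "a * b \<in> q" for a b
  proof (rule ccontr)
    assume "\<not> ?thesis"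
    then obtain u v u' v' where uv: "u \<in> q" "v \<in> R" "1 = u + v * a" "u' \<in> q" "v' \<in> R" "1 = u' + v' * b"
      using unit ab by meson
    have "1 = u + v * a * 1" using uv by simp
    also have "\<dots> = u + v * a * (u' + v' * b)" using uv by simp
    also have "\<dots> = u + (v * a) * u' + (v * v') * (a * b)" by (simp add: algebra_simps)
    finally have "1 = u + (v * a) * u' + (v * v') * (a * b)" .
    moreover have "(v * a) * u' \<in> q" "(v * v') * (a * b) \<in> q"
      using uv ab by (simp_all add: q_mult R)
    ultimately show False using qI uv(1) q_add by metis
  qed
  then show ?thesis
    by (intro exI[of _ q] conjI ballI impI) (use qI q_add q_mult in simp_all)
qed

section \<open>Places over a base valuation: uniqueness of the value group\<close>

context local_data
begin

definition lies_over :: "'k place \<Rightarrow> bool"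
  where "lies_over P \<longleftrightarrow> P \<in> places n f \<and> (\<exists>E>0. \<forall>r. r \<noteq> 0 \<longrightarrow> P (to_ac r) = E * v0 r)"

text \<open>
  Every \<open>r\<close> is a power of the uniformiser \<open>w\<close> times a unit of \<open>v0\<close>.
\<close>

lemma lies_overI:
  assumes P: "P \<in> places n f" and pos: "P (to_ac w) > 0"
    and unit: "\<And>r. r \<noteq> 0 \<Longrightarrow> v0 r = 0 \<Longrightarrow> P (to_ac r) = 0"
  shows "lies_over P"
  unfolding lies_over_def
proof (intro conjI exI[of _ "P (to_ac w)"] allI impI)
  fix r :: "'k poly fract" assume r: "r \<noteq> 0"
  define s where "s = r * w powi (- v0 r)"
  have s: "s \<noteq> 0" "v0 s = 0"
    using r w_nonzero v0_powi[OF w_nonzero] v0_w by (simp_all add: s_def v0_mult)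
  have "r = s * w powi (v0 r)"
    using w_nonzero by (simp add: s_def power_int_minus)
  moreover have pw: "to_ac (w powi k) = to_ac w powi k" for k
    by (simp add: power_int_def)
  ultimately have "to_ac r = to_ac s * to_ac w powi (v0 r)" by (metis to_ac_mult)
  then have "P (to_ac r) = P (to_ac s) + P (to_ac w powi (v0 r))"
    using s w_nonzero F_to_ac F_powi by (simp add: place_mult[OF P])
  then show "P (to_ac r) = P (to_ac w) * v0 r"
    using unit[OF s] w_nonzero by (simp add: place_powi[OF P] F_to_ac mult.commute)
qed (use P pos in auto)

context
  fixes P :: "'k place"
  assumes over: "lies_over P"
begin

lemma over_place: "P \<in> places n f"
  using over by (simp add: lies_over_def)

text \<open>
  If \<open>P\<close> multiplies the values of \<open>v0\<close> by \<open>E0\<close>, then \<open>e P(y) = E0 \<phi>\<close>, and \<open>e\<close> divides \<open>E0\<close> by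
  coprimality. The quotient \<open>E\<close> is the factor between weights and values; it is shown to be \<open>1\<close>
  below.
\<close>

lemma exists_ramification_factor:
  "\<exists>E>0. (\<forall>k. filt k \<subseteq> vge P (E * k)) \<and> P y = E * \<phi> \<and> (\<forall>r. r \<noteq> 0 \<longrightarrow> P (to_ac r) = E * int e * v0 r)"
proof -
  obtain E0 where E0: "E0 > 0" "\<And>r. r \<noteq> 0 \<Longrightarrow> P (to_ac r) = E0 * v0 r"
    using over by (auto simp: lies_over_def)
  have ny: "int n * P y = E0 * v0 ff"
    using place_power[OF over_place F_y y_nonzero, of n] E0(2)[of ff] f_nonzero by (simp add: y_power_n)
  have "int n * (int e * P y) = E0 * (int e * v0 ff)" using ny by (simp add: algebra_simps)
  also have "\<dots> = int n * (E0 * \<phi>)" by (simp add: e_phi[symmetric])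
  finally have ey: "int e * P y = E0 * \<phi>" using n_ge_2 by simp
  then have "int e dvd E0 * \<phi>" by (metis dvd_triv_left)
  then have "int e dvd E0" using e_phi_coprime by (simp add: coprime_dvd_mult_left_iff)
  then obtain E where E: "E0 = int e * E" by (rule dvdE)
  have Epos: "E > 0" using E0(1) E e_pos by (simp add: zero_less_mult_iff)
  have Py: "P y = E * \<phi>" using ey E e_pos by simp
  have "filt k \<subseteq> vge P (E * k)" for k
  proof
    fix h assume "h \<in> filt k"
    then obtain r where r: "h = lincomb r" "\<And>j. j < n \<Longrightarrow> r j = 0 \<or> k \<le> weight (r j) j"
      by (rule filtE) blast
    show "h \<in> vge P (E * k)"
      unfolding r(1) lincomb_def
    proof (rule vge_sum[OF over_place])
      fix j assume j: "j \<in> {..<n}"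
      show "to_ac (r j) * y ^ j \<in> vge P (E * k)"
      proof (cases "r j = 0")
        case True
        then show ?thesis using vge_0[OF over_place] by simp
      next
        case False
        have "P (to_ac (r j) * y ^ j) = E * (weight (r j) j)"
          using False y_nonzero E0(2)[OF False]
          by (simp add: place_mult[OF over_place] place_power[OF over_place] F_to_ac F_power F_y Py E algebra_simps)
        moreover have "E * k \<le> E * (weight (r j) j)"
          using r(2)[of j] j False Epos by (intro mult_left_mono) auto
        ultimately show ?thesis by (simp add: vge_def F_mult F_to_ac F_power F_y)
      qed
    qed
  qed
  moreover have "P (to_ac r) = E * int e * v0 r" if "r \<noteq> 0" for r
    using E0(2)[OF that] E by (simp add: mult_ac)
  ultimately show ?thesis using Epos Py by blast
qed

text \<open>
  If \<open>h\<close> has positive value, then \<open>g = 1 - h^(Q - 1)\<close> has value \<open>0\<close>, while \<open>g h\<close> has positive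
  weight and can be divided by \<open>t\<close>. Repeating this shows that values are multiples of the value
  of \<open>t\<close>.
\<close>

lemma unit_multiple_eq_power_t:
  assumes "h \<in> F" "h \<noteq> 0"
  shows "\<exists>k g h'. g \<in> filt 0 \<and> h' \<in> filt 0 \<and> g \<noteq> 0 \<and> h' \<noteq> 0 \<and> P g = 0 \<and> P h' = 0 \<and> g * h = t powi k * h'"
proof -
  obtain E where E: "E > 0" "\<And>k. filt k \<subseteq> vge P (E * k)"
    using exists_ramification_factor by blast
  have Pt: "P t = E"
  proof -
    have "t \<in> vge P E" "inverse t \<in> vge P (- E)"
      using E(2)[of 1] E(2)[of "-1"] t_filt inverse_t_filt by auto
    then show ?thesis
      using t_nonzero place_inverse[OF over_place t_F t_nonzero] by (simp add: vge_def)
  qed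
  have int: "\<exists>k g h'. g \<in> filt 0 \<and> h' \<in> filt 0 \<and> g \<noteq> 0 \<and> h' \<noteq> 0 \<and> P g = 0 \<and> P h' = 0 \<and> g * h = t powi k * h'"
    if "h \<in> filt 0" "h \<noteq> 0" for h
    using that
  proof (induction "nat (P h)" arbitrary: h rule: less_induct)
    case less
    have hF: "h \<in> F" using less.prems filt_subset_F by blast
    have ge: "P h \<ge> 0" using E(2)[of 0] less.prems by (auto simp: vge_def)
    show ?case
    proof (cases "P h = 0")
      case True
      have "P 1 = 0" using place_1[OF over_place] .
      then show ?thesis
        using True less.prems filt_1 by (intro exI[of _ 0] exI[of _ 1] exI[of _ h]) auto
    next
      case False
      define g where "g = 1 + (- (h ^ (Q - 1)))"
      have "h ^ (Q - 1) \<in> vge P 1"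
      proof -
        have "1 * 1 \<le> int (Q - 1) * P h" using Q_ge_2 ge False by (intro mult_mono) auto
        then show ?thesis
          using less.prems by (simp add: vge_def F_power hF place_power[OF over_place] del: of_nat_diff)
      qed
      then have "- (h ^ (Q - 1)) \<in> vge P (0 + 1)" using vge_minus[OF over_place] by simp
      from place_add_eq[OF over_place F_1 _ place_1[OF over_place] this]
      have g: "g \<noteq> 0" "P g = 0" by (simp_all add: g_def)
      have g0: "g \<in> filt 0"
        unfolding g_def using less.prems by (intro filt_add filt_1 filt_uminus filt_power)
      have "Q = Suc (Q - 1)" using Q_ge_2 by simp
      then have "h ^ Q = h * h ^ (Q - 1)" by (metis power_Suc)
      then have "g * h = - (h ^ Q - h)" by (simp add: g_def algebra_simps)
      then have gh: "g * h \<in> filt 1" using frobenius less.prems filt_uminus by metis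
      define h1 where "h1 = t powi (-1) * (g * h)"
      have h1: "h1 \<in> filt 0" using filt_t_powi[OF gh, of "-1"] by (simp add: h1_def)
      have h1n: "h1 \<noteq> 0" using less.prems g t_nonzero by (simp add: h1_def)
      have "P h1 = P h - E"
        using g g0 filt_subset_F hF less.prems t_nonzero t_F Pt
        by (simp add: h1_def place_mult[OF over_place] F_mult F_inverse place_inverse[OF over_place])
      moreover have "P h1 \<ge> 0" using h1 E(2)[of 0] h1n by (auto simp: vge_def)
      ultimately have "nat (P h1) < nat (P h)" using E(1) by linarith
      from less.hyps[OF this h1 h1n]
      obtain k g' h' where *: "g' \<in> filt 0" "h' \<in> filt 0" "g' \<noteq> 0" "h' \<noteq> 0" "P g' = 0" "P h' = 0"
        "g' * h1 = t powi k * h'" by blast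
      have "g' * g * h = t powi 1 * (g' * h1)" using t_nonzero by (simp add: h1_def mult_ac)
      also have "\<dots> = t powi (1 + k) * h'" using *(7) t_nonzero by (simp add: power_int_add)
      finally have "g' * g * h = t powi (1 + k) * h'" .
      moreover have "P (g' * g) = 0"
        using *(1,3,5) g g0 filt_subset_F by (simp add: place_mult[OF over_place])
      ultimately show ?thesis
        using * g g0 filt_mult0
        by (intro exI[of _ "1 + k"] exI[of _ "g' * g"] exI[of _ h']) auto
    qed
  qed
  obtain l where l: "h \<in> filt l" using filt_exhaust assms(1) by blast
  then have "t powi (- l) * h \<in> filt 0" using filt_t_powi[OF l, of "- l"] by simp
  moreover have "t powi (- l) * h \<noteq> 0" using assms t_nonzero by simp
  ultimately obtain k g h' where *: "g \<in> filt 0" "h' \<in> filt 0" "g \<noteq> 0" "h' \<noteq> 0" "P g = 0" "P h' = 0"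
      "g * (t powi (- l) * h) = t powi k * h'" using int by blast
  have "g * h = t powi l * (g * (t powi (- l) * h))"
    using t_nonzero by (simp add: power_int_minus)
  also have "\<dots> = t powi (l + k) * h'" using *(7) t_nonzero by (simp add: power_int_add)
  finally show ?thesis using * by blast
qed

text \<open>
  The value of \<open>t\<close> divides all values, and a normalised valuation takes the value \<open>1\<close>.
\<close>

lemma place_t: "P t = 1"
proof -
  obtain E where E: "E > 0" "\<And>k. filt k \<subseteq> vge P (E * k)"
    using exists_ramification_factor by blast
  have Pt: "P t \<ge> 1" using E(2)[of 1] t_filt E(1) t_nonzero by (auto simp: vge_def)
  obtain h where h: "h \<in> F" "h \<noteq> 0" "P h = 1" using place_surj[OF over_place] by blast
  obtain k g h' where *: "g \<in> filt 0" "h' \<in> filt 0" "g \<noteq> 0" "h' \<noteq> 0" "P g = 0" "P h' = 0"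
      "g * h = t powi k * h'" using unit_multiple_eq_power_t[OF h(1,2)] by blast
  have "P (g * h) = 1" using *(1,3,5) h filt_subset_F by (simp add: place_mult[OF over_place])
  moreover have "P (t powi k * h') = k * P t"
    using *(2,4,6) filt_subset_F t_F t_nonzero by (simp add: place_mult[OF over_place] place_powi[OF over_place] F_powi)
  ultimately have "k * P t = 1" unfolding *(7) by simp
  then show ?thesis using Pt by (simp add: zmult_eq_1_iff)
qed

lemma unit_multiple_eq_power_t':
  assumes "h \<in> F" "h \<noteq> 0"
  shows "\<exists>g h'. g \<in> filt 0 \<and> h' \<in> filt 0 \<and> g \<noteq> 0 \<and> h' \<noteq> 0 \<and> P g = 0 \<and> P h' = 0 \<and> g * h = t powi (P h) * h'"
proof -
  obtain k g h' where *: "g \<in> filt 0" "h' \<in> filt 0" "g \<noteq> 0" "h' \<noteq> 0" "P g = 0" "P h' = 0"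
      "g * h = t powi k * h'" using unit_multiple_eq_power_t[OF assms] by blast
  have "P (g * h) = P h" using *(1,3,5) assms filt_subset_F by (simp add: place_mult[OF over_place])
  moreover have "P (t powi k * h') = k"
    using *(2,4,6) filt_subset_F t_F t_nonzero
    by (simp add: place_mult[OF over_place] place_powi[OF over_place] F_powi place_t)
  ultimately have "k = P h" unfolding *(7) by simp
  then show ?thesis using * by blast
qed

lemma place_over: 
  shows "filt k \<subseteq> vge P k" and "P y = \<phi>" and "r \<noteq> 0 \<Longrightarrow> P (to_ac r) = int e * v0 r"
proof -
  obtain E where E: "E > 0" "\<And>k. filt k \<subseteq> vge P (E * k)" "P y = E * \<phi>"
    "\<And>r. r \<noteq> 0 \<Longrightarrow> P (to_ac r) = E * int e * v0 r"
    using exists_ramification_factor by blast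
  have "t \<in> vge P E" "inverse t \<in> vge P (- E)"
    using E(2)[of 1] E(2)[of "-1"] t_filt inverse_t_filt by auto
  then have "E = 1"
    using t_nonzero place_inverse[OF over_place t_F t_nonzero] place_t by (simp add: vge_def)
  then show "filt k \<subseteq> vge P k" "P y = \<phi>" "r \<noteq> 0 \<Longrightarrow> P (to_ac r) = int e * v0 r"
    using E by auto
qed

end

section \<open>Places over a base valuation: existence\<close>

text \<open>
  A prime ideal \<open>q\<close> of \<open>filt 0\<close> that contains \<open>filt 1\<close> defines a place: every function has the
  form \<open>t^k h'/g\<close> with \<open>g, h' \<notin> q\<close>, by the same use of \<open>1 - h^(Q - 1)\<close> as above, and \<open>k\<close> is its
  value. A prime ideal that contains \<open>1 - h0^(Q - 1)\<close> does not contain \<open>h0\<close>.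
\<close>

lemma exists_place_over:
  assumes h0: "h0 \<in> filt 0" "h0 \<notin> filt 1"
  shows "\<exists>P. lies_over P \<and> P h0 = 0"
proof -
  define g0 where "g0 = 1 - h0 ^ (Q - 1)"
  have powQ: "h ^ Q = h * h ^ (Q - 1)" for h :: "'k ambient"
  proof -
    have "Q = Suc (Q - 1)" using Q_ge_2 by simp
    then show ?thesis by (metis power_Suc)
  qed
  have g0: "g0 \<in> filt 0" "g0 * h0 \<in> filt 1"
  proof -
    show "g0 \<in> filt 0" unfolding g0_def using h0 by (intro filt_diff filt_1 filt_power)
    have "g0 * h0 = - (h0 ^ Q - h0)" by (simp add: g0_def powQ algebra_simps)
    then show "g0 * h0 \<in> filt 1" using frobenius h0 filt_uminus by metis
  qed
  define I where "I = {a + b * g0 | a b. a \<in> filt 1 \<and> b \<in> filt 0}"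
  have f10: "h \<in> filt 1 \<Longrightarrow> h \<in> filt 0" for h using filt_mono by fastforce
  have one: "1 \<notin> I"
  proof
    assume "1 \<in> I"
    then obtain a b where ab: "1 = a + b * g0" "a \<in> filt 1" "b \<in> filt 0" by (auto simp: I_def)
    have "h0 = h0 * (a + b * g0)" using ab(1) by simp
    also have "\<dots> = h0 * a + b * (g0 * h0)" by (simp add: algebra_simps)
    finally have "h0 = h0 * a + b * (g0 * h0)" .
    moreover have "h0 * a + b * (g0 * h0) \<in> filt 1"
      by (intro filt_add filt_mult0 ab h0 g0)
    ultimately show False using h0 by simp
  qed
  have "\<exists>q. I \<subseteq> q \<and> q \<subseteq> filt 0 \<and> (\<forall>a\<in>q. \<forall>b\<in>q. a + b \<in> q) \<and> (\<forall>a\<in>filt 0. \<forall>b\<in>q. a * b \<in> q) \<and> 1 \<notin> q \<and>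
    (\<forall>a\<in>filt 0. \<forall>b\<in>filt 0. a * b \<in> q \<longrightarrow> a \<in> q \<or> b \<in> q)" (is "\<exists>q. ?prime q")
  proof (rule exists_prime_ideal[OF filt_1 filt_add filt_mult0 _ _ _ _ one])
    show "I \<subseteq> filt 0" using g0 f10 by (auto simp: I_def intro!: filt_add filt_mult0)
    have "0 = 0 + 0 * g0 \<and> 0 \<in> filt 1 \<and> 0 \<in> filt 0" using filt_0 by simp
    then show "0 \<in> I" unfolding I_def by blast
  next
    fix a b assume "a \<in> I" "b \<in> I"
    then obtain u v u' v' where uv: "a = u + v * g0" "u \<in> filt 1" "v \<in> filt 0"
      "b = u' + v' * g0" "u' \<in> filt 1" "v' \<in> filt 0" by (auto simp: I_def)
    then have "a + b = (u + u') + (v + v') * g0 \<and> u + u' \<in> filt 1 \<and> v + v' \<in> filt 0"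
      by (simp add: algebra_simps filt_add)
    then show "a + b \<in> I" unfolding I_def by blast
  next
    fix a b assume a: "a \<in> filt 0" and "b \<in> I"
    then obtain u v where uv: "b = u + v * g0" "u \<in> filt 1" "v \<in> filt 0" by (auto simp: I_def)
    then have "a * b = a * u + (a * v) * g0 \<and> a * u \<in> filt 1 \<and> a * v \<in> filt 0"
      using a by (simp add: algebra_simps filt_mult0)
    then show "a * b \<in> I" unfolding I_def by blast
  qed
  then obtain q where "?prime q" by (rule exE)
  then have q: "I \<subseteq> q" "q \<subseteq> filt 0" "\<And>a b. a \<in> q \<Longrightarrow> b \<in> q \<Longrightarrow> a + b \<in> q"
    "\<And>a b. a \<in> filt 0 \<Longrightarrow> b \<in> q \<Longrightarrow> a * b \<in> q" "1 \<notin> q"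
    "\<And>a b. a \<in> filt 0 \<Longrightarrow> b \<in> filt 0 \<Longrightarrow> a * b \<in> q \<Longrightarrow> a \<in> q \<or> b \<in> q"
    by blast+
  have filt1_q: "filt 1 \<subseteq> q"
  proof
    fix a assume "a \<in> filt 1"
    then have "a = a + 0 * g0 \<and> a \<in> filt 1 \<and> 0 \<in> filt 0" using filt_0 by simp
    then have "a \<in> I" unfolding I_def by blast
    then show "a \<in> q" using q(1) by blast
  qed
  have "g0 = 0 + 1 * g0 \<and> 0 \<in> filt 1 \<and> 1 \<in> filt 0" using filt_0 filt_1 by simp
  then have "g0 \<in> I" unfolding I_def by blast
  then have g0q: "g0 \<in> q" using q(1) by blast
  define S where "S = filt 0 - q"
  have S_mult: "a * b \<in> S" if "a \<in> S" "b \<in> S" for a b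
    using that q(6) filt_mult0 by (auto simp: S_def)
  have S_1: "1 \<in> S" using q(5) filt_1 by (simp add: S_def)
  have S_filt: "a \<in> filt 0" and S_nz: "a \<noteq> 0" if "a \<in> S" for a
    using that filt1_q filt_0 by (auto simp: S_def)
  have S_F: "a \<in> F" if "a \<in> S" for a using S_filt[OF that] filt_subset_F by blast
  have one_minus: "1 - h ^ (Q - 1) \<in> S" if "h \<in> q" for h
  proof -
    have hf: "h \<in> filt 0" using that q(2) by blast
    have "h ^ (Q - 2) * h \<in> q" using that hf by (intro q(4) filt_power)
    moreover have "h ^ (Q - 1) = h ^ (Q - 2) * h"
    proof -
      have "Q - 1 = Suc (Q - 2)" using Q_ge_2 by simp
      then show ?thesis by (simp add: mult.commute)
    qed
    ultimately have hq: "h ^ (Q - 1) \<in> q" by simp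
    have "1 - h ^ (Q - 1) \<notin> q"
    proof
      assume "1 - h ^ (Q - 1) \<in> q"
      then have "(1 - h ^ (Q - 1)) + h ^ (Q - 1) \<in> q" using hq q(3) by blast
      then show False using q(5) by simp
    qed
    moreover have "1 - h ^ (Q - 1) \<in> filt 0" using hf by (intro filt_diff filt_1 filt_power)
    ultimately show ?thesis by (simp add: S_def)
  qed
  have h0S: "h0 \<in> S"
  proof -
    have "h0 \<notin> q"
    proof
      assume "h0 \<in> q"
      then show False using one_minus[of h0] g0q by (simp add: g0_def S_def)
    qed
    then show ?thesis using h0 by (simp add: S_def)
  qed
  \<comment> \<open>\<open>V h k\<close> says that \<open>h\<close> is \<open>t^k\<close> up to a unit of the localisation at \<open>q\<close>.\<close>
  define V where "V = (\<lambda>h k. \<exists>g\<in>S. \<exists>h'\<in>S. g * h = t powi k * h')"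
  have V_ge: "k \<le> l" if V: "V h l" and g: "g \<in> S" and r: "r \<in> filt 0" and eq: "g * h = t powi k * r"
    for h k l g r
  proof (rule ccontr)
    assume "\<not> k \<le> l"
    then have "k - l - 1 \<ge> 0" by simp
    obtain g' h' where *: "g' \<in> S" "h' \<in> S" "g' * h = t powi l * h'" using V by (auto simp: V_def)
    have "t powi l * (g * h') = g * (g' * h)" using *(3) by (simp add: mult_ac)
    also have "\<dots> = g' * (g * h)" by (simp add: mult_ac)
    also have "\<dots> = t powi k * (g' * r)" using eq by (simp add: mult_ac)
    also have "t powi k = t powi l * t powi (k - l)" using t_nonzero by (simp flip: power_int_add)
    finally have "g * h' = t powi (k - l) * (g' * r)" using t_nonzero by (simp add: mult.assoc)
    moreover have "g' * r \<in> filt 0" using S_filt[OF *(1)] r by (rule filt_mult0)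
    ultimately have "g * h' \<in> filt (k - l)" using filt_t_powi[of "g' * r" 0 "k - l"] by simp
    then have "g * h' \<in> filt 1" using filt_mono \<open>\<not> k \<le> l\<close> by fastforce
    then have "g * h' \<notin> S" using filt1_q by (auto simp: S_def)
    then show False using S_mult[OF g *(2)] by blast
  qed
  have V_le: "k \<le> l" if kl: "V h k" "V h l" for h k l
  proof -
    obtain g h' where "g \<in> S" "h' \<in> S" "g * h = t powi k * h'" using kl(1) by (auto simp: V_def)
    then show ?thesis using V_ge[OF kl(2)] S_filt by blast
  qed
  have V_unique: "k = l" if "V h k" "V h l" for h k l
    using V_le[OF that] V_le[OF that(2,1)] by (rule order_antisym)
  have V_ex: "\<exists>k. V h k" if h: "h \<in> F" "h \<noteq> 0" for h
  proof -
    \<comment> \<open>The value is the largest weight to which \<open>h\<close> can be raised by a factor in \<open>S\<close>. It exists,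
      because the weights of \<open>h\<close> and of its inverse bound each other.\<close>
    define K where "K = {k. \<exists>g\<in>S. g * h \<in> filt k}"
    obtain k0 where "h \<in> filt k0" using filt_exhaust h by blast
    then have k0: "k0 \<in> K" using S_1 by (auto simp: K_def intro!: bexI[of _ 1])
    obtain l where l: "inverse h \<in> filt l" using filt_exhaust F_inverse h by blast
    have bound: "k \<le> - l" if "k \<in> K" for k
    proof (rule ccontr)
      assume "\<not> k \<le> - l"
      obtain g where g: "g \<in> S" "g * h \<in> filt k" using \<open>k \<in> K\<close> by (auto simp: K_def)
      have "g * h * inverse h \<in> filt (k + l)" using filt_mult g l by blast
      then have "g \<in> filt 1" using filt_mono[of g "k + l" 1] \<open>\<not> k \<le> - l\<close> h by (simp add: mult.assoc)
      then show False using g filt1_q by (auto simp: S_def)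
    qed
    have "\<exists>k\<in>K. \<forall>k'\<in>K. k' \<le> k"
    proof -
      have "finite (K \<inter> {k0..})"
        by (rule finite_subset[of _ "{k0..- l}"]) (use bound in auto)
      then have max: "Max (K \<inter> {k0..}) \<in> K \<inter> {k0..}" "\<And>k'. k' \<in> K \<inter> {k0..} \<Longrightarrow> k' \<le> Max (K \<inter> {k0..})"
        using k0 Max_in[of "K \<inter> {k0..}"] by auto
      have "k' \<le> Max (K \<inter> {k0..})" if "k' \<in> K" for k'
        using max(1) max(2)[of k'] that by (cases "k0 \<le> k'") auto
      then show ?thesis using max(1) by blast
    qed
    then obtain k where k: "k \<in> K" "\<And>k'. k' \<in> K \<Longrightarrow> k' \<le> k" by blast
    obtain g where g: "g \<in> S" "g * h \<in> filt k" using k(1) by (auto simp: K_def)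
    define h' where "h' = t powi (- k) * (g * h)"
    have h': "h' \<in> filt 0" using filt_t_powi[OF g(2), of "- k"] by (simp add: h'_def)
    have eq: "g * h = t powi k * h'" using t_nonzero by (simp add: h'_def power_int_minus)
    have "h' \<notin> q"
    proof
      assume "h' \<in> q"
      define g1 where "g1 = 1 - h' ^ (Q - 1)"
      have g1: "g1 \<in> S" using one_minus[OF \<open>h' \<in> q\<close>] by (simp add: g1_def)
      have "g1 * h' = - (h' ^ Q - h')" by (simp add: g1_def powQ algebra_simps)
      then have "g1 * h' \<in> filt 1" using frobenius[OF h'] filt_uminus by metis
      then have "t powi k * (g1 * h') \<in> filt (k + 1)" by (rule filt_t_powi)
      moreover have "t powi k * (g1 * h') = (g1 * g) * h" using eq by (simp add: mult_ac)
      ultimately have "k + 1 \<in> K" using S_mult[OF g1 g(1)] by (auto simp: K_def)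
      then show False using k(2) by fastforce
    qed
    then have "h' \<in> S" using h' by (simp add: S_def)
    then show ?thesis using eq g by (auto simp: V_def)
  qed
  define P where "P = (\<lambda>h. if h \<in> F \<and> h \<noteq> 0 then (THE k. V h k) else 0)"
  have PV: "P h = k" if "V h k" "h \<in> F" "h \<noteq> 0" for h k
    unfolding P_def using that V_unique by (auto intro: the_equality)
  have VP: "V h (P h)" if "h \<in> F" "h \<noteq> 0" for h
    using V_ex[OF that] PV that by blast
  have VI: "V h k" if "g \<in> S" "h' \<in> S" "g * h = t powi k * h'" for g h h' k
    unfolding V_def using that by blast
  have V_S: "V h 0" if "h \<in> S" for h
    by (rule VI[OF S_1 that]) simp
  have P_S: "P h = 0" if "h \<in> S" for h
    using PV[OF V_S[OF that] S_F[OF that] S_nz[OF that]] .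
  have V_mult: "V (g * h) (k + l)" if gh: "V g k" "V h l" for g h k l
  proof -
    obtain a a' b b' where "a \<in> S" "a' \<in> S" "a * g = t powi k * a'" "b \<in> S" "b' \<in> S" "b * h = t powi l * b'"
      using gh by (auto simp: V_def)
    note ab = this
    have "(a * b) * (g * h) = t powi (k + l) * (a' * b')"
    proof -
      have "(a * b) * (g * h) = (a * g) * (b * h)" by (simp add: mult_ac)
      also have "\<dots> = (t powi k * t powi l) * (a' * b')" using ab by (simp add: mult_ac)
      finally show ?thesis using t_nonzero by (simp add: power_int_add)
    qed
    with ab show ?thesis using S_mult unfolding V_def by blast
  qed
  have P_mult: "P (g * h) = P g + P h" if "g \<in> F" "h \<in> F" "g \<noteq> 0" "h \<noteq> 0" for g h
    using V_mult[OF VP VP] that by (intro PV) (auto simp: F_mult)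
  have P_add: "P g \<le> P (g + h)" if gh: "g \<in> F" "h \<in> F" "g \<noteq> 0" "h \<noteq> 0" "g + h \<noteq> 0" "P g \<le> P h" for g h
  proof -
    obtain a a' where a: "a \<in> S" "a' \<in> S" "a * g = t powi (P g) * a'" using VP[OF gh(1,3)] by (auto simp: V_def)
    obtain b b' where b: "b \<in> S" "b' \<in> S" "b * h = t powi (P h) * b'" using VP[OF gh(2,4)] by (auto simp: V_def)
    define r where "r = b * a' + t powi (P h - P g) * (a * b')"
    have tk: "t powi (P h) = t powi (P g) * t powi (P h - P g)" using t_nonzero by (simp flip: power_int_add)
    have "(a * b) * (g + h) = b * (a * g) + a * (b * h)" by (simp add: algebra_simps)
    also have "\<dots> = t powi (P g) * r" unfolding a(3) b(3) tk r_def by (simp add: algebra_simps)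
    finally have eq: "(a * b) * (g + h) = t powi (P g) * r" .
    have "t powi (P h - P g) * (a * b') \<in> filt (P h - P g)"
      using filt_t_powi[of "a * b'" 0] S_filt S_mult a b by simp
    then have "t powi (P h - P g) * (a * b') \<in> filt 0" using filt_mono gh by fastforce
    then have "r \<in> filt 0" unfolding r_def using S_filt[OF S_mult[OF b(1) a(2)]] filt_add by blast
    then show ?thesis
      by (rule V_ge[OF VP[OF F_add[OF gh(1,2)] gh(5)] S_mult[OF a(1) b(1)] _ eq])
  qed
  have P_const: "P (const a) = 0" if "a \<noteq> 0" for a
  proof -
    have "const a * const (inverse a) = 1" using that by (simp add: const_1 flip: const_mult)
    then have "const a \<notin> q" using q(4)[OF filt_const[of "inverse a"], of "const a"] q(5) by (auto simp: mult.commute)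
    then show ?thesis using filt_const by (intro P_S) (simp add: S_def)
  qed
  have place: "P \<in> places n f"
    unfolding places_def
  proof (intro CollectI conjI allI impI ballI)
    show "P h = 0" if "h \<notin> F \<or> h = 0" for h using that by (auto simp: P_def)
    show "P ` (F - {0}) = UNIV"
    proof (intro equalityI subset_UNIV subsetI)
      fix k :: int
      have "P (t powi k) = k"
        by (rule PV[OF VI[OF S_1 S_1] F_powi[OF t_F]]) (use t_nonzero in simp_all)
      moreover have "t powi k \<in> F - {0}" using t_nonzero t_F F_powi by simp
      ultimately show "k \<in> P ` (F - {0})" by (metis imageI)
    qed
    show "P (const a) = 0" if "a \<noteq> 0" for a using P_const that by blast
  next
    fix g h assume gh: "g \<in> F - {0}" "h \<in> F - {0}"
    then show "P (g * h) = P g + P h" using P_mult by blast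
    assume "g + h \<noteq> 0"
    then show "min (P g) (P h) \<le> P (g + h)"
      using P_add[of g h] P_add[of h g] gh by (auto simp: add.commute min_def)
  qed
  have "lies_over P"
  proof (rule lies_overI[OF place])
    have "to_ac w \<in> filt 1"
      using e_pos v0_w by (intro filt_to_ac) auto
    then have wq: "to_ac w \<in> filt 1" .
    have "to_ac w = t powi 1 * (t powi (-1) * to_ac w)" using t_nonzero by (simp add: power_int_minus)
    moreover have "t powi (-1) * to_ac w \<in> filt 0" using filt_t_powi[OF wq, of "-1"] by simp
    ultimately have "1 \<le> P (to_ac w)"
      using V_ge[OF VP[OF F_to_ac] S_1, of w "t powi (-1) * to_ac w" 1] w_nonzero by simp
    then show "P (to_ac w) > 0" by simp
  next
    fix r :: "'k poly fract" assume r: "r \<noteq> 0" "v0 r = 0"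
    have "to_ac r * to_ac (inverse r) = 1" using r by simp
    moreover have "to_ac (inverse r) \<in> filt 0" "to_ac r \<in> filt 0"
      by (intro filt_to_ac; use r v0_inverse in simp)+
    moreover have "to_ac r \<notin> q"
      using calculation q(4)[of "to_ac (inverse r)" "to_ac r"] q(5) by (auto simp: mult.commute simp del: to_ac_inverse)
    ultimately have "to_ac r \<in> S" unfolding S_def by blast
    then show "P (to_ac r) = 0" by (rule P_S)
  qed
  then show ?thesis using P_S[OF h0S] by blast
qed

text \<open>
  If the weight \<open>l\<close> of \<open>h\<close> is smaller than \<open>k\<close>, then \<open>t^(- l) h\<close> has weight exactly \<open>0\<close>, and a place
  at which it has value \<open>0\<close> gives \<open>h\<close> the value \<open>l\<close>. So no weight is lost by looking at the places
  only.
\<close>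

lemma filt_iff_places:
  "h \<in> filt k \<longleftrightarrow> h \<in> F \<and> (\<forall>P. lies_over P \<longrightarrow> h \<in> vge P k)"
proof
  assume "h \<in> filt k"
  then show "h \<in> F \<and> (\<forall>P. lies_over P \<longrightarrow> h \<in> vge P k)" using place_over(1) filt_subset_F by blast
next
  assume h: "h \<in> F \<and> (\<forall>P. lies_over P \<longrightarrow> h \<in> vge P k)"
  show "h \<in> filt k"
  proof (cases "h = 0")
    case True
    then show ?thesis using filt_0 by simp
  next
    case False
    have down: "h \<in> filt (k - int i) \<Longrightarrow> h \<in> filt k" for i
    proof (induction i)
      case (Suc i)
      define l where "l = k - int (Suc i)"
      have hl: "h \<in> filt l" using Suc.prems by (simp add: l_def)
      define h' where "h' = t powi (- l) * h"
      have h': "h' \<in> filt 0" using filt_t_powi[OF hl, of "- l"] by (simp add: h'_def)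
      have "h' \<in> filt 1"
      proof (rule ccontr)
        assume "h' \<notin> filt 1"
        then obtain P where P: "lies_over P" "P h' = 0" using exists_place_over h' by blast
        have "P h' = - l + P h"
          using h False t_F t_nonzero over_place[OF P(1)]
          by (simp add: h'_def place_mult F_powi place_powi place_t[OF P(1)])
        moreover have "k \<le> P h" using h P(1) False by (auto simp: vge_def)
        ultimately show False using P(2) by (simp add: l_def)
      qed
      then have "t powi l * h' \<in> filt (l + 1)" by (rule filt_t_powi)
      moreover have "t powi l * h' = h" using t_nonzero by (simp add: h'_def power_int_minus)
      ultimately have "h \<in> filt (k - int i)" by (simp add: l_def)
      then show ?case by (rule Suc.IH)
    qed simp
    obtain l where "h \<in> filt l" using filt_exhaust h by blast
    then have "h \<in> filt (k - int (nat (k - l)))" using filt_mono by fastforce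
    then show ?thesis by (rule down)
  qed
qed

end

section \<open>The places of the curve\<close>

lemma of_poly_add: "of_poly (p + q) = of_poly p + of_poly q"
  and of_poly_diff: "of_poly (p - q) = of_poly p - of_poly q"
  and of_poly_mult: "of_poly (p * q) = of_poly p * of_poly q"
  and of_poly_1: "of_poly 1 = 1"
  and of_poly_0: "of_poly 0 = 0"
  by (simp_all add: of_poly_def)

lemma of_poly_power: "of_poly (p ^ k) = of_poly p ^ k"
  by (induction k) (simp_all add: of_poly_1 of_poly_mult)

lemma of_poly_prod: "of_poly (prod p I) = (\<Prod>i\<in>I. of_poly (p i))"
  by (induction I rule: infinite_finite_induct) (simp_all add: of_poly_1 of_poly_mult)

lemma of_poly_eq_0_iff: "of_poly p = 0 \<longleftrightarrow> p = 0"
  by (simp add: of_poly_def)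

lemma of_poly_const: "of_poly [:a:] = const a"
  by (simp add: of_poly_def const_def)

lemma const_0: "const 0 = 0"
  by (simp add: const_def)

lemma const_eq_0_iff: "const a = 0 \<longleftrightarrow> a = 0"
  by (simp add: const_def)

lemma const_minus: "const (- a) = - const a"
  using const_add[of a "- a"] by (simp add: const_0 eq_neg_iff_add_eq_0 add.commute)

lemma const_diff: "const (a - b) = const a - const b"
  using const_add[of a "- b"] by (simp add: const_minus)

lemma const_power: "const (a ^ k) = const a ^ k"
  by (induction k) (simp_all add: const_1 const_mult)

lemma const_inverse: "const (inverse a) = inverse (const a)"
proof (cases "a = 0")
  case False
  then have "const a * const (inverse a) = 1" by (simp add: const_1 flip: const_mult)
  then show ?thesis by (metis inverse_unique)
qed (simp add: const_0)

lemma of_poly_linear: "of_poly [:- a, 1:] = x_fun - const a"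
proof -
  have "[:- a, 1:] = [:0, 1:] - [:a:]" by simp
  then show ?thesis by (simp only: of_poly_diff of_poly_const x_fun_def)
qed

lemma irreducible_linear: "irreducible [:- a, 1 :: 'k :: field:]"
  by (rule irreducible_linear_field_poly) simp

text \<open>
  Every irreducible factor of a denominator of \<open>r\<close> divides the numerator as well and can be
  cancelled.
\<close>

lemma pval_nonneg_imp_to_fract:
  fixes r :: "'k :: {field, finite} poly fract"
  assumes "\<And>p. irreducible p \<Longrightarrow> 0 \<le> pval p r" "r \<noteq> 0"
  shows "\<exists>a. r = to_fract a"
proof -
  have "\<exists>a. r = to_fract a" if "b \<noteq> 0" "r = to_fract a / to_fract b" for a b
    using that
  proof (induction "degree b" arbitrary: a b rule: less_induct)
    case less
    show ?case
    proof (cases "degree b = 0")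
      case True
      then obtain c where c: "b = [:c:]" using degree_eq_zeroE by blast
      then have "c \<noteq> 0" using less.prems by auto
      then have "a = [:c:] * smult (inverse c) a" by simp
      then have "to_fract a = to_fract b * to_fract (smult (inverse c) a)"
        unfolding c by (metis to_fract_mult)
      then have "r = to_fract (smult (inverse c) a)" using less.prems by (simp add: field_simps)
      then show ?thesis by blast
    next
      case False
      then obtain p where p: "irreducible p" "p dvd b" using exists_irreducible_dvd by blast
      have a0: "a \<noteq> 0" using less.prems assms(2) by auto
      have "1 \<le> pord p b" using pord_ge[OF p(1) less.prems(1), of 1] p(2) by simp
      moreover have "pval p r = int (pord p a) - int (pord p b)"
        using pval_quotient[OF p(1) a0 less.prems(1)] less.prems(2) by simp
      ultimately have "1 \<le> pord p a" using assms(1)[OF p(1)] by linarith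
      then have "p dvd a" using pord_power_dvd[OF p(1) a0, of 1] by simp
      then obtain a' b' where a'b': "a = p * a'" "b = p * b'" using p(2) by (auto elim!: dvdE)
      then have nz: "b' \<noteq> 0" "p \<noteq> 0" using less.prems by auto
      then have "degree b' < degree b"
        using irreducible_degree_pos[OF p(1)] by (simp add: a'b' degree_mult_eq)
      moreover have "r = to_fract a' / to_fract b'" using less.prems a'b' nz by simp
      ultimately show ?thesis using less.hyps nz by blast
    qed
  qed
  then show ?thesis by (metis fract_cases)
qed

context superelliptic
begin

lemma exists_local_data_finite:
  assumes "irreducible p"
  shows "\<exists>m. local_data f n (pval p) (to_fract p) m (if p dvd f then n else 1) (if p dvd f then 1 else 0)"
proof -
  obtain m where "base_valuation (pval p) (to_fract p) m" using base_valuation_pval[OF assms] by blast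
  then interpret base_valuation "pval p" "to_fract p" m .
  have "pval p ff = (if p dvd f then 1 else 0)"
    using pval_to_fract[OF assms f_nonzero] pord_f[OF assms] pord_eq_0_iff[OF assms f_nonzero] by simp
  then have "local_data f n (pval p) (to_fract p) m (if p dvd f then n else 1) (if p dvd f then 1 else 0)"
    by unfold_locales (use n_ge_2 in auto)
  then show ?thesis by blast
qed

abbreviation c :: nat where "c \<equiv> gcd n (degree f)"

lemma c_pos: "c > 0"
  using n_ge_2 by simp

lemma local_data_infinity:
  "local_data f n dval (1 / to_fract [:0, 1:]) (CARD('k) - 1) (n div c) (- int (degree f div c))"
proof -
  interpret base_valuation "dval :: 'k poly fract \<Rightarrow> int" "1 / to_fract [:0, 1:]" "CARD('k) - 1"
    by (rule base_valuation_dval)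
  show ?thesis
  proof
    show "n div c > 0" using n_ge_2 by (simp add: div_greater_zero_iff gcd_le1_nat)
    have "n * (degree f div c) = (n div c) * degree f"
      by (metis div_mult_swap dvd_div_mult gcd_dvd1 gcd_dvd2)
    then show "int n * - int (degree f div c) = int (n div c) * dval ff"
      using dval_to_fract[OF f_nonzero] by (simp flip: of_nat_mult)
    have "coprime (n div c) (degree f div c)"
      using n_ge_2 by (intro div_gcd_coprime) simp
    then show "coprime (int (n div c)) (- int (degree f div c))" by simp
  qed
qed

text \<open>
  At a pole of \<open>x\<close> the leading term of a polynomial has strictly the smallest value.
\<close>

lemma place_of_poly_infinite:
  assumes P: "P \<in> places n f" "P x < 0" and a: "a \<noteq> 0"
  shows "P (of_poly a) = int (degree a) * P x"
  using a
proof (induction a)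
  case (pCons u a)
  have eq: "of_poly (pCons u a) = x * of_poly a + const u"
  proof -
    have "pCons u a = [:0, 1:] * a + [:u:]" by simp
    then show ?thesis by (metis of_poly_add of_poly_mult of_poly_const x_fun_def)
  qed
  show ?case
  proof (cases "a = 0")
    case True
    then show ?thesis using place_const[OF P(1)] by (simp add: of_poly_const)
  next
    case False
    have x0: "x \<noteq> 0" by (simp add: x_fun_def of_poly_eq_0_iff)
    have nz: "x * of_poly a \<noteq> 0" using False x0 by (simp add: of_poly_eq_0_iff)
    have val: "P (x * of_poly a) = int (Suc (degree a)) * P x"
      using False x0 pCons.IH
      by (simp add: place_mult[OF P(1)] F_x F_of_poly of_poly_eq_0_iff algebra_simps)
    have "int (Suc (degree a)) * P x \<le> 1 * P x" using P(2) by (intro mult_right_mono_neg) auto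
    then have "const u \<in> vge P (int (Suc (degree a)) * P x + 1)"
      using P(2) by (intro vge_mono[OF P(1) vge_const[OF P(1)]]) linarith
    then show ?thesis
      using place_add_eq[OF P(1) F_mult[OF F_x F_of_poly] nz val] False by (simp add: eq)
  qed
qed simp

lemma x_nonzero: "x \<noteq> 0"
  by (simp add: x_fun_def of_poly_eq_0_iff)

lemma lies_over_infinity_iff:
  "local_data.lies_over f n dval P \<longleftrightarrow> P \<in> places n f \<and> P x < 0"
proof
  interpret local_data f n dval "1 / to_fract [:0, 1:]" "CARD('k) - 1" "n div c" "- int (degree f div c)"
    by (rule local_data_infinity)
  assume over: "lies_over P"
  have P: "P \<in> places n f" using over_place[OF over] .
  have "P (to_ac (to_fract [:0, 1:])) = int (n div c) * dval (to_fract [:0, 1 :: 'k:])"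
    using place_over(3)[OF over] by simp
  then have "P x = - int (n div c)" by (simp add: dval_to_fract x_fun_def of_poly_def)
  then show "P \<in> places n f \<and> P x < 0" using P e_pos by simp
next
  interpret local_data f n dval "1 / to_fract [:0, 1:]" "CARD('k) - 1" "n div c" "- int (degree f div c)"
    by (rule local_data_infinity)
  assume P: "P \<in> places n f \<and> P x < 0"
  then have P': "P \<in> places n f" by simp
  show "lies_over P"
  proof (rule lies_overI[OF P'])
    have "to_ac (1 / to_fract [:0, 1:]) = inverse x"
      by (simp add: x_fun_def of_poly_def divide_inverse)
    then show "P (to_ac (1 / to_fract [:0, 1:])) > 0"
      using P place_inverse[OF P' F_x x_nonzero] by simp
    fix r :: "'k poly fract" assume r: "r \<noteq> 0" "dval r = 0"
    obtain a b where ab: "b \<noteq> 0" "r = to_fract a / to_fract b" by (rule fract_cases)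
    have a: "a \<noteq> 0" using r ab by auto
    have "degree a = degree b" using dval_quotient[OF a ab(1)] r(2) ab(2) by simp
    moreover have "to_ac r = of_poly a / of_poly b" by (simp add: ab of_poly_def)
    ultimately show "P (to_ac r) = 0"
      using place_divide[OF P' F_of_poly F_of_poly] a ab(1) P
      by (simp add: of_poly_eq_0_iff place_of_poly_infinite)
  qed
qed

lemma place_infinite:
  assumes "P \<in> places n f" "P x < 0"
  shows "P x = - int (n div c)" "P y = - int (degree f div c)"
proof -
  interpret local_data f n dval "1 / to_fract [:0, 1:]" "CARD('k) - 1" "n div c" "- int (degree f div c)"
    by (rule local_data_infinity)
  have over: "lies_over P" using assms lies_over_infinity_iff by blast
  show "P y = - int (degree f div c)" by (rule place_over(2)[OF over])
  have "P (to_ac (to_fract [:0, 1:])) = int (n div c) * dval (to_fract [:0, 1 :: 'k:])"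
    using place_over(3)[OF over] by simp
  then show "P x = - int (n div c)" by (simp add: dval_to_fract x_fun_def of_poly_def)
qed

lemma x_vge_0: "P \<in> places n f \<Longrightarrow> \<not> P x < 0 \<Longrightarrow> x \<in> vge P 0"
  by (simp add: vge_def F_x)

lemma y_vge_0:
  assumes P: "P \<in> places n f" "\<not> P x < 0"
  shows "y \<in> vge P 0"
proof -
  have "of_poly f \<in> vge P 0" using vge_of_poly[OF P(1) x_vge_0[OF P]] .
  then have "0 \<le> int n * P y"
    using place_power[OF P(1) F_y y_nonzero, of n] y_power_n f_nonzero
    by (auto simp: vge_def of_poly_def)
  then have "0 \<le> P y" using n_ge_2 by (simp add: zero_le_mult_iff)
  then show ?thesis by (simp add: vge_def F_y)
qed

text \<open>
  A polynomial prime to \<open>p\<close> has value \<open>0\<close> at \<open>P\<close>, because one of its powers is congruent to \<open>1\<close>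
  modulo \<open>p\<close>.
\<close>

lemma lies_over_finite_iff:
  assumes p: "irreducible p"
  shows "local_data.lies_over f n (pval p) P \<longleftrightarrow> P \<in> places n f \<and> \<not> P x < 0 \<and> P (of_poly p) > 0"
proof -
  obtain m where "local_data f n (pval p) (to_fract p) m (if p dvd f then n else 1) (if p dvd f then 1 else 0)"
    using exists_local_data_finite[OF p] by blast
  then interpret local_data f n "pval p" "to_fract p" m "if p dvd f then n else 1" "if p dvd f then 1 else 0" .
  have p0: "p \<noteq> 0" using p by auto
  show ?thesis
  proof
    assume over: "lies_over P"
    have P: "P \<in> places n f" using over_place[OF over] .
    have pos: "P (of_poly p) > 0"
      using place_over(3)[OF over, of "to_fract p"] p0 v0_w e_pos by (simp add: of_poly_def)
    have "\<not> P x < 0"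
    proof
      assume "P x < 0"
      then have "P (of_poly p) = int (degree p) * P x" by (rule place_of_poly_infinite[OF P _ p0])
      then show False using pos \<open>P x < 0\<close> by (simp add: zero_less_mult_iff)
    qed
    then show "P \<in> places n f \<and> \<not> P x < 0 \<and> P (of_poly p) > 0" using P pos by simp
  next
    assume "P \<in> places n f \<and> \<not> P x < 0 \<and> P (of_poly p) > 0"
    then have P: "P \<in> places n f" "\<not> P x < 0" "P (of_poly p) > 0" by auto
    have poly0: "of_poly a \<in> vge P 0" for a using vge_of_poly[OF P(1) x_vge_0[OF P(1,2)]] .
    obtain l where l: "l > 0" "\<And>a. \<not> p dvd a \<Longrightarrow> p dvd a ^ l - 1"
      using exists_power_cong_1[OF p] by blast
    have dvd: "of_poly a \<in> vge P 1" if pa: "p dvd a" for a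
    proof -
      obtain b where "a = p * b" using pa by blast
      then show ?thesis using vge_mult[OF P(1), of "of_poly p" 1 "of_poly b" 0] poly0[of b] P(3)
        by (auto simp: of_poly_mult vge_def F_of_poly)
    qed
    have unit: "P (of_poly a) = 0" if a: "\<not> p dvd a" for a
    proof -
      have a0: "a \<noteq> 0" using a by auto
      have "of_poly (a ^ l - 1) \<in> vge P (0 + 1)" using dvd[OF l(2)[OF a]] by simp
      from place_add_eq[OF P(1) F_1 _ place_1[OF P(1)] this]
      have "P (of_poly a ^ l) = 0" by (simp add: of_poly_diff of_poly_power of_poly_1)
      then show ?thesis using place_power[OF P(1) F_of_poly, of a l] l(1) a0 by (simp add: of_poly_eq_0_iff)
    qed
    show "lies_over P"
    proof (rule lies_overI[OF P(1)])
      show "P (to_ac (to_fract p)) > 0" using P(3) by (simp add: of_poly_def)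
      fix r :: "'k poly fract" assume r: "r \<noteq> 0" "pval p r = 0"
      obtain a b where ab: "b \<noteq> 0" "r = to_fract a / to_fract b" by (rule fract_cases)
      have a: "a \<noteq> 0" using r ab by auto
      have eq: "pord p a = pord p b" using pval_quotient[OF p a ab(1)] r(2) ab(2) by simp
      obtain a' where a': "a = p ^ pord p a * a'" "\<not> p dvd a'" using pord_decompose[OF p a] by blast
      obtain b' where b': "b = p ^ pord p a * b'" "\<not> p dvd b'" using pord_decompose[OF p ab(1)] eq by auto
      have "b' \<noteq> 0" "a' \<noteq> 0" using a' b' by auto
      have "to_ac r = of_poly a / of_poly b" by (simp add: ab of_poly_def)
      also have "\<dots> = of_poly (p ^ pord p a) * of_poly a' / (of_poly (p ^ pord p a) * of_poly b')"
        by (metis a'(1) b'(1) of_poly_mult)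
      also have "\<dots> = of_poly a' / of_poly b'" using p0 by (simp add: of_poly_eq_0_iff)
      finally have eq: "to_ac r = of_poly a' / of_poly b'" .
      show "P (to_ac r) = 0"
        unfolding eq using place_divide[OF P(1) F_of_poly F_of_poly] unit[OF a'(2)] unit[OF b'(2)] \<open>b' \<noteq> 0\<close> \<open>a' \<noteq> 0\<close>
        by (simp add: of_poly_eq_0_iff)
    qed
  qed
qed

section \<open>The Riemann--Roch spaces of multiples of the divisor at infinity\<close>

definition weighted_span :: "int \<Rightarrow> 'k ambient set"
  where "weighted_span k = {\<Sum>j<n. of_poly (p j) * y ^ j | p.
    \<forall>j<n. p j = 0 \<or> int (n * degree (p j) + j * degree f) \<le> k}"

lemma n_div_c: "int n = int c * int (n div c)" and deg_div_c: "int (degree f) = int c * int (degree f div c)"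
  by (simp_all flip: of_nat_mult)

text \<open>
  For a function that is regular outside infinity, the places over an irreducible polynomial \<open>p\<close>
  show that the coefficient \<open>r\<close> of \<open>y^j\<close> has \<open>v(r) \<ge> 0\<close> if \<open>p\<close> does not divide \<open>f\<close>, and
  \<open>n v(r) + j \<ge> 0\<close> otherwise; the latter gives \<open>v(r) \<ge> 0\<close> too, since \<open>j < n\<close>. So the coefficients are
  polynomials, and the places at infinity bound their degrees.
\<close>

theorem riemann_roch_space_G_div:
  "riemann_roch_space n f (G_div n f s) = weighted_span (int c * s)"
proof (intro equalityI subsetI)
  fix h assume h: "h \<in> riemann_roch_space n f (G_div n f s)"
  then have hF: "h \<in> F" by (simp add: riemann_roch_space_def)
  obtain r where r: "h = lincomb r" using hF by (rule F_cases)
  have fin: "0 \<le> pval p (r j)" if p: "irreducible p" and j: "j < n" and nz: "r j \<noteq> 0" for p j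
  proof -
    obtain m where "local_data f n (pval p) (to_fract p) m (if p dvd f then n else 1) (if p dvd f then 1 else 0)"
      using exists_local_data_finite[OF p] by blast
    then interpret local_data f n "pval p" "to_fract p" m "if p dvd f then n else 1" "if p dvd f then 1 else 0" .
    have "h \<in> filt 0"
      unfolding filt_iff_places
    proof (intro conjI allI impI hF)
      fix P assume "lies_over P"
      then have "P \<in> places n f" "\<not> P x < 0" using lies_over_finite_iff[OF p] by auto
      then show "h \<in> vge P 0"
        using h by (auto simp: riemann_roch_space_def vge_def G_div_def D_inf_def)
    qed
    then obtain r' where r': "h = lincomb r'" "\<And>j. j < n \<Longrightarrow> r' j = 0 \<or>
        0 \<le> int (if p dvd f then n else 1) * pval p (r' j) + int j * (if p dvd f then 1 else 0)"
      by (rule filtE) blast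
    have "r' j = r j" using lincomb_eqD r r' j by metis
    then have *: "0 \<le> int (if p dvd f then n else 1) * pval p (r j) + int j * (if p dvd f then 1 else 0)"
      using r'(2)[OF j] nz by simp
    show ?thesis
    proof (rule ccontr)
      assume neg: "\<not> 0 \<le> pval p (r j)"
      then have "int n * pval p (r j) \<le> int n * (-1)" by (intro mult_left_mono) auto
      then show False using * j neg by (auto split: if_splits)
    qed
  qed
  have "\<exists>a. r j = to_fract a" if "j < n" for j
  proof (cases "r j = 0")
    case True
    then show ?thesis by (intro exI[of _ 0]) simp
  qed (use pval_nonneg_imp_to_fract fin that in blast)
  then obtain p where p: "\<And>j. j < n \<Longrightarrow> r j = to_fract (p j)" by metis
  have hp: "h = (\<Sum>j<n. of_poly (p j) * y ^ j)"
    unfolding r lincomb_def by (rule sum.cong) (simp_all add: p of_poly_def)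
  have "int (n * degree (p j) + j * degree f) \<le> int c * s" if j: "j < n" and nz: "p j \<noteq> 0" for j
  proof -
    interpret local_data f n dval "1 / to_fract [:0, 1:]" "CARD('k) - 1" "n div c" "- int (degree f div c)"
      by (rule local_data_infinity)
    have "h \<in> filt (- s)"
      unfolding filt_iff_places
    proof (intro conjI allI impI hF)
      fix P assume "lies_over P"
      then have "P \<in> places n f" "P x < 0" using lies_over_infinity_iff by auto
      then show "h \<in> vge P (- s)"
        using h by (auto simp: riemann_roch_space_def vge_def G_div_def D_inf_def)
    qed
    then obtain r' where r': "h = lincomb r'" "\<And>j. j < n \<Longrightarrow> r' j = 0 \<or>
        - s \<le> int (n div c) * dval (r' j) + int j * - int (degree f div c)"
      by (rule filtE) blast
    have "r' j = r j" using lincomb_eqD r r' j by metis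
    then have "- s \<le> int (n div c) * dval (r j) + int j * - int (degree f div c)"
      using r'(2)[OF j] nz p[OF j] by simp
    then have "int (n div c) * int (degree (p j)) + int j * int (degree f div c) \<le> s"
      using p[OF j] dval_to_fract[OF nz] by simp
    then have "int c * (int (n div c) * int (degree (p j)) + int j * int (degree f div c)) \<le> int c * s"
      by (rule mult_left_mono) simp
    moreover have "int c * (int (n div c) * int (degree (p j)) + int j * int (degree f div c)) =
        (int c * int (n div c)) * int (degree (p j)) + int j * (int c * int (degree f div c))"
      by (simp only: algebra_simps)
    ultimately show ?thesis using n_div_c deg_div_c by simp
  qed
  then have "\<forall>j<n. p j = 0 \<or> int (n * degree (p j) + j * degree f) \<le> int c * s" by blast
  then show "h \<in> weighted_span (int c * s)" unfolding weighted_span_def using hp by blast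
next
  fix h assume "h \<in> weighted_span (int c * s)"
  then obtain p where p: "h = (\<Sum>j<n. of_poly (p j) * y ^ j)"
    "\<And>j. j < n \<Longrightarrow> p j = 0 \<or> int (n * degree (p j) + j * degree f) \<le> int c * s"
    by (auto simp: weighted_span_def)
  have hF: "h \<in> F" unfolding p(1) by (intro F_sum F_mult F_of_poly F_power F_y)
  have "h \<in> vge P (- (G_div n f s P))" if P: "P \<in> places n f" for P
  proof (cases "P x < 0")
    case False
    then have "h \<in> vge P 0"
      unfolding p(1)
      by (intro vge_sum[OF P] vge_mult0[OF P] vge_of_poly[OF P] vge_power[OF P] x_vge_0[OF P] y_vge_0[OF P])
    then show ?thesis using False by (simp add: G_div_def D_inf_def)
  next
    case True
    have "h \<in> vge P (- s)"
      unfolding p(1)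
    proof (intro vge_sum[OF P])
      fix j assume j: "j \<in> {..<n}"
      show "of_poly (p j) * y ^ j \<in> vge P (- s)"
      proof (cases "p j = 0")
        case True
        then show ?thesis using vge_0[OF P] by (simp add: of_poly_0)
      next
        case False
        have "P (of_poly (p j) * y ^ j) = - (int (n div c) * int (degree (p j)) + int j * int (degree f div c))"
          using False y_nonzero place_infinite[OF P True]
          by (simp add: place_mult[OF P] place_power[OF P] F_of_poly F_power F_y of_poly_eq_0_iff
              place_of_poly_infinite[OF P True] algebra_simps)
        moreover have "int (n div c) * int (degree (p j)) + int j * int (degree f div c) \<le> s"
        proof -
          have "int c * (int (n div c) * int (degree (p j)) + int j * int (degree f div c)) =
              (int c * int (n div c)) * int (degree (p j)) + int j * (int c * int (degree f div c))"
            by (simp only: algebra_simps)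
          also have "\<dots> \<le> int c * s" using p(2)[of j] j False n_div_c deg_div_c by simp
          finally show ?thesis using c_pos by (simp only: mult_le_cancel_left_pos of_nat_0_less_iff)
        qed
        ultimately show ?thesis by (simp add: vge_def F_mult F_of_poly F_power F_y)
      qed
    qed
    then show ?thesis using True P by (simp add: G_div_def D_inf_def)
  qed
  then show "h \<in> riemann_roch_space n f (G_div n f s)"
    using hF by (force simp: riemann_roch_space_def vge_def)
qed

end

section \<open>Bases modulo a subspace\<close>

context vector_space
begin

lemma exists_basis_modulo:
  assumes "subspace U" "subspace W" "W \<subseteq> U"
  shows "\<exists>B. basis_modulo scale U W B"
proof -
  obtain BW where BW: "BW \<subseteq> W" "independent BW" "W \<subseteq> span BW"
    using maximal_independent_subset[of W] by blast
  have spW: "span BW = W" using BW assms(2) by (metis span_minimal subset_antisym)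
  obtain BU where BU: "BW \<subseteq> BU" "BU \<subseteq> U" "independent BU" "U \<subseteq> span BU"
    using maximal_independent_subset_extend[of BW U] BW assms by blast
  define B where "B = BU - BW"
  have "span (B \<union> W) = U"
  proof
    show "span (B \<union> W) \<subseteq> U" using BU assms by (intro span_minimal) (auto simp: B_def)
    have "BU \<subseteq> B \<union> W" using BW by (auto simp: B_def)
    then show "U \<subseteq> span (B \<union> W)" using BU(4) span_mono by blast
  qed
  moreover have "\<forall>b\<in>T. u b = 0" if T: "finite T" "T \<subseteq> B" "(\<Sum>b\<in>T. scale (u b) b) \<in> W" for T u
  proof -
    have "(\<Sum>b\<in>T. scale (u b) b) \<in> span BW" using T(3) spW by simp
    then obtain S w where S: "finite S" "S \<subseteq> BW" "(\<Sum>a\<in>S. scale (w a) a) = (\<Sum>b\<in>T. scale (u b) b)"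
      unfolding span_explicit by auto
    have disj: "S \<inter> T = {}" using S T by (auto simp: B_def)
    let ?g = "\<lambda>v. if v \<in> T then u v else - w v"
    have "(\<Sum>v\<in>T \<union> S. scale (?g v) v) = (\<Sum>v\<in>T. scale (?g v) v) + (\<Sum>v\<in>S. scale (?g v) v)"
      using S T disj by (intro sum.union_disjoint) auto
    also have "(\<Sum>v\<in>T. scale (?g v) v) = (\<Sum>b\<in>T. scale (u b) b)" by (rule sum.cong) auto
    also have "(\<Sum>v\<in>S. scale (?g v) v) = (\<Sum>v\<in>S. - scale (w v) v)"
      using disj by (intro sum.cong) auto
    also have "(\<Sum>b\<in>T. scale (u b) b) + \<dots> = 0" using S(3) by (simp add: sum_negf)
    finally have zero: "(\<Sum>v\<in>T \<union> S. scale (?g v) v) = 0" .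
    have "?g v = 0" if "v \<in> T \<union> S" for v
      by (rule independentD[OF BU(3) _ _ zero that]) (use S T BU BW in \<open>auto simp: B_def\<close>)
    then show ?thesis by (metis UnI1)
  qed
  ultimately show ?thesis unfolding basis_modulo_def by blast
qed

lemma quot_dim_eq_card:
  assumes "subspace U" "subspace W" "W \<subseteq> U"
  obtains B where "basis_modulo scale U W B" "quot_dim scale U W = card B"
  using someI_ex[OF exists_basis_modulo[OF assms]] by (auto simp: quot_dim_def)

end

section \<open>Values of functions at rational points\<close>

context superelliptic
begin

lemma valuation_ring_eq_vge: "valuation_ring n f P = vge P 0"
  by (simp add: valuation_ring_def vge_def)

lemma maximal_ideal_eq_vge: "maximal_ideal n f P = vge P 1"
  by (auto simp: maximal_ideal_def vge_def)

sublocale V: vector_space "fscale :: 'k \<Rightarrow> _"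
  by (rule vector_space_fscale)

text \<open>
  The relational form of the value: \<open>h\<close> is regular at \<open>P\<close> and its residue class is the constant \<open>a\<close>.
\<close>

definition has_value :: "'k place \<Rightarrow> 'k ambient \<Rightarrow> 'k \<Rightarrow> bool"
  where "has_value P h a \<longleftrightarrow> h \<in> F \<and> h - const a \<in> vge P 1"

context
  fixes P :: "'k place"
  assumes P: "P \<in> places n f"
begin

lemma subspace_vge: "V.subspace (vge P k)"
  by (rule V.subspaceI) (auto intro: vge_0[OF P] vge_add[OF P] vge_mult0[OF P vge_const[OF P]])

lemma const_in_vge_1_iff: "const a \<in> vge P 1 \<longleftrightarrow> a = 0"
  using place_const[OF P, of a] by (auto simp: vge_def F_const const_eq_0_iff)

lemma has_value_unique: "has_value P h a \<Longrightarrow> has_value P h b \<Longrightarrow> a = b"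
proof -
  assume "has_value P h a" "has_value P h b"
  then have "(h - const b) - (h - const a) \<in> vge P 1"
    unfolding has_value_def using vge_diff[OF P] by blast
  then have "const (a - b) \<in> vge P 1" by (simp add: const_diff)
  then show "a = b" using const_in_vge_1_iff by simp
qed

lemma value_at_eqI: "has_value P h a \<Longrightarrow> value_at n f h P = a"
  unfolding value_at_def maximal_ideal_eq_vge
  using has_value_unique[of h] by (intro the_equality) (auto simp: has_value_def)

lemma has_value_vge_0: "has_value P h a \<Longrightarrow> h \<in> vge P 0"
proof -
  assume "has_value P h a"
  then have "h - const a \<in> vge P 1" by (simp add: has_value_def)
  then have "h - const a \<in> vge P 0" by (rule vge_mono[OF P]) simp
  from vge_add[OF P this vge_const[OF P, of a]] show "h \<in> vge P 0" by simp
qed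

lemma has_value_0_iff: "has_value P h 0 \<longleftrightarrow> h \<in> vge P 1"
  by (auto simp: has_value_def const_0 vge_def)

lemma has_value_const: "has_value P (const a) a"
  by (simp add: has_value_def F_const vge_0[OF P])

lemma has_value_add: "has_value P g a \<Longrightarrow> has_value P h b \<Longrightarrow> has_value P (g + h) (a + b)"
proof -
  assume "has_value P g a" "has_value P h b"
  then have gh: "g \<in> F" "h \<in> F" "g - const a \<in> vge P 1" "h - const b \<in> vge P 1"
    by (auto simp: has_value_def)
  have eq: "(g + h) - const (a + b) = (g - const a) + (h - const b)" by (simp add: const_add)
  show "has_value P (g + h) (a + b)"
    unfolding has_value_def eq using gh F_add vge_add[OF P] by blast
qed

lemma has_value_mult: "has_value P g a \<Longrightarrow> has_value P h b \<Longrightarrow> has_value P (g * h) (a * b)"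
proof -
  assume gh: "has_value P g a" "has_value P h b"
  have "g * h - const (a * b) = h * (g - const a) + const a * (h - const b)"
    by (simp add: const_mult algebra_simps)
  also have "\<dots> \<in> vge P 1"
    using gh has_value_vge_0[OF gh(2)] vge_const[OF P]
    by (intro vge_add[OF P] vge_mult0[OF P]) (auto simp: has_value_def)
  finally show ?thesis using gh by (simp add: has_value_def F_mult)
qed

lemma has_value_sum: "(\<And>i. i \<in> I \<Longrightarrow> has_value P (h i) (a i)) \<Longrightarrow> has_value P (sum h I) (sum a I)"
  by (induction I rule: infinite_finite_induct)
    (use has_value_const[of 0] in \<open>auto simp: const_0 intro: has_value_add\<close>)

lemma has_value_power: "has_value P h a \<Longrightarrow> has_value P (h ^ k) (a ^ k)"
  by (induction k) (use has_value_const[of 1] in \<open>auto simp: const_1 intro: has_value_mult\<close>)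

lemma has_value_nonzero:
  assumes "has_value P h a" "a \<noteq> 0"
  shows "h \<noteq> 0" "P h = 0"
proof -
  have "h - const a \<in> vge P (0 + 1)" using assms by (simp add: has_value_def)
  moreover have "const a + (h - const a) = h" by simp
  ultimately show "h \<noteq> 0" "P h = 0"
    using place_add_eq[OF P F_const[of a] _ place_const[OF P]] assms(2) const_eq_0_iff by metis+
qed

lemma has_value_inverse:
  assumes h: "has_value P h a" and a: "a \<noteq> 0"
  shows "has_value P (inverse h) (inverse a)"
proof -
  have nz: "h \<noteq> 0" "P h = 0" using has_value_nonzero[OF assms] by auto
  have hF: "h \<in> F" using h by (simp add: has_value_def)
  have "inverse h \<in> vge P 0"
    using nz place_inverse[OF P hF nz(1)] by (simp add: vge_def F_inverse hF)
  then have "(inverse h * const (- inverse a)) * (h - const a) \<in> vge P 1"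
    using h by (intro vge_mult0[OF P] vge_const[OF P]) (auto simp: has_value_def)
  moreover have "inverse h - const (inverse a) = (inverse h * const (- inverse a)) * (h - const a)"
    unfolding const_minus const_inverse using nz(1) a const_eq_0_iff[of a] by (simp add: field_simps)
  ultimately show ?thesis by (simp add: has_value_def F_inverse hF)
qed

lemma has_value_of_poly:
  assumes "has_value P x a"
  shows "has_value P (of_poly p) (poly p a)"
proof (induction p)
  case 0
  then show ?case using has_value_const[of 0] by (simp add: of_poly_0 const_0)
next
  case (pCons u p)
  have "pCons u p = [:u:] + [:0, 1:] * p" by simp
  then have eq: "of_poly (pCons u p) = const u + x * of_poly p"
    by (metis of_poly_add of_poly_mult of_poly_const x_fun_def)
  have "has_value P (const u + x * of_poly p) (u + a * poly p a)"
    by (intro has_value_add has_value_mult has_value_const assms pCons.IH)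
  then show ?case unfolding eq by simp
qed

text \<open>
  If the residue field is spanned by a single class, then the class of \<open>1\<close> spans it.
\<close>

lemma place_degree_eq_1_iff:
  "place_degree n f P = 1 \<longleftrightarrow> (\<forall>h \<in> vge P 0. \<exists>a. has_value P h a)"
proof -
  let ?U = "vge P 0" and ?W = "vge P 1"
  have WU: "?W \<subseteq> ?U" using vge_mono[OF P] by auto
  obtain B where B: "basis_modulo fscale ?U ?W B" "place_degree n f P = card B"
    using V.quot_dim_eq_card[OF subspace_vge subspace_vge WU]
    unfolding place_degree_def valuation_ring_eq_vge maximal_ideal_eq_vge by blast
  have span: "V.span (B \<union> ?W) = ?U" and
    ind: "\<And>T u. finite T \<Longrightarrow> T \<subseteq> B \<Longrightarrow> (\<Sum>b\<in>T. fscale (u b) b) \<in> ?W \<Longrightarrow> \<forall>b\<in>T. u b = 0"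
    using B(1) by (auto simp: basis_modulo_def)
  have spanW: "V.span ?W = ?W" by (simp add: V.span_eq_iff subspace_vge)
  have one: "1 \<in> ?U" "1 \<notin> ?W" using place_1[OF P] by (auto simp: vge_def F_1)
  have F: "h \<in> F" if "h \<in> ?U" for h using that by (simp add: vge_def)
  show ?thesis
  proof
    assume "place_degree n f P = 1"
    then obtain b where b: "B = {b}" using B(2) card_1_singletonE by metis
    have ex: "\<exists>u. h - fscale u b \<in> ?W" if "h \<in> ?U" for h
    proof -
      have "h \<in> V.span (insert b ?W)" using that span b by simp
      then show ?thesis by (simp add: V.span_breakdown_eq spanW)
    qed
    obtain u where u: "1 - fscale u b \<in> ?W" using ex[OF one(1)] by blast
    have u0: "u \<noteq> 0" using u one(2) by (auto simp: const_0)
    show "\<forall>h\<in>?U. \<exists>a. has_value P h a"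
    proof
      fix h assume h: "h \<in> ?U"
      obtain w where w: "h - fscale w b \<in> ?W" using ex[OF h] by blast
      have "h - const (w / u) = (h - fscale w b) - const (w / u) * (1 - fscale u b)"
      proof -
        have "const (w / u) * const u = const w" using u0 by (simp flip: const_mult)
        then show ?thesis by (simp add: right_diff_distrib mult.assoc[symmetric])
      qed
      also have "\<dots> \<in> ?W" by (intro vge_diff[OF P] w vge_mult0[OF P vge_const[OF P] u])
      finally show "\<exists>a. has_value P h a" using F[OF h] by (auto simp: has_value_def)
    qed
  next
    assume all: "\<forall>h\<in>?U. \<exists>a. has_value P h a"
    have BU: "b \<in> ?U" if "b \<in> B" for b using that span V.span_base by blast
    obtain b where b: "b \<in> B"
    proof (cases "B = {}")
      case True
      then have "?U = ?W" using span spanW by simp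
      then show ?thesis using one by blast
    qed blast
    have "b' = b" if b': "b' \<in> B" for b'
    proof (rule ccontr)
      assume ne: "b' \<noteq> b"
      obtain u where u: "has_value P b u" using all BU[OF b] by blast
      obtain u' where u': "has_value P b' u'" using all BU[OF b'] by blast
      have "has_value P (fscale u' b + fscale (- u) b') (u' * u + (- u) * u')"
        by (intro has_value_add has_value_mult has_value_const u u')
      then have "(\<Sum>v\<in>{b, b'}. fscale (if v = b then u' else - u) v) \<in> ?W"
        using ne by (simp add: mult.commute has_value_0_iff)
      from ind[OF _ _ this] b b' ne have "u' = 0" by auto
      then have "(\<Sum>v\<in>{b'}. fscale 1 v) \<in> ?W" using u' by (simp add: has_value_0_iff const_1)
      from ind[OF _ _ this] b' show False by auto
    qed
    then have "B = {b}" using b by blast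
    then show "place_degree n f P = 1" using B(2) by simp
  qed
qed

end

lemma eval_points_iff:
  "P \<in> eval_points n f \<longleftrightarrow> P \<in> places n f \<and> x \<in> vge P 0 \<and> (\<forall>h \<in> vge P 0. \<exists>a. has_value P h a)"
  using place_degree_eq_1_iff by (auto simp: eval_points_def vge_def F_x x_nonzero)

lemma not_linear_dvd_f: "poly f a \<noteq> 0 \<Longrightarrow> \<not> [:- a, 1:] dvd f"
  by (simp add: poly_eq_0_iff_dvd)

lemma exists_local_data_unramified:
  assumes "poly f a \<noteq> 0"
  shows "\<exists>m. local_data f n (pval [:- a, 1:]) (to_fract [:- a, 1:]) m 1 0"
  using exists_local_data_finite[OF irreducible_linear[of a]] not_linear_dvd_f[OF assms] by simp

lemma lies_over_linear_iff:
  "local_data.lies_over f n (pval [:- a, 1:]) P \<longleftrightarrow> P \<in> places n f \<and> has_value P x a"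
proof -
  have nz: "x - const a \<noteq> 0" by (simp add: of_poly_eq_0_iff flip: of_poly_linear)
  have "x \<in> vge P 0" if "P \<in> places n f" "has_value P x a"
    using has_value_vge_0[OF that] .
  then show ?thesis
    unfolding lies_over_finite_iff[OF irreducible_linear] of_poly_linear
    using nz x_nonzero by (auto simp: has_value_def vge_def F_x F_diff F_const)
qed

text \<open>
  The coefficients of a function of weight at least \<open>0\<close> have no pole at \<open>a\<close>, so that \<open>a\<close> and \<open>b\<close>
  can be substituted for \<open>x\<close> and \<open>y\<close>.
\<close>

lemma filt_has_value:
  assumes h: "h \<in> local_data.filt f n (pval [:- a, 1:]) 1 0 0"
    and fa: "poly f a \<noteq> 0"
  shows "\<exists>u. \<forall>P\<in>places n f. has_value P x a \<longrightarrow> has_value P y b \<longrightarrow> has_value P h u"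
proof -
  let ?p = "[:- a, 1:]"
  obtain m where "local_data f n (pval ?p) (to_fract ?p) m 1 0"
    using exists_local_data_unramified[OF fa] by blast
  then interpret local_data f n "pval ?p" "to_fract ?p" m 1 0 .
  obtain r where r: "h = lincomb r" "\<And>j. j < n \<Longrightarrow> r j = 0 \<or> 0 \<le> int 1 * pval ?p (r j) + int j * 0"
    using h by (rule filtE) blast
  have "\<exists>u. \<forall>P\<in>places n f. has_value P x a \<longrightarrow> has_value P (to_ac (r j)) u" if j: "j < n" for j
  proof (cases "r j = 0")
    case True
    then show ?thesis using has_value_const[of _ 0] by (auto simp: const_0)
  next
    case False
    obtain A B where AB: "B \<noteq> 0" "r j = to_fract A / to_fract B" by (rule fract_cases)
    have A: "A \<noteq> 0" using False AB by auto
    have le: "pord ?p B \<le> pord ?p A"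
      using pval_quotient[OF irreducible_linear A AB(1), of a] r(2)[OF j] False AB(2) by simp
    obtain B' where B': "B = ?p ^ pord ?p B * B'" "\<not> ?p dvd B'"
      using pord_decompose[OF irreducible_linear AB(1)] by blast
    obtain A' where A': "A = ?p ^ pord ?p B * A'"
      using pord_power_dvd[OF irreducible_linear A le] by (rule dvdE)
    have "to_ac (r j) = of_poly A / of_poly B" by (simp add: AB of_poly_def)
    also have "\<dots> = of_poly (?p ^ pord ?p B) * of_poly A' / (of_poly (?p ^ pord ?p B) * of_poly B')"
      by (metis A' B'(1) of_poly_mult)
    also have "\<dots> = of_poly A' * inverse (of_poly B')" by (simp add: of_poly_eq_0_iff divide_inverse)
    finally have eq: "to_ac (r j) = of_poly A' * inverse (of_poly B')" .
    have "poly B' a \<noteq> 0" using B'(2) by (simp add: poly_eq_0_iff_dvd)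
    then show ?thesis
      unfolding eq by (intro exI[of _ "poly A' a * inverse (poly B' a)"])
        (auto intro!: has_value_mult has_value_inverse has_value_of_poly)
  qed
  then obtain u where u: "\<And>j P. j < n \<Longrightarrow> P \<in> places n f \<Longrightarrow> has_value P x a \<Longrightarrow> has_value P (to_ac (r j)) (u j)"
    by metis
  show ?thesis
    unfolding r(1) lincomb_def
    by (intro exI[of _ "\<Sum>j<n. u j * b ^ j"])
      (auto intro!: has_value_sum has_value_mult has_value_power u)
qed

text \<open>
  A function of value \<open>0\<close> is a quotient of two functions of weight at least \<open>0\<close> that have nonzero
  values, so it has a value in \<open>K\<close> as well.
\<close>

lemma eval_pointsI:
  assumes P: "P \<in> places n f" and x: "has_value P x a" and y: "has_value P y b" and fa: "poly f a \<noteq> 0"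
  shows "P \<in> eval_points n f"
proof -
  let ?p = "[:- a, 1:]"
  obtain m where "local_data f n (pval ?p) (to_fract ?p) m 1 0"
    using exists_local_data_unramified[OF fa] by blast
  then interpret local_data f n "pval ?p" "to_fract ?p" m 1 0 .
  have over: "lies_over P" using lies_over_linear_iff P x by blast
  have "\<exists>u. has_value P h u" if h: "h \<in> vge P 0" for h
  proof (cases "h \<in> vge P 1")
    case True
    then show ?thesis using has_value_0_iff[OF P] by blast
  next
    case False
    then have hF: "h \<in> F" "h \<noteq> 0" "P h = 0" using h by (auto simp: vge_def)
    obtain g h' where gh: "g \<in> filt 0" "h' \<in> filt 0" "g \<noteq> 0" "P g = 0" "g * h = t powi (P h) * h'"
      using unit_multiple_eq_power_t'[OF over hF(1,2)] by blast
    obtain u where u: "has_value P g u" using filt_has_value[OF gh(1) fa] P x y by blast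
    obtain u' where u': "has_value P h' u'" using filt_has_value[OF gh(2) fa] P x y by blast
    have "u \<noteq> 0"
      using u gh has_value_0_iff[OF P, of g] by (auto simp: vge_def)
    moreover have "h = h' * inverse g" using gh hF by (simp add: field_simps)
    ultimately show ?thesis using has_value_mult[OF P u' has_value_inverse[OF P u]] by blast
  qed
  then show ?thesis using eval_points_iff P has_value_vge_0[OF P x] by blast
qed

text \<open>
  The coordinates \<open>a\<close> and \<open>b\<close> determine which functions of weight at least \<open>0\<close> have value \<open>0\<close>. Every
  function is a quotient of two of these times a power of \<open>t\<close>, whose exponent is its value.
\<close>

lemma place_eqI:
  assumes P: "P \<in> places n f" "has_value P x a" "has_value P y b"
    and P': "P' \<in> places n f" "has_value P' x a" "has_value P' y b"
    and fa: "poly f a \<noteq> 0"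
  shows "P = P'"
proof
  fix h
  let ?p = "[:- a, 1:]"
  obtain m where "local_data f n (pval ?p) (to_fract ?p) m 1 0"
    using exists_local_data_unramified[OF fa] by blast
  then interpret local_data f n "pval ?p" "to_fract ?p" m 1 0 .
  have over: "lies_over P" "lies_over P'" using lies_over_linear_iff P P' by blast+
  show "P h = P' h"
  proof (cases "h \<in> F \<and> h \<noteq> 0")
    case False
    then show ?thesis using P P' by (auto simp: places_def)
  next
    case True
    then have hF: "h \<in> F" "h \<noteq> 0" by auto
    obtain g h' where gh: "g \<in> filt 0" "h' \<in> filt 0" "g \<noteq> 0" "h' \<noteq> 0" "P g = 0" "P h' = 0"
      "g * h = t powi (P h) * h'"
      using unit_multiple_eq_power_t'[OF over(1) hF] by blast
    have zero: "P' k = 0" if k: "k \<in> filt 0" "k \<noteq> 0" "P k = 0" for k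
    proof -
      obtain u where u: "has_value P k u" "has_value P' k u"
        using filt_has_value[OF k(1) fa] P P' by blast
      have "u \<noteq> 0" using u k has_value_0_iff[OF P(1), of k] by (auto simp: vge_def)
      then show ?thesis using has_value_nonzero[OF P'(1) u(2)] by blast
    qed
    have "P' (g * h) = P' h"
      using gh(1,3,5) zero hF filt_subset_F by (simp add: place_mult[OF P'(1)])
    moreover have "P' (t powi (P h) * h') = P h"
      using gh(2,4,6) zero[of h'] filt_subset_F t_F t_nonzero
      by (simp add: place_mult[OF P'(1)] place_powi[OF P'(1)] F_powi place_t[OF over(2)] del: One_nat_def)
    ultimately show ?thesis using gh(7) by simp
  qed
qed

text \<open>
  The function \<open>(y^n - b^n)/(y - b)\<close> has weight \<open>0\<close>, so there is a place above \<open>x = a\<close> at which it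
  does not vanish; there \<open>y - b\<close> vanishes together with \<open>f(x) - f(a)\<close>.
\<close>

lemma exists_place_at_point:
  assumes fa: "poly f a \<noteq> 0" and b: "b ^ n = poly f a"
  shows "\<exists>P\<in>places n f. has_value P x a \<and> has_value P y b"
proof -
  let ?p = "[:- a, 1:]"
  obtain m where "local_data f n (pval ?p) (to_fract ?p) m 1 0"
    using exists_local_data_unramified[OF fa] by blast
  then interpret local_data f n "pval ?p" "to_fract ?p" m 1 0 .
  define r where "r = (\<lambda>i. to_fract [:b ^ (n - Suc i):])"
  define h where "h = lincomb r"
  have nb: "b \<noteq> 0" using fa b n_ge_2 by (auto simp: power_0_left)
  have wt: "pval ?p (r i) = 0" for i
    using v0_const[of "b ^ (n - Suc i)"] nb by (simp add: r_def)
  have "h \<in> filt 0" unfolding h_def filt_def using wt by auto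
  moreover have "h \<notin> filt 1"
  proof
    assume "h \<in> filt 1"
    then obtain s where s: "h = lincomb s" "\<And>j. j < n \<Longrightarrow> s j = 0 \<or> 1 \<le> int 1 * pval ?p (s j) + int j * 0"
      by (rule filtE) blast
    have "s 0 = r 0" using lincomb_eqD[of s r 0] s(1) n_ge_2 by (simp add: h_def)
    then show False using s(2)[of 0] n_ge_2 wt[of 0] nb by (simp add: r_def)
  qed
  ultimately obtain P where P: "lies_over P" "P h = 0" using exists_place_over by blast
  have pl: "P \<in> places n f" "has_value P x a" using P(1) lies_over_linear_iff by blast+
  have hF: "h \<in> F" by (simp add: h_def F_eq_range_lincomb)
  have h0: "h \<noteq> 0" using \<open>h \<notin> filt 1\<close> filt_0 by auto
  have "(y - const b) * h = y ^ n - const b ^ n"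
    unfolding power_diff_sumr2 h_def lincomb_def
    by (simp add: r_def const_power flip: const_def)
  also have "\<dots> = of_poly f - const (poly f a)" by (simp add: y_power_n of_poly_def b flip: const_power)
  also have "\<dots> \<in> vge P 1" using has_value_of_poly[OF pl, of f] by (simp add: has_value_def)
  finally have "(y - const b) * h \<in> vge P 1" .
  moreover have "inverse h \<in> vge P 0"
    using place_inverse[OF pl(1) hF h0] P(2) by (simp add: vge_def F_inverse hF)
  ultimately have "inverse h * ((y - const b) * h) \<in> vge P 1" by (rule vge_mult0[OF pl(1), rotated])
  moreover have "inverse h * ((y - const b) * h) = y - const b" using h0 by simp
  ultimately have "has_value P y b" by (simp add: has_value_def F_y)
  then show ?thesis using pl by blast
qed

lemma eval_point_values:
  assumes P: "P \<in> eval_points n f"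
  shows "has_value P x (value_at n f x P)" "has_value P y (value_at n f y P)"
    "value_at n f y P ^ n = poly f (value_at n f x P)"
proof -
  have pl: "P \<in> places n f" "x \<in> vge P 0" and val: "\<And>h. h \<in> vge P 0 \<Longrightarrow> \<exists>a. has_value P h a"
    using P eval_points_iff by auto
  have "\<not> P x < 0" using pl x_nonzero by (auto simp: vge_def)
  then have "y \<in> vge P 0" using y_vge_0 pl by blast
  then show x: "has_value P x (value_at n f x P)" and y: "has_value P y (value_at n f y P)"
    using val[OF pl(2)] val value_at_eqI[OF pl(1)] by metis+
  have "has_value P (of_poly f) (value_at n f y P ^ n)"
    using has_value_power[OF pl(1) y, of n] by (simp add: y_power_n of_poly_def)
  then show "value_at n f y P ^ n = poly f (value_at n f x P)"
    using has_value_of_poly[OF pl(1) x] has_value_unique[OF pl(1)] by blast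
qed

end

section \<open>Hulls and excess: linear algebra\<close>

text \<open>
  The family \<open>w\<close> represents a basis of \<open>H / K\<close>. It is indexed by \<open>B\<close> because it will be the
  image of a basis of a different quotient, under a map that is injective only by virtue of
  these assumptions.
\<close>

lemma (in vector_space) dim_eq_dim_plus_card:
  assumes H: "subspace H" "finite H" and K: "subspace K" "K \<subseteq> H"
    and w: "\<And>b. b \<in> B \<Longrightarrow> w b \<in> H"
    and ind: "\<And>T u. finite T \<Longrightarrow> T \<subseteq> B \<Longrightarrow> (\<Sum>b\<in>T. scale (u b) (w b)) \<in> K \<Longrightarrow> \<forall>b\<in>T. u b = 0"
    and span: "H \<subseteq> span (w ` B \<union> K)"
  shows "dim H = dim K + card B"
proof -
  have inj: "inj_on w B"
  proof (rule inj_onI, rule ccontr)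
    fix b b' assume b: "b \<in> B" "b' \<in> B" "w b = w b'" "b \<noteq> b'"
    have "(\<Sum>v\<in>{b, b'}. scale (if v = b then 1 else - 1) (w v)) = 0" using b by simp
    also have "0 \<in> K" using K(1) by (rule subspace_0)
    finally have "\<forall>v\<in>{b, b'}. (if v = b then 1 else - 1) = (0 :: 'a)" using b by (intro ind) auto
    then show False by simp
  qed
  have finB: "finite B"
    using inj H(2) w by (meson finite_imageD finite_subset image_subsetI)
  obtain C where C: "C \<subseteq> K" "independent C" "K \<subseteq> span C" "card C = dim K"
    using basis_exists[of K] by blast
  have finC: "finite C" by (rule finite_subset[OF subset_trans[OF C(1) K(2)] H(2)])
  have disj: "C \<inter> w ` B = {}"
  proof (rule ccontr)
    assume "C \<inter> w ` B \<noteq> {}"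
    then obtain b where b: "b \<in> B" "w b \<in> C" by blast
    then have "(\<Sum>v\<in>{b}. scale 1 (w v)) \<in> K" using C(1) by auto
    then have "\<forall>v\<in>{b}. (1 :: 'a) = 0" using b by (intro ind) auto
    then show False by simp
  qed
  have indep: "independent (C \<union> w ` B)"
  proof (rule independent_if_scalars_zero)
    show "finite (C \<union> w ` B)" using finB finC by simp
    fix u v assume zero: "(\<Sum>x\<in>C \<union> w ` B. scale (u x) x) = 0" and v: "v \<in> C \<union> w ` B"
    have "(\<Sum>x\<in>C. scale (u x) x) + (\<Sum>x\<in>w ` B. scale (u x) x) = 0"
      using zero finB finC disj by (simp add: sum.union_disjoint)
    then have sum0: "(\<Sum>x\<in>C. scale (u x) x) + (\<Sum>b\<in>B. scale (u (w b)) (w b)) = 0"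
      using inj by (simp add: sum.reindex)
    have "(\<Sum>x\<in>C. scale (u x) x) \<in> K"
      using C(1) by (intro subspace_sum[OF K(1)] subspace_scale[OF K(1)]) auto
    then have "- (\<Sum>x\<in>C. scale (u x) x) \<in> K" by (rule subspace_neg[OF K(1)])
    moreover have "(\<Sum>b\<in>B. scale (u (w b)) (w b)) = - (\<Sum>x\<in>C. scale (u x) x)"
      using sum0 by (simp add: eq_neg_iff_add_eq_0 add.commute)
    ultimately have uB: "\<forall>b\<in>B. u (w b) = 0" using finB by (intro ind) auto
    then have "(\<Sum>x\<in>C. scale (u x) x) = 0" using sum0 by simp
    then have "\<forall>x\<in>C. u x = 0" using independentD[OF C(2) finC order.refl] by blast
    then show "u v = 0" using uB v by blast
  qed
  have "K \<subseteq> span (C \<union> w ` B)" using C(3) span_mono[of C "C \<union> w ` B"] by blast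
  moreover have "w ` B \<subseteq> span (C \<union> w ` B)" by (rule subset_trans[OF _ span_superset]) simp
  ultimately have "span (w ` B \<union> K) \<subseteq> span (C \<union> w ` B)" by (intro span_minimal) auto
  then have "card (C \<union> w ` B) = dim H"
    using indep span C(1) K(2) w by (intro basis_card_eq_dim) auto
  then show ?thesis
    using finB finC disj inj C(4) by (simp add: card_Un_disjoint card_image)
qed

text \<open>
  If a common value of the two images is written as \<open>ev u = ev v\<close>, then \<open>u - v\<close> lies in the kernel
  of \<open>ev\<close> on \<open>U + V\<close>. Modulo the sum of the kernels of \<open>ev\<close> on \<open>U\<close> and on \<open>V\<close> it determines the
  common value up to \<open>ev (U \<inter> V)\<close>, and every element of the kernel on \<open>U + V\<close> arises.
\<close>

theorem dim_image_Int_image: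
  fixes s1 :: "'a :: field \<Rightarrow> 'b :: ab_group_add \<Rightarrow> 'b" and s2 :: "'a \<Rightarrow> 'c :: ab_group_add \<Rightarrow> 'c"
  assumes "vector_space s1" "vector_space s2"
    and S: "module.subspace s1 S"
    and add: "\<And>g h. g \<in> S \<Longrightarrow> h \<in> S \<Longrightarrow> ev (g + h) = ev g + ev h"
    and scale: "\<And>a h. h \<in> S \<Longrightarrow> ev (s1 a h) = s2 a (ev h)"
    and U: "module.subspace s1 U" "U \<subseteq> S" and V: "module.subspace s1 V" "V \<subseteq> S"
    and fin: "finite (ev ` S)"
  shows "vector_space.dim s2 (ev ` U \<inter> ev ` V) = vector_space.dim s2 (ev ` (U \<inter> V)) +
    quot_dim s1 {h \<in> space_sum U V. ev h = 0} (space_sum {h \<in> U. ev h = 0} {h \<in> V. ev h = 0})"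
proof -
  interpret V1: vector_space s1 by fact
  interpret V2: vector_space s2 by fact
  have zero: "ev 0 = 0"
    using scale[OF V1.subspace_0[OF S], of 0] by simp
  have neg: "ev (- h) = - ev h" if "h \<in> S" for h
    using add[OF that V1.subspace_neg[OF S that]] zero by (simp add: eq_neg_iff_add_eq_0 add.commute)
  have diff: "ev (g - h) = ev g - ev h" if "g \<in> S" "h \<in> S" for g h
    using add[OF that(1) V1.subspace_neg[OF S that(2)]] neg that by simp
  have sum: "ev (\<Sum>b\<in>T. s1 (u b) (g b)) = (\<Sum>b\<in>T. s2 (u b) (ev (g b)))"
    if "\<And>b. b \<in> T \<Longrightarrow> g b \<in> S" for T u and g :: "'b \<Rightarrow> 'b"
    using that
  proof (induction T rule: infinite_finite_induct)
    case (insert b T)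
    have "ev (s1 (u b) (g b) + (\<Sum>b\<in>T. s1 (u b) (g b))) =
        ev (s1 (u b) (g b)) + ev (\<Sum>b\<in>T. s1 (u b) (g b))"
      using insert.prems by (intro add V1.subspace_scale[OF S] V1.subspace_sum[OF S]) auto
    then show ?case using insert scale by simp
  qed (simp_all add: zero)
  have image: "V2.subspace (ev ` X1)" if X1: "V1.subspace X1" "X1 \<subseteq> S" for X1
  proof (rule V2.subspaceI)
    show "0 \<in> ev ` X1" using zero V1.subspace_0[OF X1(1)] by (metis imageI)
  next
    fix p q assume "p \<in> ev ` X1" "q \<in> ev ` X1"
    then obtain g h where gh: "g \<in> X1" "h \<in> X1" "p = ev g" "q = ev h" by blast
    then have "p + q = ev (g + h)" using add[OF subsetD[OF X1(2)] subsetD[OF X1(2)]] by simp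
    then show "p + q \<in> ev ` X1" using V1.subspace_add[OF X1(1) gh(1,2)] by blast
  next
    fix a p assume "p \<in> ev ` X1"
    then obtain g where g: "g \<in> X1" "p = ev g" by blast
    then have "s2 a p = ev (s1 a g)" using scale[OF subsetD[OF X1(2)]] by simp
    then show "s2 a p \<in> ev ` X1" using V1.subspace_scale[OF X1(1) g(1)] by blast
  qed
  define U0 where "U0 = {h \<in> U. ev h = 0}"
  define V0 where "V0 = {h \<in> V. ev h = 0}"
  define Z where "Z = {h \<in> space_sum U V. ev h = 0}"
  define W where "W = space_sum U0 V0"
  have ker: "V1.subspace {h \<in> X1. ev h = 0}" if X1: "V1.subspace X1" "X1 \<subseteq> S" for X1
    using X1(2) zero add scale V1.subspace_0[OF X1(1)] V1.subspace_add[OF X1(1)] V1.subspace_scale[OF X1(1)]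
    by (intro V1.subspaceI) (auto simp: subset_iff)
  have sums: "space_sum X1 X2 = {a + b |a b. a \<in> X1 \<and> b \<in> X2}" for X1 X2 :: "'b set"
    by (simp add: space_sum_def)
  have UV: "V1.subspace (space_sum U V)" "space_sum U V \<subseteq> S"
    using V1.subspace_sums[OF U(1) V(1)] U(2) V(2) V1.subspace_add[OF S] by (auto simp: sums)
  have Z: "V1.subspace Z" unfolding Z_def by (rule ker[OF UV])
  have sub0: "V1.subspace U0" "V1.subspace V0"
    unfolding U0_def V0_def by (rule ker[OF U], rule ker[OF V])
  have W: "V1.subspace W"
    unfolding W_def sums by (rule V1.subspace_sums[OF sub0])
  have WZ: "W \<subseteq> Z"
  proof
    fix h assume "h \<in> W"
    then obtain g k where "h = g + k" "g \<in> U" "ev g = 0" "k \<in> V" "ev k = 0"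
      by (auto simp: W_def sums U0_def V0_def)
    then show "h \<in> Z" using U(2) V(2) add[of g k] by (auto simp: Z_def sums)
  qed
  obtain B where B: "basis_modulo s1 Z W B" "quot_dim s1 Z W = card B"
    using V1.quot_dim_eq_card[OF Z W WZ] by blast
  have spanB: "V1.span (B \<union> W) = Z" and
    indB: "\<And>T u. finite T \<Longrightarrow> T \<subseteq> B \<Longrightarrow> (\<Sum>b\<in>T. s1 (u b) b) \<in> W \<Longrightarrow> \<forall>b\<in>T. u b = 0"
    using B(1) by (auto simp: basis_modulo_def)
  have "\<exists>g k. g \<in> U \<and> k \<in> V \<and> b = g + k \<and> ev b = 0" if "b \<in> B" for b
  proof -
    have "b \<in> Z" using that spanB V1.span_base by blast
    then show ?thesis by (auto simp: Z_def sums)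
  qed
  then obtain gu gv where g: "\<And>b. b \<in> B \<Longrightarrow> gu b \<in> U" "\<And>b. b \<in> B \<Longrightarrow> gv b \<in> V"
    "\<And>b. b \<in> B \<Longrightarrow> b = gu b + gv b" "\<And>b. b \<in> B \<Longrightarrow> ev b = 0" by metis
  have gS: "gu b \<in> S" "gv b \<in> S" if "b \<in> B" for b using g that U(2) V(2) by auto
  have ev_gv: "ev (gu b) = - ev (gv b)" if "b \<in> B" for b
    using add[OF gS[OF that]] g(3,4)[OF that] by (simp add: eq_neg_iff_add_eq_0)
  have split: "(\<Sum>b\<in>T. s1 (u b) b) = (\<Sum>b\<in>T. s1 (u b) (gu b)) + (\<Sum>b\<in>T. s1 (u b) (gv b))"
    if "T \<subseteq> B" for T u
  proof -
    have "(\<Sum>b\<in>T. s1 (u b) b) = (\<Sum>b\<in>T. s1 (u b) (gu b) + s1 (u b) (gv b))"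
      using that g(3) by (intro sum.cong refl) (metis V1.scale_right_distrib subsetD)
    then show ?thesis by (simp add: sum.distrib)
  qed
  have sumU: "(\<Sum>b\<in>T. s1 (u b) (gu b)) \<in> U" and sumV: "(\<Sum>b\<in>T. s1 (u b) (gv b)) \<in> V"
    if "T \<subseteq> B" for T u
    using that g by (auto intro!: V1.subspace_sum[OF U(1)] V1.subspace_scale[OF U(1)]
        V1.subspace_sum[OF V(1)] V1.subspace_scale[OF V(1)])
  have ev_sum: "ev (\<Sum>b\<in>T. s1 (u b) (gu b)) = (\<Sum>b\<in>T. s2 (u b) (ev (gu b)))"
    "ev (\<Sum>b\<in>T. s1 (u b) (gv b)) = - (\<Sum>b\<in>T. s2 (u b) (ev (gu b)))" if T: "T \<subseteq> B" for T u
  proof -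
    show "ev (\<Sum>b\<in>T. s1 (u b) (gu b)) = (\<Sum>b\<in>T. s2 (u b) (ev (gu b)))"
      using T gS by (intro sum) auto
    have "ev (\<Sum>b\<in>T. s1 (u b) (gv b)) = (\<Sum>b\<in>T. s2 (u b) (ev (gv b)))"
      using T gS by (intro sum) auto
    also have "\<dots> = (\<Sum>b\<in>T. - s2 (u b) (ev (gu b)))"
      using T ev_gv by (intro sum.cong refl) auto
    finally show "ev (\<Sum>b\<in>T. s1 (u b) (gv b)) = - (\<Sum>b\<in>T. s2 (u b) (ev (gu b)))"
      by (simp add: sum_negf)
  qed
  have "V2.dim (ev ` U \<inter> ev ` V) = V2.dim (ev ` (U \<inter> V)) + card B"
  proof (rule V2.dim_eq_dim_plus_card[where w = "\<lambda>b. ev (gu b)"])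
    show "V2.subspace (ev ` U \<inter> ev ` V)"
      by (intro V2.subspace_inter image U V)
    show "finite (ev ` U \<inter> ev ` V)" using fin U(2) by (meson finite_Int finite_subset image_mono)
    show "V2.subspace (ev ` (U \<inter> V))"
      using U V by (intro image V1.subspace_inter) auto
    show "ev ` (U \<inter> V) \<subseteq> ev ` U \<inter> ev ` V" by blast
    show "ev (gu b) \<in> ev ` U \<inter> ev ` V" if b: "b \<in> B" for b
    proof -
      have "ev (gu b) = ev (- gv b)" using ev_gv[OF b] neg gS[OF b] by simp
      then show ?thesis using g(1,2)[OF b] V1.subspace_neg[OF V(1)] by blast
    qed
  next
    fix T u assume T: "finite T" "T \<subseteq> B" "(\<Sum>b\<in>T. s2 (u b) (ev (gu b))) \<in> ev ` (U \<inter> V)"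
    then obtain k where k: "k \<in> U" "k \<in> V" "(\<Sum>b\<in>T. s2 (u b) (ev (gu b))) = ev k" by blast
    let ?a = "\<Sum>b\<in>T. s1 (u b) (gu b)" and ?b = "\<Sum>b\<in>T. s1 (u b) (gv b)"
    have "?a - k \<in> U0" "?b + k \<in> V0"
      unfolding U0_def V0_def
      using diff[of ?a k] add[of ?b k] ev_sum[OF T(2)] k sumU[OF T(2)] sumV[OF T(2)] U V
        V1.subspace_diff[OF U(1)] V1.subspace_add[OF V(1)] by (auto simp: subset_iff)
    then have "(?a - k) + (?b + k) \<in> W" unfolding W_def sums by blast
    moreover have "(?a - k) + (?b + k) = (\<Sum>b\<in>T. s1 (u b) b)" by (simp add: split[OF T(2)])
    ultimately show "\<forall>b\<in>T. u b = 0" using indB[OF T(1,2), of u] by simp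
  next
    show "ev ` U \<inter> ev ` V \<subseteq> V2.span ((\<lambda>b. ev (gu b)) ` B \<union> ev ` (U \<inter> V))"
    proof
      fix h assume "h \<in> ev ` U \<inter> ev ` V"
      then obtain p q where pq: "p \<in> U" "q \<in> V" "h = ev p" "h = ev q" by blast
      have "p - q = p + (- q)" by simp
      then have "p - q \<in> space_sum U V"
        using pq V1.subspace_neg[OF V(1)] unfolding sums by blast
      moreover have "ev (p - q) = 0" using diff[of p q] pq U V by auto
      ultimately have "p - q \<in> V1.span (B \<union> W)" unfolding spanB by (simp add: Z_def)
      then obtain z w where zw: "z \<in> V1.span B" "w \<in> W" "p - q = z + w"
        unfolding V1.span_Un V1.span_eq_iff[THEN iffD2, OF W] by auto
      obtain T u where T: "finite T" "T \<subseteq> B" "z = (\<Sum>b\<in>T. s1 (u b) b)"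
        using zw(1) unfolding V1.span_explicit by auto
      obtain u0 v0 where uv: "u0 \<in> U" "ev u0 = 0" "v0 \<in> V" "ev v0 = 0" "w = u0 + v0"
        using zw(2) by (auto simp: W_def sums U0_def V0_def)
      let ?a = "\<Sum>b\<in>T. s1 (u b) (gu b)" and ?b = "\<Sum>b\<in>T. s1 (u b) (gv b)"
      define k where "k = p - (?a + u0)"
      have k': "k = q + (?b + v0)"
      proof -
        have "p - q = (?a + ?b) + (u0 + v0)" using zw(3) T(3) uv(5) split[OF T(2)] by simp
        then have "p = q + ((?a + ?b) + (u0 + v0))" by (simp add: algebra_simps)
        then show ?thesis by (simp add: k_def algebra_simps)
      qed
      have au: "?a + u0 \<in> U" using sumU[OF T(2)] uv(1) V1.subspace_add[OF U(1)] by blast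
      have "k \<in> U" unfolding k_def using V1.subspace_diff[OF U(1) pq(1) au] .
      moreover have "k \<in> V"
        unfolding k' using sumV[OF T(2)] uv(3) pq(2) V1.subspace_add[OF V(1)] by blast
      moreover have "h = ev k + (\<Sum>b\<in>T. s2 (u b) (ev (gu b)))"
      proof -
        have "ev k = ev p - ev (?a + u0)" unfolding k_def using au pq(1) U(2) by (intro diff) auto
        also have "ev (?a + u0) = ev ?a + ev u0" using sumU[OF T(2)] uv(1) U(2) by (intro add) auto
        finally show ?thesis using uv(2) pq(3) ev_sum(1)[OF T(2)] by simp
      qed
      moreover have "(\<Sum>b\<in>T. s2 (u b) (ev (gu b))) \<in> V2.span ((\<lambda>b. ev (gu b)) ` B \<union> ev ` (U \<inter> V))"
        using T(2) by (intro V2.span_sum V2.span_scale V2.span_base) auto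
      moreover have "ev k \<in> V2.span ((\<lambda>b. ev (gu b)) ` B \<union> ev ` (U \<inter> V))"
        using \<open>k \<in> U\<close> \<open>k \<in> V\<close> by (intro V2.span_base) auto
      ultimately show "h \<in> V2.span ((\<lambda>b. ev (gu b)) ` B \<union> ev ` (U \<inter> V))"
        by (metis V2.span_add)
    qed
  qed
  then show ?thesis using B(2) by (simp add: Z_def W_def U0_def V0_def)
qed

section \<open>Duality for codes on the points of \<open>b^n = f(a)\<close>\<close>

lemma prod_linear_dvd:
  fixes p :: "'k :: field poly"
  assumes "finite A" "\<And>a. a \<in> A \<Longrightarrow> poly p a = 0"
  shows "(\<Prod>a\<in>A. [:- a, 1:]) dvd p"
  using assms
proof (induction A arbitrary: p rule: finite_induct)
  case (insert a A)
  then have "[:- a, 1:] dvd p" by (simp add: poly_eq_0_iff_dvd)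
  then obtain r where r: "p = [:- a, 1:] * r" by (rule dvdE)
  have "poly r b = 0" if "b \<in> A" for b
  proof -
    have "poly p b = 0" using insert.prems that by blast
    then have "(b - a) * poly r b = 0" unfolding r by (simp add: algebra_simps)
    then show ?thesis using that insert.hyps by auto
  qed
  then have "(\<Prod>a\<in>A. [:- a, 1:]) dvd r" by (rule insert.IH)
  then show ?case
    unfolding r prod.insert[OF insert.hyps] by (rule mult_dvd_mono[OF dvd_refl])
qed simp

text \<open>
  A function on a finite field is a polynomial whose coefficients are its moments, up to sign and
  except for the constant one. The reason is that the sum of all \<open>b^i a^(q - 1 - i)\<close> is
  \<open>(b^q - a^q)/(b - a) = 1\<close> for \<open>a \<noteq> b\<close> and vanishes for \<open>a = b\<close>.
\<close>

lemma interpolation_by_moments: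
  fixes Z :: "'k :: {field, finite} \<Rightarrow> 'k"
  defines "mom \<equiv> \<lambda>i. \<Sum>a\<in>UNIV. Z a * a ^ i"
  defines "p \<equiv> [:mom 0:] - (\<Sum>i<CARD('k). monom (mom i) (CARD('k) - Suc i))"
  shows "poly p a = Z a"
    and "l < CARD('k) \<Longrightarrow> coeff p l = (if l = 0 then mom 0 else 0) - mom (CARD('k) - Suc l)"
    and "degree p \<le> CARD('k) - 1"
proof -
  let ?q = "CARD('k)"
  have S: "(\<Sum>i<?q. b ^ i * a ^ (?q - Suc i)) = (if b = a then 0 else 1)" for a b :: 'k
  proof (cases "b = a")
    case True
    have "(\<Sum>i<?q. b ^ i * a ^ (?q - Suc i)) = (\<Sum>i<?q. a ^ (?q - 1))"
      using True by (intro sum.cong refl) (simp flip: power_add)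
    also have "\<dots> = 0" using CHAR_dvd_CARD[where 'a = 'k] by (simp add: of_nat_eq_0_iff_char_dvd)
    finally show ?thesis using True by simp
  next
    case False
    have "b - a = b ^ ?q - a ^ ?q" by (simp add: power_CARD)
    also have "\<dots> = (b - a) * (\<Sum>i<?q. a ^ (?q - Suc i) * b ^ i)" by (rule power_diff_sumr2)
    finally have "(\<Sum>i<?q. a ^ (?q - Suc i) * b ^ i) = 1" using False by simp
    then show ?thesis using False by (simp add: mult.commute)
  qed
  have "poly p a = mom 0 - (\<Sum>i<?q. mom i * a ^ (?q - Suc i))"
    by (simp add: p_def poly_sum poly_monom)
  also have "(\<Sum>i<?q. mom i * a ^ (?q - Suc i)) = (\<Sum>i<?q. \<Sum>b\<in>UNIV. Z b * (b ^ i * a ^ (?q - Suc i)))"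
    by (simp add: mom_def sum_distrib_right mult.assoc)
  also have "\<dots> = (\<Sum>b\<in>UNIV. Z b * (\<Sum>i<?q. b ^ i * a ^ (?q - Suc i)))"
    unfolding sum_distrib_left by (rule sum.swap)
  also have "\<dots> = (\<Sum>b\<in>UNIV. Z b - (if b = a then Z b else 0))"
    unfolding S by (intro sum.cong refl) simp
  also have "\<dots> = mom 0 - Z a" by (simp add: mom_def sum_subtractf)
  finally show "poly p a = Z a" by simp
  show "coeff p l = (if l = 0 then mom 0 else 0) - mom (?q - Suc l)" if l: "l < ?q"
  proof -
    have "(\<Sum>i<?q. coeff (monom (mom i) (?q - Suc i)) l) = (\<Sum>i<?q. if i = ?q - Suc l then mom i else 0)"
      using l by (intro sum.cong refl) auto
    also have "\<dots> = mom (?q - Suc l)" using l by simp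
    finally show ?thesis by (simp add: p_def coeff_sum coeff_pCons split: nat.split)
  qed
  show "degree p \<le> ?q - 1"
    unfolding p_def
    by (intro degree_diff_le degree_sum_le) (auto intro: order.trans[OF degree_monom_le])
qed

locale point_code =
  fixes f :: "'k :: {field, finite} poly" and n d :: nat
    and I :: "'p set" and \<alpha> \<beta> :: "'p \<Rightarrow> 'k"
  assumes n_dvd: "n dvd CARD('k) - 1" and no_root: "poly f a \<noteq> 0"
    and bij: "bij_betw (\<lambda>i. (\<alpha> i, \<beta> i)) I {(a, b). b ^ n = poly f a}"
begin

definition bounded :: "int \<Rightarrow> (nat \<Rightarrow> 'k poly) \<Rightarrow> bool"
  where "bounded k p \<longleftrightarrow> (\<forall>j<n. p j = 0 \<or> int (n * degree (p j) + j * d) \<le> k)"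

definition poly_word :: "(nat \<Rightarrow> 'k poly) \<Rightarrow> 'p \<Rightarrow> 'k"
  where "poly_word p i = (\<Sum>j<n. poly (p j) (\<alpha> i) * \<beta> i ^ j)"

definition code :: "int \<Rightarrow> ('p \<Rightarrow> 'k) set"
  where "code k = {\<lambda>i. if i \<in> I then poly_word p i else 0 | p. bounded k p}"

abbreviation \<Delta> :: "'k set" where "\<Delta> \<equiv> Delta n f"

definition W :: "'k poly" where "W = (\<Prod>a\<in>\<Delta>. [:- a, 1:])"

text \<open>
  As \<open>W\<close> vanishes on \<open>\<Delta>\<close>, where the fibres are empty, sums over the points of a twisted word can be
  extended from the complement of \<open>\<Delta>\<close> to sums over all of \<open>K\<close>.
\<close>

definition twisted_code :: "int \<Rightarrow> ('p \<Rightarrow> 'k) set"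
  where "twisted_code k =
    {\<lambda>i. if i \<in> I then poly W (\<alpha> i) * poly_word p i / \<beta> i ^ (n - 1) else 0 | p. bounded k p}"

lemma n_pos: "n > 0"
  using n_dvd CARD_gt_1[where 'k = 'k] by (auto intro: gr0I)

lemma finite_I: "finite I"
  using bij_betw_finite[OF bij] by simp

lemma \<beta>_nonzero: "i \<in> I \<Longrightarrow> \<beta> i \<noteq> 0"
  using bij no_root[of "\<alpha> i"] n_pos by (force simp: bij_betw_def power_0_left)

lemma sum_points: "(\<Sum>i\<in>I. \<phi> (\<alpha> i) (\<beta> i)) = (\<Sum>a\<in>UNIV. \<Sum>b | b ^ n = poly f a. \<phi> a b)"
proof -
  have "(\<Sum>i\<in>I. \<phi> (\<alpha> i) (\<beta> i)) = (\<Sum>(a, b)\<in>{(a, b). b ^ n = poly f a}. \<phi> a b)"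
    using sum.reindex_bij_betw[OF bij, of "\<lambda>(a, b). \<phi> a b"] by simp
  also have "{(a, b). b ^ n = poly f a} = Sigma UNIV (\<lambda>a. {b. b ^ n = poly f a})" by auto
  finally show ?thesis by (simp add: sum.Sigma)
qed

lemma Delta_iff: "a \<in> \<Delta> \<longleftrightarrow> {b. b ^ n = poly f a} = {}"
proof -
  have "b \<noteq> 0" if "b ^ n = poly f a" for b using that no_root[of a] n_pos by (auto simp: power_0_left)
  then have "{b. b ^ n = poly f a} = {} \<longleftrightarrow> \<not> (\<exists>b. b \<noteq> 0 \<and> poly f a = b ^ n)"
    by (metis (mono_tags, lifting) Collect_empty_eq)
  then show ?thesis by (auto simp: Delta_def image_iff)
qed

lemma poly_W: "poly W a = 0 \<longleftrightarrow> a \<in> \<Delta>"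
  by (simp add: W_def poly_prod)

lemma degree_W: "degree W = card \<Delta>"
  unfolding W_def by (subst degree_prod_eq_sum_degree) simp_all

lemma W_nonzero: "W \<noteq> 0"
  by (auto simp: W_def)

text \<open>
  As \<open>b^n = f(a)\<close>, the summand is \<open>b^(j + l + 1)/f(a)\<close>, and the exponent \<open>j + l + 1\<close> lies between \<open>1\<close>
  and \<open>2 n - 1\<close>. So it is divisible by \<open>n\<close> only if it is equal to \<open>n\<close>.
\<close>

lemma sum_fibre:
  assumes "j < n" "l < n"
  shows "(\<Sum>b | b ^ n = poly f a. b ^ j * b ^ l / b ^ (n - 1)) =
    (if j + l = n - 1 \<and> a \<notin> \<Delta> then of_nat n else 0)"
proof -
  have eq: "b ^ j * b ^ l / b ^ (n - 1) = b ^ (j + l + 1) / poly f a" if "b ^ n = poly f a" for b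
  proof -
    have b: "b \<noteq> 0" using that no_root[of a] n_pos by (auto simp: power_0_left)
    have "b ^ n = b ^ (n - 1) * b" using n_pos by (metis power_minus_mult)
    then show ?thesis using b that by (simp add: power_add field_simps)
  qed
  have "(\<Sum>b | b ^ n = poly f a. b ^ j * b ^ l / b ^ (n - 1)) = (\<Sum>b | b ^ n = poly f a. b ^ (j + l + 1)) / poly f a"
    unfolding sum_divide_distrib by (rule sum.cong[OF refl eq]) simp
  also have "\<dots> = (if j + l = n - 1 \<and> a \<notin> \<Delta> then of_nat n else 0)"
  proof (cases "j + l = n - 1")
    case True
    then have "j + l + 1 = n" using n_pos by simp
    then have "(\<Sum>b | b ^ n = poly f a. b ^ (j + l + 1)) = of_nat (card {b. b ^ n = poly f a}) * poly f a"
      by simp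
    moreover have "card {b. b ^ n = poly f a} = (if a \<in> \<Delta> then 0 else n)"
      using card_nth_roots[OF n_dvd _ no_root[of a]] Delta_iff[of a] by auto
    ultimately show ?thesis using True no_root[of a] by simp
  next
    case False
    have "\<not> n dvd j + l + 1"
    proof
      assume "n dvd j + l + 1"
      then obtain k where k: "j + l + 1 = n * k" by (rule dvdE)
      have "k \<noteq> 0" by (rule notI) (use k in simp)
      have "n * k < n * 2" using k assms by linarith
      then have "k = 1" using \<open>k \<noteq> 0\<close> by simp
      then show False using k False by simp
    qed
    then have "(\<Sum>b | b ^ n = poly f a. b ^ (j + l + 1)) = 0"
      by (rule sum_power_nth_roots_eq_0[OF n_dvd])
    then show ?thesis using False by simp
  qed
  finally show ?thesis .
qed

lemma sum_twisted_product:
  "(\<Sum>i\<in>I. (poly W (\<alpha> i) * poly_word p i / \<beta> i ^ (n - 1)) * poly_word p' i) =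
    of_nat n * (\<Sum>j<n. \<Sum>a\<in>UNIV. poly (W * p j * p' (n - 1 - j)) a)"
proof -
  have "(\<Sum>i\<in>I. (poly W (\<alpha> i) * poly_word p i / \<beta> i ^ (n - 1)) * poly_word p' i) =
      (\<Sum>i\<in>I. \<Sum>j<n. \<Sum>l<n. poly (W * p j * p' l) (\<alpha> i) * (\<beta> i ^ j * \<beta> i ^ l / \<beta> i ^ (n - 1)))"
    by (simp add: poly_word_def sum_product sum_distrib_left sum_distrib_right sum_divide_distrib mult_ac)
  also have "\<dots> = (\<Sum>j<n. \<Sum>l<n. \<Sum>i\<in>I. poly (W * p j * p' l) (\<alpha> i) * (\<beta> i ^ j * \<beta> i ^ l / \<beta> i ^ (n - 1)))"
    by (subst sum.swap, intro sum.cong refl, rule sum.swap)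
  also have "\<dots> = (\<Sum>j<n. \<Sum>l<n. if l = n - 1 - j then of_nat n * (\<Sum>a\<in>UNIV. poly (W * p j * p' l) a) else 0)"
  proof (intro sum.cong refl)
    fix j l assume jl: "j \<in> {..<n}" "l \<in> {..<n}"
    have "(\<Sum>i\<in>I. poly (W * p j * p' l) (\<alpha> i) * (\<beta> i ^ j * \<beta> i ^ l / \<beta> i ^ (n - 1))) =
        (\<Sum>a\<in>UNIV. poly (W * p j * p' l) a * (\<Sum>b | b ^ n = poly f a. b ^ j * b ^ l / b ^ (n - 1)))"
      unfolding sum_distrib_left by (rule sum_points)
    also have "\<dots> = (\<Sum>a\<in>UNIV. if j + l = n - 1 then of_nat n * poly (W * p j * p' l) a else 0)"
    proof (intro sum.cong refl)
      fix a
      have "a \<in> \<Delta> \<Longrightarrow> poly W a = 0" using poly_W by blast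
      then show "poly (W * p j * p' l) a * (\<Sum>b | b ^ n = poly f a. b ^ j * b ^ l / b ^ (n - 1)) =
          (if j + l = n - 1 then of_nat n * poly (W * p j * p' l) a else 0)"
        using jl by (subst sum_fibre) auto
    qed
    also have "\<dots> = (if l = n - 1 - j then of_nat n * (\<Sum>a\<in>UNIV. poly (W * p j * p' l) a) else 0)"
    proof -
      have eq: "j + l = n - 1 \<longleftrightarrow> l = n - 1 - j" using jl by auto
      show ?thesis
        unfolding eq
        by (cases "l = n - 1 - j") (simp_all only: if_True if_False simp_thms sum_distrib_left sum.neutral_const)
    qed
    finally show "(\<Sum>i\<in>I. poly (W * p j * p' l) (\<alpha> i) * (\<beta> i ^ j * \<beta> i ^ l / \<beta> i ^ (n - 1))) =
        (if l = n - 1 - j then of_nat n * (\<Sum>a\<in>UNIV. poly (W * p j * p' l) a) else 0)" .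
  qed
  also have "\<dots> = (\<Sum>j<n. of_nat n * (\<Sum>a\<in>UNIV. poly (W * p j * p' (n - 1 - j)) a))"
    by (intro sum.cong refl) (use n_pos in \<open>simp add: if_distrib cong: if_cong\<close>)
  finally show ?thesis by (simp add: sum_distrib_left)
qed

text \<open>
  Orthogonality of characters on a fibre; it inverts the decomposition along the powers of \<open>y\<close>.
\<close>

lemma sum_inverse_powers:
  assumes "b ^ n = poly f a" "b' ^ n = poly f a"
  shows "(\<Sum>j<n. (b' / b) ^ j) = (if b' = b then of_nat n else 0)"
proof -
  have nz: "b \<noteq> 0" using assms no_root[of a] n_pos by (auto simp: power_0_left)
  show ?thesis
  proof (cases "b' = b")
    case True
    then show ?thesis using nz by simp
  next
    case False
    then have ne: "b' / b - 1 \<noteq> 0" using nz by simp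
    have "(b' / b - 1) * (\<Sum>j<n. (b' / b) ^ j) = (b' / b) ^ n - 1" by (simp add: power_diff_1_eq)
    also have "\<dots> = 0" using assms no_root[of a] by (simp add: power_divide)
    finally show ?thesis using ne False by simp
  qed
qed

text \<open>
  A twisted word pairs with a word to sums over \<open>K\<close> of polynomials of degree less than \<open>q - 1\<close>, which
  vanish. Conversely, decompose an orthogonal word along the powers of \<open>y\<close>. Orthogonality says that
  the \<open>j\<close>-th component has vanishing moments up to a bound, so the polynomial that interpolates it
  has small degree; it vanishes on \<open>\<Delta>\<close> and can be divided by \<open>W\<close>. The two degree bounds fit together
  exactly because all weights \<open>n i + j d\<close> are multiples of \<open>g\<close>.
\<close>

theorem dual_code_eq:
  assumes g: "g > 0" "g dvd n" "g dvd d" "int g dvd k"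
  defines "k' \<equiv> int n * (int CARD('k) - 1 - int (card \<Delta>)) + (int n - 1) * int d - int g - k"
  shows "dual_code I (code k) = twisted_code k'"
proof (intro equalityI subsetI)
  fix z assume "z \<in> twisted_code k'"
  then obtain p where z: "z = (\<lambda>i. if i \<in> I then poly W (\<alpha> i) * poly_word p i / \<beta> i ^ (n - 1) else 0)"
    and p: "bounded k' p" by (auto simp: twisted_code_def)
  have "(\<Sum>i\<in>I. z i * u i) = 0" if u_code: "u \<in> code k" for u
  proof -
    obtain p' where u: "u = (\<lambda>i. if i \<in> I then poly_word p' i else 0)" and p': "bounded k p'"
      using u_code by (auto simp: code_def)
    have "(\<Sum>a\<in>UNIV. poly (W * p j * p' (n - 1 - j)) a) = 0" if j: "j < n" for j
    proof (cases "p j = 0 \<or> p' (n - 1 - j) = 0")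
      case False
      define l where "l = n - 1 - j"
      have l: "l < n" "int l = int n - 1 - int j" using j by (auto simp: l_def)
      have b: "int (n * degree (p j) + j * d) \<le> k'" "int (n * degree (p' l) + l * d) \<le> k"
        using p[unfolded bounded_def, rule_format, OF j] p'[unfolded bounded_def, rule_format, OF l(1)] False
        unfolding l_def by blast+
      have ld: "int l * int d = (int n - 1) * int d - int j * int d" by (simp add: l(2) algebra_simps)
      have "int n * (int (degree (p j)) + int (degree (p' l))) \<le>
          int n * (int CARD('k) - 1 - int (card \<Delta>)) - int g"
        using b ld unfolding k'_def by (simp add: distrib_left)
      then have "int n * (int (degree (p j)) + int (degree (p' l))) < int n * (int CARD('k) - 1 - int (card \<Delta>))"
        using g(1) by linarith
      then have "int (degree (p j)) + int (degree (p' l)) < int CARD('k) - 1 - int (card \<Delta>)"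
        using n_pos by (simp only: mult_less_cancel_left_pos of_nat_0_less_iff)
      moreover have "degree (W * p j * p' l) = card \<Delta> + degree (p j) + degree (p' l)"
        using False W_nonzero by (simp add: degree_mult_eq degree_W l_def)
      ultimately have "degree (W * p j * p' l) < CARD('k) - 1" by linarith
      then show ?thesis unfolding l_def by (rule sum_poly_field_eq_0)
    qed auto
    then have "(\<Sum>i\<in>I. (poly W (\<alpha> i) * poly_word p i / \<beta> i ^ (n - 1)) * poly_word p' i) = 0"
      unfolding sum_twisted_product by simp
    then show ?thesis by (simp add: z u)
  qed
  then show "z \<in> dual_code I (code k)" by (auto simp: dual_code_def words_def z)
next
  fix z assume "z \<in> dual_code I (code k)"
  then have z0: "\<And>i. i \<notin> I \<Longrightarrow> z i = 0" and orth: "\<And>u. u \<in> code k \<Longrightarrow> (\<Sum>i\<in>I. z i * u i) = 0"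
    by (auto simp: dual_code_def words_def)
  let ?q = "CARD('k)"
  define \<zeta> where "\<zeta> = (\<lambda>a b. z (the_inv_into I (\<lambda>i. (\<alpha> i, \<beta> i)) (a, b)))"
  have \<zeta>: "z i = \<zeta> (\<alpha> i) (\<beta> i)" if "i \<in> I" for i
    unfolding \<zeta>_def using bij that by (subst the_inv_into_f_f[of "\<lambda>i. (\<alpha> i, \<beta> i)"]) (auto simp: bij_betw_def)
  define Z where "Z = (\<lambda>j a. \<Sum>b | b ^ n = poly f a. \<zeta> a b * b ^ j)"
  have ZD: "Z j a = 0" if "a \<in> \<Delta>" for j a using that by (simp add: Z_def Delta_iff)
  define mom where "mom = (\<lambda>j i. \<Sum>a\<in>UNIV. Z j a * a ^ i)"
  have mom0: "mom j i = 0" if ji: "j < n" "int (n * i + j * d) \<le> k" for j i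
  proof -
    define p where "p = (\<lambda>l. if l = j then monom (1 :: 'k) i else 0)"
    have "bounded k p" using ji by (simp add: bounded_def p_def degree_monom_eq)
    then have "(\<lambda>i. if i \<in> I then poly_word p i else 0) \<in> code k" unfolding code_def by blast
    from orth[OF this] have "0 = (\<Sum>i\<in>I. z i * poly_word p i)" by simp
    also have "\<dots> = (\<Sum>i'\<in>I. \<zeta> (\<alpha> i') (\<beta> i') * (\<alpha> i' ^ i * \<beta> i' ^ j))"
    proof (intro sum.cong refl)
      fix i' assume "i' \<in> I"
      have "poly_word p i' = (\<Sum>l<n. if l = j then \<alpha> i' ^ i * \<beta> i' ^ j else 0)"
        unfolding poly_word_def p_def by (intro sum.cong refl) (simp add: poly_monom)
      then show "z i' * poly_word p i' = \<zeta> (\<alpha> i') (\<beta> i') * (\<alpha> i' ^ i * \<beta> i' ^ j)"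
        using ji(1) \<zeta>[OF \<open>i' \<in> I\<close>] by simp
    qed
    also have "\<dots> = (\<Sum>a\<in>UNIV. \<Sum>b | b ^ n = poly f a. \<zeta> a b * (a ^ i * b ^ j))" by (rule sum_points)
    also have "\<dots> = mom j i" by (simp add: mom_def Z_def sum_distrib_left sum_distrib_right mult_ac)
    finally show ?thesis by simp
  qed
  define Zp where "Zp = (\<lambda>j. [:mom j 0:] - (\<Sum>i<?q. monom (mom j i) (?q - Suc i)))"
  have Zp: "poly (Zp j) a = Z j a"
    "l < ?q \<Longrightarrow> coeff (Zp j) l = (if l = 0 then mom j 0 else 0) - mom j (?q - Suc l)"
    "degree (Zp j) \<le> ?q - 1" for j a l
    using interpolation_by_moments[where Z = "Z j"] unfolding Zp_def mom_def by blast+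
  have "W dvd Zp j" for j
    unfolding W_def by (rule prod_linear_dvd) (auto simp: Zp ZD)
  then obtain r where r: "\<And>j. Zp j = W * r j" unfolding dvd_def by metis
  define p where "p = (\<lambda>l. smult (inverse (of_nat n)) (r (n - 1 - l)))"
  have n0: "of_nat n \<noteq> (0 :: 'k)" using of_nat_neq_0_of_dvd[OF n_dvd] .
  have q1: "?q > 1" by (rule CARD_gt_1)
  have bound: "int (n * degree (r j) + (n - 1 - j) * d) \<le> k'" if j: "j < n" and nz: "r j \<noteq> 0" for j
  proof -
    define D where "D = degree (Zp j)"
    have D: "D = card \<Delta> + degree (r j)" using nz W_nonzero by (simp add: D_def r degree_mult_eq degree_W)
    have Dq: "D < ?q" using Zp(3)[of j] q1 by (simp add: D_def)
    have "Zp j \<noteq> 0" using nz W_nonzero by (simp add: r)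
    then have lead: "coeff (Zp j) D \<noteq> 0" by (simp add: D_def)
    define i where "i = ?q - Suc D"
    have i: "int i = int ?q - 1 - int D" using Dq by (simp add: i_def)
    \<comment> \<open>The coefficient at \<open>D\<close> is minus the \<open>i\<close>-th moment, or a difference of two moments if \<open>D = 0\<close>.\<close>
    have "\<not> int (n * i + j * d) \<le> k"
    proof
      assume le: "int (n * i + j * d) \<le> k"
      have "int (n * 0 + j * d) \<le> int (n * i + j * d)" by simp
      then have "int (n * 0 + j * d) \<le> k" using le by linarith
      then have "mom j 0 = 0" "mom j i = 0" using mom0[OF j] le by blast+
      then show False using lead Zp(2)[OF Dq, of j] by (simp add: i_def split: if_splits)
    qed
    moreover have "int g dvd int (n * i + j * d) - k"
      using g by (intro dvd_diff) (auto intro!: dvd_add dvd_mult dvd_mult2 simp flip: of_nat_add of_nat_mult)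
    ultimately have "int g \<le> int (n * i + j * d) - k" by (intro zdvd_imp_le) auto
    moreover have "int (n * i + j * d) = int n * (int ?q - 1 - int (card \<Delta>)) - int n * int (degree (r j)) + int j * int d"
    proof -
      have i': "int i = (int ?q - 1 - int (card \<Delta>)) - int (degree (r j))" using i D by simp
      show ?thesis by (simp only: of_nat_add of_nat_mult i') (simp add: algebra_simps)
    qed
    moreover have "int (n * degree (r j) + (n - 1 - j) * d) = int n * int (degree (r j)) + (int n - 1) * int d - int j * int d"
    proof -
      have j': "int (n - 1 - j) = int n - 1 - int j" using j by simp
      show ?thesis by (simp only: of_nat_add of_nat_mult j') (simp add: algebra_simps)
    qed
    ultimately show ?thesis unfolding k'_def by linarith
  qed
  have "bounded k' p"
    unfolding bounded_def
  proof (intro allI impI)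
    fix l assume l: "l < n"
    show "p l = 0 \<or> int (n * degree (p l) + l * d) \<le> k'"
      using bound[of "n - 1 - l"] l n0 by (auto simp: p_def)
  qed
  moreover have "z = (\<lambda>i. if i \<in> I then poly W (\<alpha> i) * poly_word p i / \<beta> i ^ (n - 1) else 0)"
  proof
    fix i
    show "z i = (if i \<in> I then poly W (\<alpha> i) * poly_word p i / \<beta> i ^ (n - 1) else 0)"
    proof (cases "i \<in> I")
      case True
      let ?a = "\<alpha> i" and ?b = "\<beta> i"
      have pt: "?b ^ n = poly f ?a" using bij True by (auto simp: bij_betw_def)
      have b0: "?b \<noteq> 0" using \<beta>_nonzero[OF True] .
      have "poly_word p i = (\<Sum>j<n. poly (p (n - 1 - j)) ?a * ?b ^ (n - 1 - j))"
        unfolding poly_word_def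
        by (rule sum.reindex_bij_witness[of _ "\<lambda>j. n - 1 - j" "\<lambda>j. n - 1 - j"]) auto
      then have "poly W ?a * poly_word p i / ?b ^ (n - 1) =
          (\<Sum>j<n. poly W ?a * (poly (p (n - 1 - j)) ?a * ?b ^ (n - 1 - j)) / ?b ^ (n - 1))"
        by (simp add: sum_distrib_left sum_divide_distrib)
      also have "\<dots> = (\<Sum>j<n. inverse (of_nat n) * (Z j ?a / ?b ^ j))"
      proof (intro sum.cong refl)
        fix j assume j: "j \<in> {..<n}"
        have pw: "?b ^ (n - 1) = ?b ^ (n - 1 - j) * ?b ^ j" using j by (simp flip: power_add)
        have "poly W ?a * poly (r j) ?a = Z j ?a" using Zp(1)[of j ?a] by (simp add: r)
        moreover have "poly (p (n - 1 - j)) ?a = inverse (of_nat n) * poly (r j) ?a"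
          using j by (simp add: p_def)
        ultimately show "poly W ?a * (poly (p (n - 1 - j)) ?a * ?b ^ (n - 1 - j)) / ?b ^ (n - 1) =
            inverse (of_nat n) * (Z j ?a / ?b ^ j)"
          using b0 unfolding pw by (simp add: mult_ac)
      qed
      also have "\<dots> = inverse (of_nat n) * (\<Sum>j<n. \<Sum>b | b ^ n = poly f ?a. \<zeta> ?a b * (b / ?b) ^ j)"
        by (simp add: Z_def sum_distrib_left sum_divide_distrib power_divide)
      also have "(\<Sum>j<n. \<Sum>b | b ^ n = poly f ?a. \<zeta> ?a b * (b / ?b) ^ j) =
          (\<Sum>b | b ^ n = poly f ?a. \<zeta> ?a b * (\<Sum>j<n. (b / ?b) ^ j))"
        unfolding sum_distrib_left by (rule sum.swap)
      also have "\<dots> = (\<Sum>b | b ^ n = poly f ?a. if b = ?b then \<zeta> ?a b * of_nat n else 0)"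
        by (intro sum.cong refl) (simp add: sum_inverse_powers[OF pt])
      also have "\<dots> = \<zeta> ?a ?b * of_nat n" using pt by simp
      finally have "poly W ?a * poly_word p i / ?b ^ (n - 1) = \<zeta> ?a ?b" using n0 by simp
      then show ?thesis using \<zeta>[OF True] True by simp
    qed (simp add: z0)
  qed
  ultimately show "z \<in> twisted_code k'" unfolding twisted_code_def by blast
qed

end

section \<open>The divisors \<open>G_s\<close> and \<open>A_s\<close>\<close>

lemma exists_irreducible_factor_positive:
  fixes v :: "'k :: field poly \<Rightarrow> int"
  assumes mult: "\<And>a b. a \<noteq> 0 \<Longrightarrow> b \<noteq> 0 \<Longrightarrow> v (a * b) = v a + v b"
    and const: "\<And>u. u \<noteq> 0 \<Longrightarrow> v [:u:] = 0"
    and a: "v a > 0" "a \<noteq> 0"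
  shows "\<exists>p. irreducible p \<and> p dvd a \<and> v p > 0"
  using a
proof (induction "degree a" arbitrary: a rule: less_induct)
  case less
  show ?case
  proof (cases "degree a = 0")
    case True
    then obtain u where "a = [:u:]" using degree_eq_zeroE by blast
    then show ?thesis using less.prems const[of u] by simp
  next
    case False
    then obtain p where p: "irreducible p" "p dvd a" using exists_irreducible_dvd by blast
    then obtain b where b: "a = p * b" by blast
    have nz: "p \<noteq> 0" "b \<noteq> 0" using b less.prems by auto
    show ?thesis
    proof (cases "v p > 0")
      case True
      then show ?thesis using p by blast
    next
      case False
      then have "v b > 0" using mult[OF nz] b less.prems by simp
      moreover have "degree b < degree a"
        using irreducible_degree_pos[OF p(1)] nz by (simp add: b degree_mult_eq)
      ultimately obtain p' where "irreducible p'" "p' dvd b" "v p' > 0" using less.hyps nz by blast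
      then show ?thesis using b by auto
    qed
  qed
qed

lemma sum_fun_apply: "(\<Sum>i\<in>I. g i) z = (\<Sum>i\<in>I. g i z)"
  by (induction I rule: infinite_finite_induct) simp_all

context superelliptic
begin

lemma riemann_roch_space_iff:
  "h \<in> riemann_roch_space n f A \<longleftrightarrow> h \<in> F \<and> (\<forall>P\<in>places n f. h \<in> vge P (- A P))"
  by (force simp: riemann_roch_space_def vge_def)

lemma subspace_riemann_roch_space: "V.subspace (riemann_roch_space n f A)"
  by (rule V.subspaceI)
    (auto simp: riemann_roch_space_iff F_0 F_add F_mult F_const vge_0 intro: vge_add vge_mult0 vge_const)

text \<open>
  At a zero of \<open>f\<close> one irreducible factor of \<open>f\<close> vanishes; it divides \<open>f\<close> only once, so \<open>P\<close> is totally
  ramified and \<open>y\<close> is a uniformiser.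
\<close>

lemma place_y_finite:
  assumes P: "P \<in> places n f" "\<not> P x < 0"
  shows "P y = Ram n f P"
proof (cases "P (of_poly f) > 0")
  case True
  have "\<exists>p. irreducible p \<and> p dvd f \<and> P (of_poly p) > 0"
  proof (rule exists_irreducible_factor_positive)
    show "P (of_poly (a * b)) = P (of_poly a) + P (of_poly b)" if "a \<noteq> 0" "b \<noteq> 0" for a b
      using that place_mult[OF P(1) F_of_poly F_of_poly] by (simp add: of_poly_mult of_poly_eq_0_iff)
    show "P (of_poly [:u:]) = 0" for u using place_const[OF P(1)] by (simp add: of_poly_const)
  qed (use True f_nonzero in auto)
  then obtain p where p: "irreducible p" "p dvd f" "P (of_poly p) > 0" by blast
  obtain m where "local_data f n (pval p) (to_fract p) m (if p dvd f then n else 1) (if p dvd f then 1 else 0)"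
    using exists_local_data_finite[OF p(1)] by blast
  then interpret local_data f n "pval p" "to_fract p" m "if p dvd f then n else 1" "if p dvd f then 1 else 0" .
  have "lies_over P" using lies_over_finite_iff[OF p(1)] P p(3) by blast
  then have "P y = (if p dvd f then 1 else 0)" by (rule place_over(2))
  then show ?thesis using p(2) True P by (simp add: Ram_def)
next
  case False
  have "0 \<le> P (of_poly f)"
    using vge_of_poly[OF P(1) x_vge_0[OF P], of f] f_nonzero by (simp add: vge_def of_poly_eq_0_iff)
  then have "int n * P y = 0"
    using False place_power[OF P(1) F_y y_nonzero, of n] by (simp add: y_power_n of_poly_def)
  then show ?thesis using False n_ge_2 by (simp add: Ram_def)
qed

lemma x_minus_const: "x - const a \<noteq> 0" "x - const a \<in> F"
  using of_poly_eq_0_iff[of "[:- a, 1:]"] by (simp_all add: of_poly_linear F_diff F_x F_const)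

lemma fibre_finite:
  assumes P: "P \<in> places n f" "\<not> P x < 0"
  shows "fibre n f a P = P (x - const a)"
proof -
  have "x - const a \<in> vge P 0"
    using vge_diff[OF P(1) x_vge_0[OF P] vge_const[OF P(1)]] .
  then have "0 \<le> P (x - const a)" using x_minus_const by (simp add: vge_def)
  then show ?thesis using P by (simp add: fibre_def)
qed

lemma place_linear_infinite:
  assumes P: "P \<in> places n f" "P x < 0"
  shows "P (x - const a) = P x"
  using place_of_poly_infinite[OF P, of "[:- a, 1:]"] by (simp add: of_poly_linear)

text \<open>
  If \<open>f(a) = b0^n\<close> with \<open>b0 \<noteq> 0\<close>, then \<open>Y^n - f(a)\<close> splits over \<open>K\<close>, so at a place above \<open>a\<close> the
  function \<open>y\<close> has one of its roots as a value.
\<close>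

lemma place_above_nonDelta:
  assumes P: "P \<in> places n f" "has_value P x a" and fa: "poly f a \<noteq> 0" and a: "a \<notin> Delta n f"
  shows "P \<in> eval_points n f"
proof -
  obtain b0 where b0: "poly f a = b0 ^ n" using a by (auto simp: Delta_def)
  let ?B = "{b. b ^ n = poly f a}"
  have card: "card ?B = n" using card_nth_roots[OF n_dvd b0[symmetric] fa] .
  have nn: "\<not> P x < 0"
    using has_value_vge_0[OF P] x_nonzero by (auto simp: vge_def)
  define p where "p = (\<Prod>b\<in>?B. [:- const b, 1 :: 'k ambient:])"
  define r where "r = monom (1 :: 'k ambient) n - [:const (poly f a):]"
  have "p = r"
  proof (rule poly_eqI_degree_lead_coeff[where A = "const ` ?B" and n = n])
    have inj: "inj_on const ?B" by (auto simp: inj_on_def const_def)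
    show "card (const ` ?B) \<ge> n" using card by (simp add: card_image[OF inj])
    have deg: "degree p = n" unfolding p_def using card by (subst degree_prod_eq_sum_degree) simp_all
    then show "degree p \<le> n" by simp
    show "degree r \<le> n" by (simp add: r_def degree_diff_le degree_monom_eq)
    have "lead_coeff p = 1" unfolding p_def by (simp add: lead_coeff_prod)
    then show "coeff p n = coeff r n" using deg n_ge_2 by (simp add: r_def coeff_pCons split: nat.split)
    fix z assume "z \<in> const ` ?B"
    then show "poly p z = poly r z"
      by (auto simp: p_def r_def poly_prod poly_monom simp flip: const_power)
  qed
  then have "poly p y = poly r y" by simp
  then have prod: "(\<Prod>b\<in>?B. y - const b) = of_poly f - const (poly f a)"
    by (simp add: p_def r_def poly_prod poly_monom y_power_n of_poly_def)
  have "of_poly f - const (poly f a) \<in> vge P 1"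
    using has_value_of_poly[OF P, of f] by (simp add: has_value_def)
  then have in1: "(\<Prod>b\<in>?B. y - const b) \<in> vge P 1" by (simp add: prod)
  have "\<exists>b\<in>?B. y - const b \<in> vge P 1"
  proof (rule ccontr)
    assume no: "\<not> ?thesis"
    have yb: "y - const b \<in> vge P 0" for b
      using vge_diff[OF P(1) y_vge_0[OF P(1) nn] vge_const[OF P(1)]] .
    have z: "y - const b \<noteq> 0" "P (y - const b) = 0" if "b \<in> ?B" for b
      using no that yb[of b] by (auto simp: vge_def)
    have "P (\<Prod>b\<in>?B. y - const b) = (\<Sum>b\<in>?B. P (y - const b))"
      using z by (intro place_prod[OF P(1)]) (auto simp: F_diff F_y F_const)
    also have "\<dots> = 0" using z by (intro sum.neutral) auto
    finally have "P (\<Prod>b\<in>?B. y - const b) = 0" .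
    moreover have "(\<Prod>b\<in>?B. y - const b) \<noteq> 0" using z by auto
    ultimately show False using in1 by (simp add: vge_def)
  qed
  then obtain b where "has_value P y b" by (auto simp: has_value_def F_y)
  then show ?thesis using eval_pointsI[OF P _ fa] by blast
qed

lemma place_linear_eval_point:
  assumes P: "P \<in> eval_points n f" and fa: "\<And>a. poly f a \<noteq> 0"
  shows "P (x - const a) = (if a = value_at n f x P then 1 else 0)"
proof -
  have pl: "P \<in> places n f" using P eval_points_iff by blast
  define u where "u = value_at n f x P"
  have xu: "has_value P x u" using eval_point_values(1)[OF P] by (simp add: u_def)
  show ?thesis
  proof (cases "a = u")
    case True
    obtain m where "local_data f n (pval [:- u, 1:]) (to_fract [:- u, 1:]) m 1 0"
      using exists_local_data_unramified[OF fa] by blast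
    then interpret local_data f n "pval [:- u, 1:]" "to_fract [:- u, 1:]" m 1 0 .
    have "lies_over P" using lies_over_linear_iff pl xu by blast
    then have "P (to_ac (to_fract [:- u, 1:])) = int 1 * pval [:- u, 1:] (to_fract [:- u, 1:])"
      by (rule place_over(3)) simp
    then show ?thesis using True v0_w of_poly_linear[of u] by (simp add: of_poly_def u_def)
  next
    case False
    have "has_value P (x + const (- a)) (u + (- a))"
      by (intro has_value_add[OF pl] xu has_value_const[OF pl])
    then have "has_value P (x - const a) (u - a)" by (simp add: const_minus)
    then show ?thesis using has_value_nonzero(2)[OF pl] False by (simp add: u_def)
  qed
qed

definition w_fun :: "'k ambient"
  where "w_fun = of_poly (\<Prod>a\<in>Delta n f. [:- a, 1:])"

lemma w_fun_eq: "w_fun = (\<Prod>a\<in>Delta n f. x - const a)"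
  by (simp add: w_fun_def of_poly_prod of_poly_linear)

lemma w_fun_nonzero: "w_fun \<noteq> 0" and w_fun_F: "w_fun \<in> F"
  using x_minus_const by (auto simp: w_fun_eq intro: F_prod)

lemma place_w_fun: "P \<in> places n f \<Longrightarrow> P w_fun = (\<Sum>a\<in>Delta n f. P (x - const a))"
  unfolding w_fun_eq using x_minus_const by (intro place_prod) auto

end

locale rootless_superelliptic = superelliptic f n for f :: "'k :: {field, finite} poly" and n +
  assumes no_root: "poly f a \<noteq> 0"
begin

text \<open>
  Above \<open>a \<notin> \<Delta>\<close> all places are rational and unramified, so that \<open>D\<close> cancels the fibre. What
  remains of \<open>E\<close> are the fibres over \<open>\<Delta>\<close>, which make up the finite part of the divisor of \<open>w_fun\<close>.
\<close>

lemma E_div_finite: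
  assumes P: "P \<in> places n f" "\<not> P x < 0"
  shows "E_div n f P = P w_fun"
proof -
  have "(\<Sum>a\<in>UNIV. fibre n f a P) = (\<Sum>a\<in>UNIV. P (x - const a))"
    by (simp add: fibre_finite[OF P])
  also have "\<dots> = (\<Sum>a\<in>Delta n f. P (x - const a)) + (\<Sum>a\<in>- Delta n f. P (x - const a))"
    by (subst sum.union_disjoint[symmetric]) (auto intro: sum.cong)
  also have "(\<Sum>a\<in>- Delta n f. P (x - const a)) = D_div n f P"
  proof (cases "P \<in> eval_points n f")
    case True
    have "value_at n f x P \<notin> Delta n f"
    proof -
      have "value_at n f y P \<noteq> 0"
        using eval_point_values(3)[OF True] no_root n_ge_2 by (metis power_0_left not_numeral_le_zero)
      then show ?thesis using eval_point_values(3)[OF True, symmetric] by (auto simp: Delta_def)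
    qed
    then show ?thesis
      using place_linear_eval_point[OF True no_root] True by (simp add: D_div_def)
  next
    case False
    have "P (x - const a) = 0" if "a \<in> - Delta n f" for a
    proof -
      have "\<not> has_value P x a" using place_above_nonDelta[OF P(1) _ no_root] False that by blast
      then have "\<not> P (x - const a) \<ge> 1" using x_minus_const by (simp add: has_value_def vge_def F_x)
      moreover have "0 \<le> P (x - const a)"
        using vge_diff[OF P(1) x_vge_0[OF P] vge_const[OF P(1)], of a] x_minus_const by (simp add: vge_def)
      ultimately show ?thesis by simp
    qed
    then show ?thesis using False by (simp add: D_div_def)
  qed
  finally show ?thesis by (simp add: E_div_def sum_fun_apply place_w_fun[OF P(1)])
qed

lemma E_div_infinite:
  assumes P: "P \<in> places n f" "P x < 0"
  shows "E_div n f P = 0"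
proof -
  have "fibre n f a P = 0" for a
    using P by (simp add: fibre_def place_linear_infinite)
  moreover have "D_div n f P = 0" using P by (simp add: D_div_def eval_points_def)
  ultimately show ?thesis by (simp add: E_div_def sum_fun_apply)
qed

lemma Ram_infinite:
  assumes P: "P \<in> places n f" "P x < 0"
  shows "Ram n f P = 0"
  using place_of_poly_infinite[OF P f_nonzero] P by (simp add: Ram_def mult_nonneg_nonpos not_less)

lemma divisors_outside: "P \<notin> places n f \<Longrightarrow> G_div n f s P = 0 \<and> A_div n f s P = 0"
proof -
  assume P: "P \<notin> places n f"
  show ?thesis
    using P by (simp add: G_div_def A_div_def Ram_def D_inf_def E_div_def sum_fun_apply fibre_def D_div_def eval_points_def)
qed

lemma A_div_eq:
  assumes P: "P \<in> places n f"
  shows "A_div n f s P = (if P x < 0 then M_val n f - s else (int n - 1) * P y - P w_fun)"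
  using P E_div_finite[OF P] E_div_infinite[OF P] Ram_infinite[OF P] place_y_finite[OF P]
  by (simp add: A_div_def D_inf_def)

lemma G_div_eq: "P \<in> places n f \<Longrightarrow> G_div n f s P = (if P x < 0 then s else 0)"
  by (simp add: G_div_def D_inf_def)

text \<open>The divisors of \<open>s\<close> and \<open>M - s\<close> only differ by an exchange of their coefficients at infinity.\<close>

lemma inf_sup_symmetric:
  "inf (G_div n f s) (A_div n f s) = inf (G_div n f (M_val n f - s)) (A_div n f (M_val n f - s))"
  "sup (G_div n f s) (A_div n f s) = sup (G_div n f (M_val n f - s)) (A_div n f (M_val n f - s))"
proof -
  have "inf (G_div n f s P) (A_div n f s P) = inf (G_div n f (M_val n f - s) P) (A_div n f (M_val n f - s) P) \<and>
    sup (G_div n f s P) (A_div n f s P) = sup (G_div n f (M_val n f - s) P) (A_div n f (M_val n f - s) P)" for P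
  proof (cases "P \<in> places n f")
    case True
    then show ?thesis by (cases "P x < 0") (simp_all add: A_div_eq G_div_eq inf.commute sup.commute)
  qed (simp add: divisors_outside)
  then show "inf (G_div n f s) (A_div n f s) = inf (G_div n f (M_val n f - s)) (A_div n f (M_val n f - s))"
    "sup (G_div n f s) (A_div n f s) = sup (G_div n f (M_val n f - s)) (A_div n f (M_val n f - s))"
    by (auto simp: fun_eq_iff)
qed

definition dual_parameter :: "int \<Rightarrow> int"
  where "dual_parameter s = M_val n f - s + (int n - 1) * int (degree f div c) - int (card (Delta n f)) * int (n div c)"

text \<open>Multiplication by \<open>y^(n - 1)/w\<close> moves the finite part of \<open>A_s\<close> to infinity.\<close>

lemma riemann_roch_space_A_div:
  "riemann_roch_space n f (A_div n f s) =
    (\<lambda>h. h * (w_fun / y ^ (n - 1))) ` riemann_roch_space n f (G_div n f (dual_parameter s))"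
proof -
  define g where "g = w_fun / y ^ (n - 1)"
  have g: "g \<in> F" "g \<noteq> 0"
    using w_fun_nonzero y_nonzero by (auto simp: g_def intro: F_divide w_fun_F F_power F_y)
  have Pg: "A_div n f s P = G_div n f (dual_parameter s) P - P g" if P: "P \<in> places n f" for P
  proof -
    have "P g = P w_fun - (int n - 1) * P y"
      using w_fun_nonzero y_nonzero n_ge_2
      by (simp add: g_def place_divide[OF P] w_fun_F F_power F_y place_power[OF P] of_nat_diff)
    moreover have "P w_fun = - int (card (Delta n f)) * int (n div c)" if "P x < 0"
      using place_infinite[OF P that] by (simp add: place_w_fun[OF P] place_linear_infinite[OF P that])
    ultimately show ?thesis
      using place_infinite[OF P] by (simp add: A_div_eq[OF P] G_div_eq[OF P] dual_parameter_def)
  qed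
  have iff: "h * g \<in> riemann_roch_space n f (A_div n f s) \<longleftrightarrow> h \<in> riemann_roch_space n f (G_div n f (dual_parameter s))"
    if h: "h \<in> F" for h
  proof (cases "h = 0")
    case True
    then show ?thesis by (simp add: riemann_roch_space_def F_0)
  next
    case False
    have "(\<forall>P\<in>places n f. 0 \<le> P (h * g) + A_div n f s P) \<longleftrightarrow>
        (\<forall>P\<in>places n f. 0 \<le> P h + G_div n f (dual_parameter s) P)"
    proof (intro ball_cong refl)
      fix P assume P: "P \<in> places n f"
      show "0 \<le> P (h * g) + A_div n f s P \<longleftrightarrow> 0 \<le> P h + G_div n f (dual_parameter s) P"
        using place_mult[OF P h g(1) False g(2)] Pg[OF P] by simp
    qed
    then show ?thesis using False g h by (simp add: riemann_roch_space_def F_mult)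
  qed
  show ?thesis
    unfolding g_def[symmetric]
  proof (intro equalityI subsetI)
    fix h assume h: "h \<in> riemann_roch_space n f (A_div n f s)"
    then have hF: "h / g \<in> F" using g by (simp add: riemann_roch_space_def F_divide)
    have "h / g * g = h" using g by simp
    then show "h \<in> (\<lambda>h. h * g) ` riemann_roch_space n f (G_div n f (dual_parameter s))"
      using iff[OF hF] h by (metis image_eqI)
  next
    fix h assume "h \<in> (\<lambda>h. h * g) ` riemann_roch_space n f (G_div n f (dual_parameter s))"
    then obtain k where "h = k * g" "k \<in> riemann_roch_space n f (G_div n f (dual_parameter s))" by blast
    then show "h \<in> riemann_roch_space n f (A_div n f s)"
      using iff[of k] by (simp add: riemann_roch_space_def)
  qed
qed

section \<open>The codes\<close>

abbreviation D :: "'k place set" where "D \<equiv> eval_points n f"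

abbreviation \<alpha> :: "'k place \<Rightarrow> 'k" where "\<alpha> \<equiv> value_at n f x"
abbreviation \<beta> :: "'k place \<Rightarrow> 'k" where "\<beta> \<equiv> value_at n f y"

lemma D_place: "P \<in> D \<Longrightarrow> P \<in> places n f"
  using eval_points_iff by blast

lemma point_code_D: "point_code f n D \<alpha> \<beta>"
proof
  show "bij_betw (\<lambda>i. (\<alpha> i, \<beta> i)) D {(a, b). b ^ n = poly f a}"
  proof (rule bij_betw_imageI)
    show "inj_on (\<lambda>i. (\<alpha> i, \<beta> i)) D"
    proof (rule inj_onI)
      fix P P' assume PP: "P \<in> D" "P' \<in> D" "(\<alpha> P, \<beta> P) = (\<alpha> P', \<beta> P')"
      then show "P = P'"
        using place_eqI[OF D_place[OF PP(1)] eval_point_values(1,2)[OF PP(1)] D_place[OF PP(2)]]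
          eval_point_values(1,2)[OF PP(2)] no_root by simp
    qed
    show "(\<lambda>i. (\<alpha> i, \<beta> i)) ` D = {(a, b). b ^ n = poly f a}"
    proof (intro equalityI subsetI)
      fix z assume "z \<in> (\<lambda>i. (\<alpha> i, \<beta> i)) ` D"
      then show "z \<in> {(a, b). b ^ n = poly f a}" using eval_point_values(3) by auto
    next
      fix z assume "z \<in> {(a, b). b ^ n = poly f a}"
      then obtain a b where z: "z = (a, b)" "b ^ n = poly f a" by blast
      obtain P where P: "P \<in> places n f" "has_value P x a" "has_value P y b"
        using exists_place_at_point[OF no_root z(2)] by blast
      then have "P \<in> D" using eval_pointsI no_root by blast
      moreover have "\<alpha> P = a" "\<beta> P = b" using P value_at_eqI by blast+
      ultimately show "z \<in> (\<lambda>i. (\<alpha> i, \<beta> i)) ` D" using z(1) by force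
    qed
  qed
qed (use n_dvd no_root in auto)

sublocale C: point_code f n "degree f" D \<alpha> \<beta>
  by (rule point_code_D)

definition evaluate :: "'k ambient \<Rightarrow> 'k place \<Rightarrow> 'k"
  where "evaluate h = (\<lambda>P. if P \<in> D then value_at n f h P else 0)"

lemma AG_code_eq: "AG_code n f A = evaluate ` riemann_roch_space n f A"
  by (simp add: AG_code_def evaluate_def)

lemma has_value_poly_sum:
  assumes P: "P \<in> D"
  shows "has_value P (\<Sum>j<n. of_poly (p j) * y ^ j) (C.poly_word p P)"
  unfolding C.poly_word_def using D_place[OF P] eval_point_values[OF P]
  by (intro has_value_sum has_value_mult has_value_power has_value_of_poly)

lemma weighted_span_eq: "weighted_span k = {\<Sum>j<n. of_poly (p j) * y ^ j | p. C.bounded k p}"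
  by (simp add: weighted_span_def C.bounded_def)

lemma AG_code_G_div: "AG_code n f (G_div n f s) = C.code (int c * s)"
proof -
  have "evaluate (\<Sum>j<n. of_poly (p j) * y ^ j) = (\<lambda>P. if P \<in> D then C.poly_word p P else 0)" for p
    using value_at_eqI[OF D_place has_value_poly_sum] by (auto simp: evaluate_def fun_eq_iff)
  then show ?thesis
    unfolding AG_code_eq riemann_roch_space_G_div weighted_span_eq C.code_def by (force simp: image_iff)
qed

lemma AG_code_A_div: "AG_code n f (A_div n f s) = C.twisted_code (int c * dual_parameter s)"
proof -
  have "evaluate ((\<Sum>j<n. of_poly (p j) * y ^ j) * (w_fun / y ^ (n - 1))) =
      (\<lambda>P. if P \<in> D then poly C.W (\<alpha> P) * C.poly_word p P / \<beta> P ^ (n - 1) else 0)" for p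
  proof
    fix P
    show "evaluate ((\<Sum>j<n. of_poly (p j) * y ^ j) * (w_fun / y ^ (n - 1))) P =
      (if P \<in> D then poly C.W (\<alpha> P) * C.poly_word p P / \<beta> P ^ (n - 1) else 0)"
    proof (cases "P \<in> D")
      case True
      note pl = D_place[OF True]
      have "w_fun = of_poly C.W" by (simp add: w_fun_def C.W_def)
      then have "has_value P w_fun (poly C.W (\<alpha> P))"
        using has_value_of_poly[OF pl eval_point_values(1)[OF True]] by simp
      moreover have "has_value P (inverse (y ^ (n - 1))) (inverse (\<beta> P ^ (n - 1)))"
        using C.\<beta>_nonzero[OF True] eval_point_values(2)[OF True]
        by (intro has_value_inverse[OF pl] has_value_power[OF pl]) auto
      ultimately have "has_value P ((\<Sum>j<n. of_poly (p j) * y ^ j) * (w_fun * inverse (y ^ (n - 1))))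
          (C.poly_word p P * (poly C.W (\<alpha> P) * inverse (\<beta> P ^ (n - 1))))"
        by (intro has_value_mult[OF pl] has_value_poly_sum[OF True])
      from value_at_eqI[OF pl this] show ?thesis
        using True by (simp add: evaluate_def divide_inverse mult_ac)
    qed (simp add: evaluate_def)
  qed
  then show ?thesis
    unfolding AG_code_eq riemann_roch_space_A_div riemann_roch_space_G_div weighted_span_eq C.twisted_code_def
    by (force simp: image_iff)
qed

lemma c_mult_M_val: "int c * M_val n f = (int CARD('k) - 1) * int n - int c"
proof -
  have "int c dvd (int CARD('k) - 1) * int n" by (intro dvd_mult) (simp flip: of_nat_dvd_iff)
  then have "int c * ((int CARD('k) - 1) * int n div int c) = (int CARD('k) - 1) * int n"
    by (rule dvd_mult_div_cancel)
  then show ?thesis by (simp add: M_val_def right_diff_distrib)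
qed

lemma c_mult_dual_parameter:
  "int c * dual_parameter s =
    int n * (int CARD('k) - 1 - int (card (Delta n f))) + (int n - 1) * int (degree f) - int c - int c * s"
proof -
  have "int c * dual_parameter s = int c * M_val n f - int c * s +
      (int n - 1) * (int c * int (degree f div c)) - int (card (Delta n f)) * (int c * int (n div c))"
    by (simp add: dual_parameter_def algebra_simps)
  also have "\<dots> = (int CARD('k) - 1) * int n - int c - int c * s + (int n - 1) * int (degree f) -
      int (card (Delta n f)) * int n"
    by (simp only: c_mult_M_val n_div_c[symmetric] deg_div_c[symmetric])
  finally show ?thesis by (simp add: algebra_simps)
qed

theorem dual_AG_code: "dual_code D (AG_code n f (G_div n f s)) = AG_code n f (A_div n f s)"
  unfolding AG_code_G_div AG_code_A_div c_mult_dual_parameter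
  by (rule C.dual_code_eq) (use c_pos in auto)

section \<open>The dimension of the hull\<close>

lemma G_div_D: "P \<in> D \<Longrightarrow> G_div n f s P = 0"
  by (auto simp: G_div_def D_inf_def eval_points_def)

text \<open>
  This makes the code of \<open>A_s\<close> meaningful: functions in \<open>L(A_s)\<close> are regular at the points of \<open>D\<close>.
\<close>

lemma A_div_D:
  assumes P: "P \<in> D"
  shows "A_div n f s P = 0"
proof -
  note pl = D_place[OF P]
  have nn: "\<not> P x < 0" using P by (simp add: eval_points_def)
  have "P y = 0"
    using has_value_nonzero(2)[OF pl eval_point_values(2)[OF P]] C.\<beta>_nonzero[OF P] by blast
  moreover have "P w_fun = 0"
  proof -
    have "\<alpha> P \<notin> Delta n f" using C.Delta_iff eval_point_values(3)[OF P] by blast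
    then have "poly C.W (\<alpha> P) \<noteq> 0" using C.poly_W by blast
    moreover have "w_fun = of_poly C.W" by (simp add: w_fun_def C.W_def)
    ultimately show ?thesis
      using has_value_nonzero(2)[OF pl has_value_of_poly[OF pl eval_point_values(1)[OF P]]] by simp
  qed
  ultimately show ?thesis using nn by (simp add: A_div_eq[OF pl])
qed

definition regular :: "'k ambient set"
  where "regular = {h \<in> F. \<forall>P\<in>D. h \<in> vge P 0}"

lemma subspace_regular: "V.subspace regular"
proof (rule V.subspaceI)
  show "0 \<in> regular" by (auto simp: regular_def F_0 intro: vge_0 D_place)
  show "g + h \<in> regular" if "g \<in> regular" "h \<in> regular" for g h
    using that by (auto simp: regular_def F_add intro: vge_add D_place)
  show "fscale a h \<in> regular" if "h \<in> regular" for a h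
    using that vge_mult0[OF D_place vge_const[OF D_place]] by (auto simp: regular_def F_mult F_const)
qed

lemma regular_has_value: "h \<in> regular \<Longrightarrow> P \<in> D \<Longrightarrow> has_value P h (evaluate h P)"
proof -
  assume h: "h \<in> regular" "P \<in> D"
  then have "h \<in> vge P 0" by (simp add: regular_def)
  then obtain a where "has_value P h a" using iffD1[OF eval_points_iff h(2)] by blast
  then show ?thesis using value_at_eqI[OF D_place[OF h(2)]] h(2) by (simp add: evaluate_def)
qed

lemma evaluate_eqI:
  assumes "\<And>P. P \<in> D \<Longrightarrow> has_value P h (w P)" "\<And>P. P \<notin> D \<Longrightarrow> w P = 0"
  shows "evaluate h = w"
  using assms value_at_eqI D_place by (fastforce simp: evaluate_def fun_eq_iff)

lemma evaluate_outside: "P \<notin> D \<Longrightarrow> evaluate h P = 0"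
  by (simp add: evaluate_def)

lemma evaluate_add: "g \<in> regular \<Longrightarrow> h \<in> regular \<Longrightarrow> evaluate (g + h) = evaluate g + evaluate h"
  by (rule evaluate_eqI) (auto simp: evaluate_outside intro!: has_value_add D_place regular_has_value)

lemma evaluate_scale: "h \<in> regular \<Longrightarrow> evaluate (fscale a h) = wscale a (evaluate h)"
  by (rule evaluate_eqI)
    (auto simp: evaluate_outside intro!: has_value_mult has_value_const D_place regular_has_value)

lemma evaluate_eq_0_iff: "h \<in> regular \<Longrightarrow> evaluate h = 0 \<longleftrightarrow> (\<forall>P\<in>D. h \<in> vge P 1)"
proof -
  assume h: "h \<in> regular"
  have "evaluate h P = 0 \<longleftrightarrow> h \<in> vge P 1" if "P \<in> D" for P
    using regular_has_value[OF h that] has_value_0_iff[OF D_place[OF that], of h]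
      has_value_unique[OF D_place[OF that], of h] by metis
  moreover have "evaluate h = 0 \<longleftrightarrow> (\<forall>P\<in>D. evaluate h P = 0)"
    using evaluate_outside by (force simp: fun_eq_iff)
  ultimately show ?thesis by simp
qed

lemma finite_evaluate: "finite (range evaluate)"
proof -
  have fin: "finite D" by (rule C.finite_I)
  have "range evaluate \<subseteq> {w. \<forall>P. (P \<in> D \<longrightarrow> w P \<in> UNIV) \<and> (P \<notin> D \<longrightarrow> w P = 0)}"
    by (auto simp: evaluate_outside)
  then show ?thesis by (rule finite_subset) (intro finite_set_of_finite_funs fin finite)
qed

lemma riemann_roch_space_regular:
  assumes "\<And>P. P \<in> D \<Longrightarrow> A P = 0"
  shows "riemann_roch_space n f A \<subseteq> regular"
  using assms D_place by (fastforce simp: riemann_roch_space_iff regular_def)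

text \<open>Subtracting \<open>D\<close> means passing to the kernel of the evaluation.\<close>

lemma kernel_evaluate:
  assumes "\<And>P. P \<in> D \<Longrightarrow> A P = 0"
  shows "riemann_roch_space n f (A - D_div n f) = {h \<in> riemann_roch_space n f A. evaluate h = 0}"
proof (intro equalityI subsetI)
  fix h assume h: "h \<in> riemann_roch_space n f (A - D_div n f)"
  have "h \<in> vge P (- A P)" if P: "P \<in> places n f" for P
  proof -
    have "h \<in> vge P (- (A P - D_div n f P))" using h P by (simp add: riemann_roch_space_iff)
    then show ?thesis by (rule vge_mono[OF P]) (simp add: D_div_def)
  qed
  then have hA: "h \<in> riemann_roch_space n f A" using h by (simp add: riemann_roch_space_iff)
  then have "h \<in> regular" using riemann_roch_space_regular assms by blast
  moreover have "h \<in> vge P 1" if "P \<in> D" for P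
    using h assms[OF that] D_place[OF that] that by (auto simp: riemann_roch_space_iff D_div_def)
  ultimately show "h \<in> {h \<in> riemann_roch_space n f A. evaluate h = 0}" using hA evaluate_eq_0_iff by blast
next
  fix h assume "h \<in> {h \<in> riemann_roch_space n f A. evaluate h = 0}"
  then have h: "h \<in> riemann_roch_space n f A" "evaluate h = 0" by auto
  then have "h \<in> regular" using riemann_roch_space_regular assms by blast
  then have "h \<in> vge P 1" if "P \<in> D" for P using h(2) evaluate_eq_0_iff that by blast
  then have "h \<in> vge P (- (A P - D_div n f P))" if "P \<in> places n f" for P
    using h(1) assms that by (auto simp: riemann_roch_space_iff D_div_def)
  then show "h \<in> riemann_roch_space n f (A - D_div n f)" using h(1) by (simp add: riemann_roch_space_iff)
qed

lemma riemann_roch_space_inf: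
  "riemann_roch_space n f (inf A B) = riemann_roch_space n f A \<inter> riemann_roch_space n f B"
proof -
  have "- inf a b \<le> v \<longleftrightarrow> - a \<le> v \<and> - b \<le> v" for a b v :: int
    unfolding inf_min by linarith
  then show ?thesis by (auto simp: riemann_roch_space_iff vge_def)
qed

lemma space_sum_riemann_roch_space:
  "space_sum (riemann_roch_space n f A) (riemann_roch_space n f B) \<subseteq> riemann_roch_space n f (sup A B)"
proof
  fix h assume "h \<in> space_sum (riemann_roch_space n f A) (riemann_roch_space n f B)"
  then obtain g k where h: "h = g + k" and gk: "g \<in> riemann_roch_space n f A" "k \<in> riemann_roch_space n f B"
    by (auto simp: space_sum_def)
  have "h \<in> vge P (- sup A B P)" if P: "P \<in> places n f" for P
  proof -
    have "g \<in> vge P (- A P)" "k \<in> vge P (- B P)" using gk P by (auto simp: riemann_roch_space_iff)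
    then have "g \<in> vge P (- sup A B P)" "k \<in> vge P (- sup A B P)"
      using vge_mono[OF P, of g "- A P"] vge_mono[OF P, of k "- B P"] by auto
    then show ?thesis unfolding h by (rule vge_add[OF P])
  qed
  moreover have "h \<in> F" using gk by (simp add: h riemann_roch_space_iff F_add)
  ultimately show "h \<in> riemann_roch_space n f (sup A B)" by (simp add: riemann_roch_space_iff)
qed

theorem hull_dim_eq:
  "hull_dim n f s = vector_space.dim wscale (evaluate ` riemann_roch_space n f (inf (G_div n f s) (A_div n f s))) +
    excess n f (G_div n f s) (A_div n f s)"
proof -
  let ?G = "G_div n f s" and ?A = "A_div n f s"
  let ?U = "riemann_roch_space n f ?G" and ?V = "riemann_roch_space n f ?A"
  have zero: "sup ?G ?A P = 0" if "P \<in> D" for P using that by (simp add: G_div_D A_div_D)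
  have "vector_space.dim wscale (evaluate ` ?U \<inter> evaluate ` ?V) =
      vector_space.dim wscale (evaluate ` (?U \<inter> ?V)) +
      quot_dim fscale {h \<in> space_sum ?U ?V. evaluate h = 0} (space_sum {h \<in> ?U. evaluate h = 0} {h \<in> ?V. evaluate h = 0})"
  proof (rule dim_image_Int_image[where S = regular])
    show "finite (evaluate ` regular)" by (rule finite_subset[OF _ finite_evaluate]) auto
    show "?U \<subseteq> regular" "?V \<subseteq> regular" by (intro riemann_roch_space_regular G_div_D A_div_D; assumption)+
  qed (auto intro: vector_space_fscale vector_space_wscale subspace_regular subspace_riemann_roch_space
      evaluate_add evaluate_scale)
  moreover have "{h \<in> space_sum ?U ?V. evaluate h = 0} = space_sum ?U ?V \<inter> riemann_roch_space n f (sup ?G ?A - D_div n f)"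
    using space_sum_riemann_roch_space[of ?G ?A] kernel_evaluate[of "sup ?G ?A"] zero by auto
  moreover have "{h \<in> ?U. evaluate h = 0} = riemann_roch_space n f (?G - D_div n f)"
    using kernel_evaluate[of ?G] G_div_D by simp
  moreover have "{h \<in> ?V. evaluate h = 0} = riemann_roch_space n f (?A - D_div n f)"
    using kernel_evaluate[of ?A] A_div_D by simp
  ultimately show ?thesis
    unfolding hull_dim_def code_hull_def dual_AG_code
    unfolding AG_code_eq riemann_roch_space_inf excess_def by simp
qed

end

theorem proposition4p14:
  fixes f :: "'k :: {field, finite} poly" and n d :: nat and M :: int
  assumes "n \<ge> 2" and "d \<ge> 3"
    and "n dvd CARD('k) - 1"
    and "degree f = d"
    and "coprime f (pderiv f)"
    and "\<forall>a. poly f a \<noteq> 0"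
    and "M = M_val n f"
  shows "(\<forall>s \<in> {1..M - 1}.
      inf (G_div n f s) (A_div n f s) = inf (G_div n f (M - s)) (A_div n f (M - s)) \<and>
      sup (G_div n f s) (A_div n f s) = sup (G_div n f (M - s)) (A_div n f (M - s)) \<and>
      t_val n f s = t_val n f (M - s) \<and>
      int (hull_dim n f s) - int (hull_dim n f (M - s)) =
        int (excess n f (G_div n f s) (A_div n f s)) -
        int (excess n f (G_div n f (M - s)) (A_div n f (M - s)))) \<and>
    ((\<forall>s \<in> {1..M - 1}. excess n f (G_div n f s) (A_div n f s) = 0) \<longrightarrow>
      (\<forall>s \<in> {1..M - 1}. hull_dim n f s = hull_dim n f (M - s)))"
proof -
  interpret rootless_superelliptic f n
    using assms by unfold_locales auto
  note sym = inf_sup_symmetric[folded assms(7)]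
  have hull: "int (hull_dim n f s) - int (hull_dim n f (M - s)) =
      int (excess n f (G_div n f s) (A_div n f s)) -
      int (excess n f (G_div n f (M - s)) (A_div n f (M - s)))" for s
    using hull_dim_eq[of s] hull_dim_eq[of "M - s"] sym(1)[of s] by simp
  have t: "t_val n f s = t_val n f (M - s)" for s
    by (simp add: t_val_def mu_def assms(7) min.commute)
  have "hull_dim n f s = hull_dim n f (M - s)"
    if "\<forall>s \<in> {1..M - 1}. excess n f (G_div n f s) (A_div n f s) = 0" "s \<in> {1..M - 1}" for s
  proof -
    have "M - s \<in> {1..M - 1}" using that(2) by simp
    then have "excess n f (G_div n f (M - s)) (A_div n f (M - s)) = 0" "excess n f (G_div n f s) (A_div n f s) = 0"
      using that by blast+
    then show ?thesis using hull[of s] by simp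
  qed
  then show ?thesis using sym hull t by blast
qed

end
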